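(* Let $\phi:[-1,1]\to\mathbb{R}$ be a convex function (so that $e^{\phi}$ is log-convex) whose Lipschitz constant satisfies $L(\phi)<(1-\delta)\log n$ for some $\delta>0$. Then there exists a data structure that, for any $\epsilon>0$ and any set $X\subset\mathcal{S}^{d-1}$ of $n$ vectors, can provide a $(1\pm\epsilon)$-approximation to $Z_{\phi}(y)=\frac{1}{n}\sum_{x\in X}e^{\phi(\langle x,y\rangle)}$ for any query $y\in\mathcal{S}^{d-1}$, with constant probability, with query time $n^{1-\delta+o(1)}/\epsilon^{2}$ and using space/preprocessing time $n^{2-\delta+o(1)}/\epsilon^{2}$.
   Context: $\mathcal{S}^{d-1}$ is the unit sphere in $\mathbb{R}^d$. The Lipschitz constant $L(f)$ of $f:S\to\mathbb{R}$ is the minimum $L\ge 0$ with $|f(x)-f(y)|\le L|x-y|$ for all $x,y\in S$. A $(1\pm\epsilon)$-approximation to $\mu$ is a number $\hat\mu$ with $(1-\epsilon)\mu\le\hat\mu\le(1+\epsilon)\mu$.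
   Formalization: The time and space bounds are floored at n^{o(1)}, since for very large ε the stated bounds fall below one step; for ε ≤ 1 they are as stated. Vector operations in R^d (inner product, copy, Gaussian vector) cost one unit, and a stored vector takes one cell. *)

theory Defs
  imports "HOL-Probability.Probability"
begin

section \<open>Kernel sums on the unit sphere\<close>

text \<open>The dimension \<open>d\<close> is a number, not a type, because the \<open>o(1)\<close> terms have to be uniform
  in \<open>d\<close>. A vector of $\mathbb{R}^d$ is a function in \<open>{..<d} \<rightarrow>\<^sub>E UNIV\<close>, which is the space of
  the product measures \<open>\<Pi>\<^sub>M i\<in>{..<d}. M i\<close> used below for Gaussian vectors.\<close>

type_synonym rvec = "nat \<Rightarrow> real"

definition zero_rvec :: "nat \<Rightarrow> rvec" where
  "zero_rvec d = (\<lambda>i\<in>{..<d}. 0)"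

definition dotp :: "nat \<Rightarrow> rvec \<Rightarrow> rvec \<Rightarrow> real" where
  "dotp d x y = (\<Sum>i<d. x i * y i)"

definition unit_sphere :: "nat \<Rightarrow> rvec set" where
  "unit_sphere d = {x \<in> {..<d} \<rightarrow>\<^sub>E UNIV. dotp d x x = 1}"

definition kernel_mean :: "(real \<Rightarrow> real) \<Rightarrow> nat \<Rightarrow> rvec set \<Rightarrow> rvec \<Rightarrow> real" where
  "kernel_mean \<phi> d X y = (1 / real (card X)) * (\<Sum>x\<in>X. exp (\<phi> (dotp d x y)))"

text \<open>Only meaningful for functions that are Lipschitz on \<open>S\<close>.\<close>

definition lipschitz_const :: "real set \<Rightarrow> (real \<Rightarrow> real) \<Rightarrow> real" where
  "lipschitz_const S f = (LEAST L. L-lipschitz_on S f)"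

definition rel_approx :: "real \<Rightarrow> real \<Rightarrow> real \<Rightarrow> bool" where
  "rel_approx \<epsilon> \<mu> \<mu>' \<longleftrightarrow> (1 - \<epsilon>) * \<mu> \<le> \<mu>' \<and> \<mu>' \<le> (1 + \<epsilon>) * \<mu>"

section \<open>A randomized real RAM\<close>

text \<open>Programs are finite terms of a structured language with three memories: natural numbers
  (also serving as addresses), reals, and vectors of $\mathbb{R}^d$. One unit of time is charged for every
  operation, memory access and executed command. In particular one inner product, one copy of a
  vector and one Gaussian vector cost one unit each (multiply by \<open>d\<close> for a coordinatewise
  count), and so does one evaluation of \<open>\<phi>\<close>, which programs access as an oracle.

  There is no rounding from reals to naturals, no division of naturals, no access to
  coordinates, and no real constant other than those computed from naturals. So the usual ways of
  packing a lot of information into one cell and unpacking it again at unit cost are not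
  available.\<close>

datatype nexp =
    NConst nat
  | NLoad nexp
  | NAdd nexp nexp
  | NSub nexp nexp
  | NMul nexp nexp

datatype vexp =
    VLoad nexp
  | VInput nexp

datatype rexp =
    RNat nexp
  | RLoad nexp
  | RAdd rexp rexp
  | RSub rexp rexp
  | RMul rexp rexp
  | RDiv rexp rexp
  | RExp rexp
  | RLn rexp
  | RPhi rexp
  | RDot vexp vexp

datatype bexp =
    NLess nexp nexp
  | RLess rexp rexp
  | BNot bexp
  | BAnd bexp bexp

datatype com =
    Skip
  | NSet nexp nexp
  | RSet nexp rexp
  | VSet nexp vexp
  | RandNat nexp nexp
  | RandReal nexp
  | RandGauss nexp
  | Seq com com
  | Cond bexp com com
  | Loop bexp com

text \<open>\<open>inputs\<close> is a read-only array of vectors: the data set during preprocessing, and the query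
  point alone during a query. The two streams are the unused part of the random tapes.\<close>

record state =
  nmem :: "nat \<Rightarrow> nat"
  rmem :: "nat \<Rightarrow> real"
  vmem :: "nat \<Rightarrow> rvec"
  inputs :: "rvec list"
  utape :: "real stream"
  gtape :: "rvec stream"

primrec nval :: "nexp \<Rightarrow> state \<Rightarrow> nat" where
  "nval (NConst k) s = k"
| "nval (NLoad a) s = nmem s (nval a s)"
| "nval (NAdd a b) s = nval a s + nval b s"
| "nval (NSub a b) s = nval a s - nval b s"
| "nval (NMul a b) s = nval a s * nval b s"

primrec vval :: "nat \<Rightarrow> vexp \<Rightarrow> state \<Rightarrow> rvec" where
  "vval d (VLoad a) s = vmem s (nval a s)"
| "vval d (VInput a) s =
     (if nval a s < length (inputs s) then inputs s ! nval a s else zero_rvec d)"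

primrec rval :: "(real \<Rightarrow> real) \<Rightarrow> nat \<Rightarrow> rexp \<Rightarrow> state \<Rightarrow> real" where
  "rval \<phi> d (RNat a) s = real (nval a s)"
| "rval \<phi> d (RLoad a) s = rmem s (nval a s)"
| "rval \<phi> d (RAdd a b) s = rval \<phi> d a s + rval \<phi> d b s"
| "rval \<phi> d (RSub a b) s = rval \<phi> d a s - rval \<phi> d b s"
| "rval \<phi> d (RMul a b) s = rval \<phi> d a s * rval \<phi> d b s"
| "rval \<phi> d (RDiv a b) s = rval \<phi> d a s / rval \<phi> d b s"
| "rval \<phi> d (RExp a) s = exp (rval \<phi> d a s)"
| "rval \<phi> d (RLn a) s = ln (rval \<phi> d a s)"
| "rval \<phi> d (RPhi a) s = (if rval \<phi> d a s \<in> {-1..1} then \<phi> (rval \<phi> d a s) else 0)"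
| "rval \<phi> d (RDot u v) s = dotp d (vval d u s) (vval d v s)"

primrec bval :: "(real \<Rightarrow> real) \<Rightarrow> nat \<Rightarrow> bexp \<Rightarrow> state \<Rightarrow> bool" where
  "bval \<phi> d (NLess a b) s \<longleftrightarrow> nval a s < nval b s"
| "bval \<phi> d (RLess a b) s \<longleftrightarrow> rval \<phi> d a s < rval \<phi> d b s"
| "bval \<phi> d (BNot b) s \<longleftrightarrow> \<not> bval \<phi> d b s"
| "bval \<phi> d (BAnd b c) s \<longleftrightarrow> bval \<phi> d b s \<and> bval \<phi> d c s"

primrec ncost :: "nexp \<Rightarrow> nat" where
  "ncost (NConst k) = 1"
| "ncost (NLoad a) = 1 + ncost a"
| "ncost (NAdd a b) = 1 + ncost a + ncost b"
| "ncost (NSub a b) = 1 + ncost a + ncost b"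
| "ncost (NMul a b) = 1 + ncost a + ncost b"

primrec vcost :: "vexp \<Rightarrow> nat" where
  "vcost (VLoad a) = 1 + ncost a"
| "vcost (VInput a) = 1 + ncost a"

primrec rcost :: "rexp \<Rightarrow> nat" where
  "rcost (RNat a) = 1 + ncost a"
| "rcost (RLoad a) = 1 + ncost a"
| "rcost (RAdd a b) = 1 + rcost a + rcost b"
| "rcost (RSub a b) = 1 + rcost a + rcost b"
| "rcost (RMul a b) = 1 + rcost a + rcost b"
| "rcost (RDiv a b) = 1 + rcost a + rcost b"
| "rcost (RExp a) = 1 + rcost a"
| "rcost (RLn a) = 1 + rcost a"
| "rcost (RPhi a) = 1 + rcost a"
| "rcost (RDot u v) = 1 + vcost u + vcost v"

primrec bcost :: "bexp \<Rightarrow> nat" where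
  "bcost (NLess a b) = 1 + ncost a + ncost b"
| "bcost (RLess a b) = 1 + rcost a + rcost b"
| "bcost (BNot b) = 1 + bcost b"
| "bcost (BAnd b c) = 1 + bcost b + bcost c"

text \<open>\<open>exec \<phi> d m c s t s'\<close>: the program \<open>c\<close>, started in \<open>s\<close>, halts in \<open>s'\<close> after time \<open>t\<close>, where each
  of the three memories has only the \<open>m\<close> cells with addresses below \<open>m\<close>. A write to any other
  address blocks the execution, and the other cells keep their initial contents, so that \<open>m\<close>
  bounds the space (sparse use of a large address range is charged in full).\<close>

inductive exec ::
  "(real \<Rightarrow> real) \<Rightarrow> nat \<Rightarrow> nat \<Rightarrow> com \<Rightarrow> state \<Rightarrow> nat \<Rightarrow> state \<Rightarrow> bool"
  for \<phi> :: "real \<Rightarrow> real" and d m :: nat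
where
  Skip: "exec \<phi> d m Skip s 1 s"
| NSet: "nval a s < m \<Longrightarrow>
    exec \<phi> d m (NSet a e) s (1 + ncost a + ncost e)
      (s\<lparr>nmem := (nmem s)(nval a s := nval e s)\<rparr>)"
| RSet: "nval a s < m \<Longrightarrow>
    exec \<phi> d m (RSet a e) s (1 + ncost a + rcost e)
      (s\<lparr>rmem := (rmem s)(nval a s := rval \<phi> d e s)\<rparr>)"
| VSet: "nval a s < m \<Longrightarrow>
    exec \<phi> d m (VSet a e) s (1 + ncost a + vcost e)
      (s\<lparr>vmem := (vmem s)(nval a s := vval d e s)\<rparr>)"
| RandNat: "nval a s < m \<Longrightarrow>
    exec \<phi> d m (RandNat a e) s (1 + ncost a + ncost e)
      (s\<lparr>nmem := (nmem s)(nval a s := nat \<lfloor>shd (utape s) * real (nval e s)\<rfloor>),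
         utape := stl (utape s)\<rparr>)"
| RandReal: "nval a s < m \<Longrightarrow>
    exec \<phi> d m (RandReal a) s (1 + ncost a)
      (s\<lparr>rmem := (rmem s)(nval a s := shd (utape s)), utape := stl (utape s)\<rparr>)"
| RandGauss: "nval a s < m \<Longrightarrow>
    exec \<phi> d m (RandGauss a) s (1 + ncost a)
      (s\<lparr>vmem := (vmem s)(nval a s := shd (gtape s)), gtape := stl (gtape s)\<rparr>)"
| Seq: "exec \<phi> d m c1 s t1 s1 \<Longrightarrow> exec \<phi> d m c2 s1 t2 s2 \<Longrightarrow>
    exec \<phi> d m (Seq c1 c2) s (1 + t1 + t2) s2"
| CondTrue: "bval \<phi> d b s \<Longrightarrow> exec \<phi> d m c1 s t s' \<Longrightarrow>
    exec \<phi> d m (Cond b c1 c2) s (1 + bcost b + t) s'"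
| CondFalse: "\<not> bval \<phi> d b s \<Longrightarrow> exec \<phi> d m c2 s t s' \<Longrightarrow>
    exec \<phi> d m (Cond b c1 c2) s (1 + bcost b + t) s'"
| LoopFalse: "\<not> bval \<phi> d b s \<Longrightarrow>
    exec \<phi> d m (Loop b c) s (1 + bcost b) s"
| LoopTrue: "bval \<phi> d b s \<Longrightarrow> exec \<phi> d m c s t1 s1 \<Longrightarrow> exec \<phi> d m (Loop b c) s1 t2 s2 \<Longrightarrow>
    exec \<phi> d m (Loop b c) s (1 + bcost b + t1 + t2) s2"

inductive_cases exec_SkipE: "exec \<phi> d m Skip s t s'"
inductive_cases exec_NSetE: "exec \<phi> d m (NSet a e) s t s'"
inductive_cases exec_RSetE: "exec \<phi> d m (RSet a e) s t s'"
inductive_cases exec_VSetE: "exec \<phi> d m (VSet a e) s t s'"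
inductive_cases exec_RandNatE: "exec \<phi> d m (RandNat a e) s t s'"
inductive_cases exec_RandRealE: "exec \<phi> d m (RandReal a) s t s'"
inductive_cases exec_RandGaussE: "exec \<phi> d m (RandGauss a) s t s'"
inductive_cases exec_SeqE: "exec \<phi> d m (Seq c1 c2) s t s'"
inductive_cases exec_CondE: "exec \<phi> d m (Cond b c1 c2) s t s'"
inductive_cases exec_LoopE: "exec \<phi> d m (Loop b c) s t s'"

lemma exec_deterministic:
  "exec \<phi> d m c s t s' \<Longrightarrow> exec \<phi> d m c s u s'' \<Longrightarrow> u = t \<and> s'' = s'"
proof (induction arbitrary: u s'' rule: exec.induct)
  case (Skip s)
  then show ?case by (elim exec_SkipE) simp
next
  case (NSet a s e)
  from NSet.prems show ?case by (elim exec_NSetE) simp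
next
  case (RSet a s e)
  from RSet.prems show ?case by (elim exec_RSetE) simp
next
  case (VSet a s e)
  from VSet.prems show ?case by (elim exec_VSetE) simp
next
  case (RandNat a s e)
  from RandNat.prems show ?case by (elim exec_RandNatE) simp
next
  case (RandReal a s)
  from RandReal.prems show ?case by (elim exec_RandRealE) simp
next
  case (RandGauss a s)
  from RandGauss.prems show ?case by (elim exec_RandGaussE) simp
next
  case (Seq c1 s t1 s1 c2 t2 s2)
  from Seq.prems obtain v1 r v2 where
    r: "u = 1 + v1 + v2" "exec \<phi> d m c1 s v1 r" "exec \<phi> d m c2 r v2 s''"
    by (elim exec_SeqE) simp
  then show ?case using Seq.IH(1)[OF r(2)] Seq.IH(2)[of v2 s''] by simp
next
  case (CondTrue b s c1 t s' c2)
  from CondTrue.prems CondTrue.hyps obtain v where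
    r: "u = 1 + bcost b + v" "exec \<phi> d m c1 s v s''"
    by (elim exec_CondE) simp_all
  then show ?case using CondTrue.IH[OF r(2)] by simp
next
  case (CondFalse b s c2 t s' c1)
  from CondFalse.prems CondFalse.hyps obtain v where
    r: "u = 1 + bcost b + v" "exec \<phi> d m c2 s v s''"
    by (elim exec_CondE) simp_all
  then show ?case using CondFalse.IH[OF r(2)] by simp
next
  case (LoopFalse b s c)
  from LoopFalse.prems show ?case
    by (cases rule: exec_LoopE) (use LoopFalse.hyps in auto)
next
  case (LoopTrue b s c t1 s1 t2 s2)
  from LoopTrue.prems obtain v1 r v2 where
    r: "u = 1 + bcost b + v1 + v2" "exec \<phi> d m c s v1 r" "exec \<phi> d m (Loop b c) r v2 s''"
    by (cases rule: exec_LoopE) (use LoopTrue.hyps(1) in auto)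
  then show ?case using LoopTrue.IH(1)[OF r(2)] LoopTrue.IH(2)[of v2 s''] by simp
qed

section \<open>Random tapes\<close>

definition gauss_rvec :: "nat \<Rightarrow> rvec measure" where
  "gauss_rvec d = (\<Pi>\<^sub>M i\<in>{..<d}. std_normal_distribution)"

definition tapes :: "nat \<Rightarrow> (real stream \<times> rvec stream) measure" where
  "tapes d = stream_space (uniform_measure lborel {0..1}) \<Otimes>\<^sub>M stream_space (gauss_rvec d)"

lemma prob_space_tapes: "prob_space (tapes d)"
proof -
  have "prob_space std_normal_distribution"
    by (simp add: prob_space_normal_density)
  then have g: "prob_space (gauss_rvec d)"
    unfolding gauss_rvec_def by (intro prob_space_PiM)
  have u: "prob_space (uniform_measure lborel {0..1::real})"
    by (intro prob_space_uniform_measure) auto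
  show ?thesis
    unfolding tapes_def
    by (intro prob_space_pair prob_space.prob_space_stream_space g u)
qed

section \<open>Data structures for kernel means\<close>

definition init_state ::
  "nat \<Rightarrow> nat \<Rightarrow> real \<Rightarrow> real \<Rightarrow> rvec list \<Rightarrow> real stream \<times> rvec stream \<Rightarrow> state" where
  "init_state n d \<delta> \<epsilon> xs \<omega> =
     \<lparr>nmem = (\<lambda>_. 0)(0 := n, 1 := d),
      rmem = (\<lambda>_. 0)(0 := \<delta>, 1 := \<epsilon>),
      vmem = (\<lambda>_. zero_rvec d),
      inputs = xs,
      utape = fst \<omega>,
      gtape = snd \<omega>\<rparr>"

definition preprocess ::
  "com \<Rightarrow> (real \<Rightarrow> real) \<Rightarrow> nat \<Rightarrow> nat \<Rightarrow> real \<Rightarrow> real \<Rightarrow> rvec list \<Rightarrow>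
   real stream \<times> rvec stream \<Rightarrow> nat \<Rightarrow> state \<Rightarrow> bool" where
  "preprocess pre \<phi> d m \<delta> \<epsilon> xs \<omega> t s \<longleftrightarrow>
     exec \<phi> d m pre (init_state (length xs) d \<delta> \<epsilon> xs \<omega>) t s"

text \<open>The query program sees what preprocessing left in memory and the query point, but not the
  data set; its random choices are fresh. The answer is returned in real cell 0.\<close>

definition query ::
  "com \<Rightarrow> (real \<Rightarrow> real) \<Rightarrow> nat \<Rightarrow> nat \<Rightarrow> state \<Rightarrow> rvec \<Rightarrow> nat \<Rightarrow> real \<Rightarrow> bool" where
  "query qry \<phi> d m s y t r \<longleftrightarrow>
     (\<exists>s'. exec \<phi> d m qry (s\<lparr>inputs := [y]\<rparr>) t s' \<and> rmem s' 0 = r)"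

text \<open>The time bounds \<open>Tpre\<close> and \<open>Tqry\<close> and the space bound \<open>m\<close> hold almost surely; the
  answer to each fixed query is correct with probability at least \<open>2/3\<close> over the tapes used by both programs. The data set
  may be presented in any order. The event \<open>A\<close> avoids asking for measurability of the exact set
  of successful tapes.\<close>

definition kernel_mean_structure ::
  "com \<Rightarrow> com \<Rightarrow> (real \<Rightarrow> real) \<Rightarrow> nat \<Rightarrow> real \<Rightarrow> real \<Rightarrow> rvec set \<Rightarrow> nat \<Rightarrow> real \<Rightarrow> real \<Rightarrow> bool"
where
  "kernel_mean_structure pre qry \<phi> d \<delta> \<epsilon> X m Tpre Tqry \<longleftrightarrow>
     (\<forall>xs. distinct xs \<and> set xs = X \<longrightarrow>
        (AE \<omega> in tapes d. \<exists>t s. preprocess pre \<phi> d m \<delta> \<epsilon> xs \<omega> t s \<and> real t \<le> Tpre) \<and>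
        (\<forall>y\<in>unit_sphere d.
           (AE \<omega> in tapes d. \<exists>t s t' r. preprocess pre \<phi> d m \<delta> \<epsilon> xs \<omega> t s \<and>
              query qry \<phi> d m s y t' r \<and> real t' \<le> Tqry) \<and>
           (\<exists>A\<in>sets (tapes d). measure (tapes d) A \<ge> 2 / 3 \<and>
              (\<forall>\<omega>\<in>A. \<exists>t s t' r. preprocess pre \<phi> d m \<delta> \<epsilon> xs \<omega> t s \<and>
                 query qry \<phi> d m s y t' r \<and> rel_approx \<epsilon> (kernel_mean \<phi> d X y) r))))"

text \<open>The bound $n^{\alpha+\eta}/\epsilon^2$, to be used with \<open>\<eta> = o(1)\<close>. It is floored at $n^{\eta}$
  because for large \<open>\<epsilon>\<close> it drops below the cost of a single step, which no program can
  meet. For \<open>\<alpha> \<ge> 0\<close> and \<open>\<epsilon> \<le> 1\<close> the floor has no effect.\<close>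

definition cost_bound :: "nat \<Rightarrow> real \<Rightarrow> real \<Rightarrow> real \<Rightarrow> real" where
  "cost_bound n \<alpha> \<eta> \<epsilon> = max (real n powr \<eta>) (real n powr (\<alpha> + \<eta>) / \<epsilon>\<^sup>2)"

end

theory Submission
  imports Defs "HOL-Real_Asymp.Real_Asymp"
begin

text \<open>
  Put \<open>\<Lambda> = (1 - \<delta>) ln n\<close> and \<open>K \<approx> ln n\<close>. The inner products with the query \<open>y\<close> are cut into
  \<open>2 K + 1\<close> classes of width \<open>1/K\<close>; since \<open>\<phi>\<close> is \<open>\<Lambda>\<close>-Lipschitz, the weights \<open>exp (\<phi> \<langle>x, y\<rangle>)\<close> vary
  by a factor of at most \<open>e\<close> inside a class. The contribution of a class with largest weight \<open>W\<close>
  is estimated from a uniform sample; up to factors \<open>n\<^bsup>o(1)\<^esup>\<close>, a sample of size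
  \<open>max (1, W / \<mu>) / \<epsilon>\<^sup>2\<close> suffices, where \<open>\<mu>\<close> is the mean to be approximated.

  The members of the class in the sample are retrieved by Gaussian filters: \<open>g\<close> catches \<open>z\<close> if
  \<open>\<langle>g, z\<rangle> \<ge> t\<close> and \<open>\<sigma> \<langle>g, y\<rangle> \<ge> t\<close>, where the class sits at \<open>\<langle>x, y\<rangle> \<approx> \<sigma> r\<close> with \<open>r \<ge> 0\<close> and
  \<open>\<sigma> = \<plusminus>1\<close>, and \<open>t\<^sup>2 = \<Lambda> r (1 + r)\<close>. A point of the class is caught with probability about
  \<open>exp (- \<Lambda> r)\<close>, so about \<open>exp (\<Lambda> r)\<close> filters are enough. The expected number of times that they
  catch a point \<open>z\<close> is at most \<open>exp (\<Lambda> (1 - \<bar>\<langle>x, y\<rangle> - \<langle>z, y\<rangle>\<bar>))\<close>, which by the Lipschitz condition is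
  at most \<open>exp \<Lambda> min (1, exp (\<phi> \<langle>z, y\<rangle>) / W)\<close>. Averaging over \<open>z\<close>, a sample of the above size is scanned
  in time \<open>exp \<Lambda> / \<epsilon>\<^sup>2 = n\<^bsup>1-\<delta>\<^esup> / \<epsilon>\<^sup>2\<close>.

  Since \<open>\<mu>\<close> and \<open>W\<close> are unknown, the query tries sample sizes that are doubled each time, aborts every
  scan that exceeds this budget, and keeps the estimate of the last completed scan: whichever scan
  this is, its sample is at least as large as needed.
\<close>

section \<open>Gaussian vectors\<close>

text \<open>Collision probabilities are bounded through moment generating functions alone: from
  above by Chernoff, from below by Cramer's change of measure. The lower bound loses a factor exp (O
  (sqrt (ln n))), and this loss is why G has the form exp (100 sqrt K). The width 1/K of a class
  changes the exponents by O(1) only, since \<Lambda> \<le> ln n \<le> K. The obstacle to a sampling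
  analysis is that all samples share the filters, so that the events of being found are correlated
  and their probabilities differ from point to point. This is avoided rather than corrected: there
  are enough filters to catch, with probability at least 8/9, every data point in its own class
  simultaneously. Then each completed scan returns a plain sample mean, which depends on the
  sampling tape only, and Chebyshev applies. The scanning cost is the only quantity that depends on
  both tapes, and for it a first moment is enough. All random choices are made during preprocessing.
  The time bounds hold on every tape, because the budget cuts off the scans; chance enters only into
  accuracy.\<close>

lemma nn_integral_exp_std_normal:
  "(\<integral>\<^sup>+x. ennreal (exp (a * x)) \<partial>std_normal_distribution) = ennreal (exp (a\<^sup>2 / 2))"
proof -
  \<comment> \<open>Completing the square gives a multiple of the normal density with mean
    a.\<close>
  have shift: "std_normal_density x * exp (a * x) = exp (a\<^sup>2 / 2) * normal_density a 1 x" for x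
    by (simp add: normal_density_def mult_exp_exp power2_eq_square field_simps)
  have "(\<integral>\<^sup>+x. ennreal (exp (a * x)) \<partial>std_normal_distribution) =
      (\<integral>\<^sup>+x. ennreal (exp (a\<^sup>2 / 2)) * ennreal (normal_density a 1 x) \<partial>lborel)"
    by (subst nn_integral_density)
       (auto simp: ennreal_mult[symmetric] shift normal_density_nonneg)
  also have "\<dots> = ennreal (exp (a\<^sup>2 / 2)) * (\<integral>\<^sup>+x. ennreal (normal_density a 1 x) \<partial>lborel)"
    by (rule nn_integral_cmult) auto
  also have "(\<integral>\<^sup>+x. ennreal (normal_density a 1 x) \<partial>lborel) = 1"
    by (subst nn_integral_eq_integral) (auto simp: normal_density_nonneg)
  finally show ?thesis by simp
qed

lemma prob_space_gauss_rvec: "prob_space (gauss_rvec d)"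
  unfolding gauss_rvec_def by (intro prob_space_PiM) (simp add: prob_space_normal_density)

lemma sets_gauss_rvec [measurable_cong]: "sets (gauss_rvec d) = sets (\<Pi>\<^sub>M i\<in>{..<d}. borel)"
  unfolding gauss_rvec_def by (intro sets_PiM_cong) auto

lemma measurable_dotp [measurable]: "(\<lambda>g. dotp d h g) \<in> borel_measurable (gauss_rvec d)"
  unfolding dotp_def by measurable

lemma nn_integral_exp_dotp:
  "(\<integral>\<^sup>+g. ennreal (exp (dotp d h g)) \<partial>gauss_rvec d) = ennreal (exp (dotp d h h / 2))"
proof -
  interpret product_sigma_finite "\<lambda>_::nat. std_normal_distribution"
    unfolding product_sigma_finite_def
    by (auto intro!: prob_space_imp_sigma_finite prob_space_normal_density)
  have "(\<integral>\<^sup>+g. ennreal (exp (dotp d h g)) \<partial>gauss_rvec d) =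
      (\<integral>\<^sup>+g. (\<Prod>i\<in>{..<d}. ennreal (exp (h i * g i))) \<partial>(\<Pi>\<^sub>M i\<in>{..<d}. std_normal_distribution))"
    unfolding dotp_def gauss_rvec_def by (simp add: exp_sum prod_ennreal)
  also have "\<dots> = (\<Prod>i\<in>{..<d}. \<integral>\<^sup>+x. ennreal (exp (h i * x)) \<partial>std_normal_distribution)"
    by (rule product_nn_integral_prod) auto
  also have "\<dots> = (\<Prod>i\<in>{..<d}. ennreal (exp ((h i)\<^sup>2 / 2)))"
    by (simp only: nn_integral_exp_std_normal)
  also have "\<dots> = ennreal (exp (dotp d h h / 2))"
    by (simp add: prod_ennreal exp_sum[symmetric] dotp_def sum_divide_distrib power2_eq_square)
  finally show ?thesis .
qed

text \<open>Markov's inequality for the exponential of the inner product with h. The set S is left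
  abstract, so that an intersection of half-spaces can be bounded through a single
  direction.\<close>

lemma gauss_chernoff:
  assumes [measurable]: "S \<in> sets (gauss_rvec d)"
    and S: "\<And>g. g \<in> S \<Longrightarrow> b \<le> dotp d h g"
  shows "measure (gauss_rvec d) S \<le> exp (dotp d h h / 2 - b)"
proof -
  interpret prob_space "gauss_rvec d" by (rule prob_space_gauss_rvec)
  have "ennreal (measure (gauss_rvec d) S) = (\<integral>\<^sup>+g. indicator S g \<partial>gauss_rvec d)"
    by (simp add: emeasure_eq_measure)
  also have "\<dots> \<le> (\<integral>\<^sup>+g. ennreal (exp (- b)) * ennreal (exp (dotp d h g)) \<partial>gauss_rvec d)"
    by (intro nn_integral_mono)
       (auto simp: indicator_def ennreal_mult[symmetric] mult_exp_exp dest: S)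
  also have "\<dots> = ennreal (exp (- b)) * ennreal (exp (dotp d h h / 2))"
    by (subst nn_integral_cmult) (auto simp: nn_integral_exp_dotp)
  also have "\<dots> = ennreal (exp (dotp d h h / 2 - b))"
    by (simp add: ennreal_mult[symmetric] mult_exp_exp)
  finally show ?thesis by (simp add: ennreal_le_iff)
qed

text \<open>This is the Gaussian measure shifted by \<open>h\<close>. Defined as a density, it is accessible through
  moment generating functions alone, without any change of variables.\<close>

definition tilt :: "nat \<Rightarrow> rvec \<Rightarrow> rvec measure" where
  "tilt d h = density (gauss_rvec d) (\<lambda>g. ennreal (exp (dotp d h g - dotp d h h / 2)))"

lemma dotp_add_left: "dotp d (\<lambda>i. a i + b i) g = dotp d a g + dotp d b g"
  and dotp_add_right: "dotp d g (\<lambda>i. a i + b i) = dotp d g a + dotp d g b"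
  and dotp_scale_left: "dotp d (\<lambda>i. c * a i) g = c * dotp d a g"
  and dotp_scale_right: "dotp d g (\<lambda>i. c * a i) = c * dotp d g a"
  and dotp_commute: "dotp d g a = dotp d a g"
  unfolding dotp_def
  by (simp_all add: sum.distrib sum_distrib_left algebra_simps)

lemma sets_tilt [measurable_cong]: "sets (tilt d h) = sets (gauss_rvec d)"
  by (simp add: tilt_def)

lemma tilt_mgf:
  "(\<integral>\<^sup>+g. ennreal (exp (dotp d a g)) \<partial>tilt d h) = ennreal (exp (dotp d a a / 2 + dotp d h a))"
proof -
  have "(\<integral>\<^sup>+g. ennreal (exp (dotp d a g)) \<partial>tilt d h) =
      (\<integral>\<^sup>+g. ennreal (exp (- dotp d h h / 2)) *
          ennreal (exp (dotp d (\<lambda>i. a i + h i) g)) \<partial>gauss_rvec d)"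
    unfolding tilt_def
    by (subst nn_integral_density)
       (auto simp: ennreal_mult[symmetric] mult_exp_exp dotp_add_left algebra_simps
         intro!: nn_integral_cong)
  also have "\<dots> = ennreal (exp (- dotp d h h / 2)) *
      ennreal (exp (dotp d (\<lambda>i. a i + h i) (\<lambda>i. a i + h i) / 2))"
    by (subst nn_integral_cmult) (auto simp: nn_integral_exp_dotp)
  also have "\<dots> = ennreal (exp (dotp d a a / 2 + dotp d h a))"
    by (simp add: ennreal_mult[symmetric] mult_exp_exp dotp_add_left dotp_add_right
        dotp_commute[of d h a] field_simps)
  finally show ?thesis .
qed

lemma prob_space_tilt: "prob_space (tilt d h)"
proof
  have "emeasure (tilt d h) (space (tilt d h)) = (\<integral>\<^sup>+g. ennreal (exp (dotp d (\<lambda>_. 0) g)) \<partial>tilt d h)"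
    by (simp add: dotp_def)
  also have "\<dots> = 1" by (subst tilt_mgf) (simp add: dotp_def)
  finally show "emeasure (tilt d h) (space (tilt d h)) = 1" .
qed

lemma tilt_chernoff:
  assumes [measurable]: "S \<in> sets (gauss_rvec d)"
    and S: "\<And>g. g \<in> S \<Longrightarrow> b \<le> dotp d a g"
  shows "measure (tilt d h) S \<le> exp (dotp d a a / 2 + dotp d h a - b)"
proof -
  interpret prob_space "tilt d h" by (rule prob_space_tilt)
  have "ennreal (measure (tilt d h) S) = (\<integral>\<^sup>+g. indicator S g \<partial>tilt d h)"
    by (simp add: emeasure_eq_measure)
  also have "\<dots> \<le> (\<integral>\<^sup>+g. ennreal (exp (- b)) * ennreal (exp (dotp d a g)) \<partial>tilt d h)"
    by (intro nn_integral_mono)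
       (auto simp: indicator_def ennreal_mult[symmetric] mult_exp_exp dest: S)
  also have "\<dots> = ennreal (exp (- b)) * ennreal (exp (dotp d a a / 2 + dotp d h a))"
    by (subst nn_integral_cmult) (auto simp: tilt_mgf)
  also have "\<dots> = ennreal (exp (dotp d a a / 2 + dotp d h a - b))"
    by (simp add: ennreal_mult[symmetric] mult_exp_exp)
  finally show ?thesis by (simp add: ennreal_le_iff)
qed

text \<open>On S the density of \<open>tilt d h\<close> is at most exp (b - |h|^2 / 2). Read
  backwards, this is the lower half of Cramer's method: a set that is typical for the shifted
  measure cannot be too rare for the original one.\<close>

lemma gauss_ge_tilt:
  assumes [measurable]: "S \<in> sets (gauss_rvec d)"
    and S: "\<And>g. g \<in> S \<Longrightarrow> dotp d h g \<le> b"
  shows "exp (dotp d h h / 2 - b) * measure (tilt d h) S \<le> measure (gauss_rvec d) S"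
proof -
  interpret prob_space "gauss_rvec d" by (rule prob_space_gauss_rvec)
  interpret T: prob_space "tilt d h" by (rule prob_space_tilt)
  have "ennreal (measure (tilt d h) S) =
      (\<integral>\<^sup>+g. ennreal (exp (dotp d h g - dotp d h h / 2)) * indicator S g \<partial>gauss_rvec d)"
    unfolding T.emeasure_eq_measure[symmetric] by (simp add: tilt_def emeasure_density)
  also have "\<dots> \<le> (\<integral>\<^sup>+g. ennreal (exp (b - dotp d h h / 2)) * indicator S g \<partial>gauss_rvec d)"
    by (intro nn_integral_mono) (auto simp: indicator_def dest: S)
  also have "\<dots> = ennreal (exp (b - dotp d h h / 2)) * ennreal (measure (gauss_rvec d) S)"
    by (simp add: nn_integral_cmult emeasure_eq_measure)
  finally have "measure (tilt d h) S \<le> exp (b - dotp d h h / 2) * measure (gauss_rvec d) S"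
    by (simp add: ennreal_mult[symmetric] ennreal_le_iff)
  then have "exp (dotp d h h / 2 - b) * measure (tilt d h) S \<le>
      exp (dotp d h h / 2 - b) * (exp (b - dotp d h h / 2) * measure (gauss_rvec d) S)"
    by (rule mult_left_mono) simp
  also have "\<dots> = measure (gauss_rvec d) S"
    by (simp add: mult.assoc[symmetric] mult_exp_exp)
  finally show ?thesis .
qed

section \<open>Lower bound for two Gaussian coordinates being large at once\<close>

lemma (in prob_space) one_le_prob_cover4:
  assumes "A \<in> events" "B \<in> events" "C \<in> events" "D \<in> events"
    and "space M \<subseteq> A \<union> (B \<union> C \<union> D)"
  shows "1 \<le> prob A + prob B + prob C + prob D"
proof -
  have "A \<union> (B \<union> C \<union> D) = space M"
    using assms sets.sets_into_space by blast
  then have "1 = prob (A \<union> (B \<union> C \<union> D))" by (simp add: prob_space)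
  then show ?thesis
    using measure_Un_le[of A M "B \<union> C \<union> D"] measure_Un_le[of "B \<union> C" M D]
      measure_Un_le[of B M C] assms by simp
qed

text \<open>After a shift by h = c (x + y) both inner products have mean c (1 + \<rho>), at least
  two standard deviations above t, so the event becomes typical. Here q = |h|^2; undoing the shift
  costs exp (- q / 2), and the fluctuation of the density costs exp (- 2 sqrt q).\<close>

lemma gauss_pair_lower_bound:
  fixes t c :: real
  assumes x: "dotp d x x = 1" and y: "dotp d y y = 1" and "dotp d x y = \<rho>"
    and c: "t + 2 \<le> c * (1 + \<rho>)" and pos: "0 < c * c * (1 + \<rho>)"
  defines "q \<equiv> 2 * c * c * (1 + \<rho>)"
  shows "exp (- q / 2 - 2 * sqrt q) / 2 \<le>
    measure (gauss_rvec d) {g \<in> space (gauss_rvec d). t \<le> dotp d x g \<and> t \<le> dotp d y g}"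
proof -
  interpret G: prob_space "gauss_rvec d" by (rule prob_space_gauss_rvec)
  let ?h = "\<lambda>i. c * (x i + y i)"
  interpret T: prob_space "tilt d ?h" by (rule prob_space_tilt)
  let ?\<Omega> = "space (gauss_rvec d)"
  have sp: "space (tilt d ?h) = ?\<Omega>" by (simp add: tilt_def)
  have hx: "dotp d ?h x = c * (1 + \<rho>)" and hy: "dotp d ?h y = c * (1 + \<rho>)" and hh: "dotp d ?h ?h = q"
    using assms(1-3) unfolding q_def
    by (simp_all add: dotp_scale_left dotp_scale_right dotp_add_left dotp_add_right
        dotp_commute[of d y x] algebra_simps)
  have q: "0 < q" using pos by (simp add: q_def)
  let ?B1 = "{g\<in>?\<Omega>. dotp d x g < t}" and ?B2 = "{g\<in>?\<Omega>. dotp d y g < t}"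
  let ?B3 = "{g\<in>?\<Omega>. q + 2 * sqrt q < dotp d ?h g}"
  \<comment> \<open>The upper cut lies two standard deviations sqrt q above the shifted mean q; it
    keeps the density bounded, as \<open>gauss_ge_tilt\<close> requires.\<close>
  let ?S = "{g\<in>?\<Omega>. t \<le> dotp d x g \<and> t \<le> dotp d y g \<and> dotp d ?h g \<le> q + 2 * sqrt q}"
  have m: "?B1 \<in> sets (gauss_rvec d)" "?B2 \<in> sets (gauss_rvec d)" "?B3 \<in> sets (gauss_rvec d)"
    "?S \<in> sets (gauss_rvec d)" by measurable
  have one: "measure (tilt d ?h) {g\<in>?\<Omega>. dotp d z g < t} \<le> exp (- 2)"
    if "dotp d z z = 1" "dotp d ?h z = c * (1 + \<rho>)" for z
  proof -
    \<comment> \<open>The multiplier -2 is the optimal Chernoff exponent for a fall by two standard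
      deviations.\<close>
    have "measure (tilt d ?h) {g\<in>?\<Omega>. dotp d z g < t} \<le>
      exp (dotp d (\<lambda>i. (-2) * z i) (\<lambda>i. (-2) * z i) / 2 + dotp d ?h (\<lambda>i. (-2) * z i) - (- 2 * t))"
    proof (rule tilt_chernoff)
      fix g assume "g \<in> {g\<in>?\<Omega>. dotp d z g < t}"
      then show "- 2 * t \<le> dotp d (\<lambda>i. (-2) * z i) g" using dotp_scale_left[of d "-2" z g] by simp
    qed measurable
    also have "dotp d (\<lambda>i. (-2) * z i) (\<lambda>i. (-2) * z i) = 4"
      using dotp_scale_left[of d "-2" z "\<lambda>i. (-2) * z i"] dotp_scale_right[of d z "-2" z] that(1) by simp
    also have "dotp d ?h (\<lambda>i. (-2) * z i) = (-2) * (c * (1 + \<rho>))"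
      using dotp_scale_right[of d ?h "-2" z] that(2) by simp
    also have "4 / 2 + (-2) * (c * (1 + \<rho>)) - (- 2 * t) = 2 - 2 * (c * (1 + \<rho>)) + 2 * t" by simp
    also have "exp (2 - 2 * (c * (1 + \<rho>)) + 2 * t) \<le> exp (- 2)"
      unfolding exp_le_cancel_iff using c by linarith
    finally show ?thesis .
  qed
  have three: "measure (tilt d ?h) ?B3 \<le> exp (- 2)"
  proof -
    \<comment> \<open>The optimal exponent, deviation over variance: 2 sqrt q / q.\<close>
    define s where "s = 2 / sqrt q"
    have s: "s * s * q = 4" "s * sqrt q = 2" "s \<ge> 0" using q by (auto simp: s_def)
    have "measure (tilt d ?h) ?B3 \<le>
      exp (dotp d (\<lambda>i. s * ?h i) (\<lambda>i. s * ?h i) / 2 + dotp d ?h (\<lambda>i. s * ?h i) - s * (q + 2 * sqrt q))"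
    proof (rule tilt_chernoff)
      fix g assume "g \<in> ?B3"
      then have "q + 2 * sqrt q \<le> dotp d ?h g" by simp
      then have "s * (q + 2 * sqrt q) \<le> s * dotp d ?h g" using s(3) by (rule mult_left_mono)
      then show "s * (q + 2 * sqrt q) \<le> dotp d (\<lambda>i. s * ?h i) g" by (simp only: dotp_scale_left)
    qed fact
    also have "\<dots> = exp (s * s * q / 2 + s * q - s * (q + 2 * sqrt q))"
      unfolding dotp_scale_left[where c = s] dotp_scale_right[where c = s] hh by simp
    also have "\<dots> = exp (- 2)" using s by (simp add: algebra_simps)
    finally show ?thesis .
  qed
  \<comment> \<open>Three exceptional sets of mass at most exp (- 2) \<le> 1/6 each leave one
    half.\<close>
  have "1 \<le> measure (tilt d ?h) ?S + measure (tilt d ?h) ?B1 + measure (tilt d ?h) ?B2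
      + measure (tilt d ?h) ?B3"
    by (rule T.one_le_prob_cover4) (simp_all only: sets_tilt sp m, auto)
  also have "\<dots> \<le> measure (tilt d ?h) ?S + 3 * exp (- 2)"
    using one[OF x hx] one[OF y hy] three by simp
  finally have "1 - 3 * exp (- 2) \<le> measure (tilt d ?h) ?S" by simp
  moreover have "exp (- 2 :: real) \<le> 1 / 6"
  proof -
    have "6 \<le> exp (2::real)"
    proof -
      have "(5/2)\<^sup>2 \<le> (exp 1 :: real)\<^sup>2"
        by (rule power_mono) (use exp_lower_Taylor_quadratic[of 1] in auto)
      then show ?thesis by (simp add: power2_eq_square mult_exp_exp)
    qed
    then show ?thesis by (simp add: exp_minus field_simps)
  qed
  ultimately have half: "1 / 2 \<le> measure (tilt d ?h) ?S" by linarith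
  have "exp (- q / 2 - 2 * sqrt q) / 2 \<le> exp (dotp d ?h ?h / 2 - (q + 2 * sqrt q)) * measure (tilt d ?h) ?S"
  proof -
    have "dotp d ?h ?h / 2 - (q + 2 * sqrt q) = - q / 2 - 2 * sqrt q" unfolding hh by simp
    then show ?thesis
      using mult_left_mono[OF half exp_ge_zero, of "- q / 2 - 2 * sqrt q"]
      by (simp only: times_divide_eq_right mult_1_right)
  qed
  also have "\<dots> \<le> measure (gauss_rvec d) ?S"
    by (rule gauss_ge_tilt) auto
  also have "\<dots> \<le> measure (gauss_rvec d) {g \<in> ?\<Omega>. t \<le> dotp d x g \<and> t \<le> dotp d y g}"
    by (rule G.finite_measure_mono) auto
  finally show ?thesis .
qed

section \<open>Sequences of independent samples\<close>

lemma (in prob_space) nn_integral_stream_snth: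
  assumes [measurable]: "f \<in> borel_measurable M"
  shows "(\<integral>\<^sup>+\<omega>. f (\<omega> !! j) \<partial>stream_space M) = (\<integral>\<^sup>+x. f x \<partial>M)"
proof (induction j)
  case 0
  interpret S: prob_space "stream_space M" by (rule prob_space_stream_space)
  show ?case by (subst nn_integral_stream_space) (simp_all add: S.emeasure_space_1)
next
  case (Suc j)
  then show ?case by (subst nn_integral_stream_space) (simp_all add: emeasure_space_1)
qed

lemma (in prob_space) emeasure_stream_all_miss:
  assumes [measurable]: "A \<in> sets M"
  shows "emeasure (stream_space M) {\<omega> \<in> space (stream_space M). \<forall>f<N. \<omega> !! f \<notin> A} =
    ennreal ((1 - prob A) ^ N)"
proof (induction N)
  case 0
  interpret S: prob_space "stream_space M" by (rule prob_space_stream_space)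
  show ?case by (simp add: S.emeasure_space_1)
next
  case (Suc N)
  interpret S: prob_space "stream_space M" by (rule prob_space_stream_space)
  let ?S = "\<lambda>N. {\<omega> \<in> space (stream_space M). \<forall>f<N. \<omega> !! f \<notin> A}"
  have [measurable]: "?S N \<in> sets (stream_space M)" for N by measurable
  have "emeasure (stream_space M) (?S (Suc N)) = (\<integral>\<^sup>+x. \<integral>\<^sup>+\<omega>. indicator (?S (Suc N)) (x ## \<omega>) \<partial>stream_space M \<partial>M)"
    by (subst nn_integral_stream_space[symmetric]) auto
  also have "\<dots> = (\<integral>\<^sup>+x. \<integral>\<^sup>+\<omega>. indicator (space M - A) x * indicator (?S N) \<omega> \<partial>stream_space M \<partial>M)"
    by (intro nn_integral_cong)
       (auto simp: indicator_def space_stream_space streams_Stream less_Suc_eq_0_disj)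
  also have "\<dots> = (\<integral>\<^sup>+x. indicator (space M - A) x * emeasure (stream_space M) (?S N) \<partial>M)"
    by (subst nn_integral_cmult) auto
  also have "\<dots> = emeasure M (space M - A) * emeasure (stream_space M) (?S N)"
    by (subst nn_integral_multc) auto
  also have "emeasure M (space M - A) = ennreal (1 - prob A)"
    by (simp add: emeasure_eq_measure prob_compl)
  finally show ?case by (simp add: Suc.IH ennreal_mult)
qed

text \<open>Independence of head and tail, as an equality of measures: in this form it can be used
  for Bochner integrals, where the square of a sum is expanded into signed terms.\<close>

lemma (in prob_space) stream_space_eq_distr_pair:
  "stream_space M = distr (M \<Otimes>\<^sub>M stream_space M) (stream_space M) (\<lambda>(x, \<omega>). x ## \<omega>)"
proof (rule measure_eqI)
  interpret S: prob_space "stream_space M" by (rule prob_space_stream_space)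
  fix A assume [measurable]: "A \<in> sets (stream_space M)"
  have "emeasure (stream_space M) A = (\<integral>\<^sup>+x. \<integral>\<^sup>+\<omega>. indicator A (x ## \<omega>) \<partial>stream_space M \<partial>M)"
    by (subst nn_integral_stream_space[symmetric]) auto
  also have "\<dots> = (\<integral>\<^sup>+p. indicator A ((\<lambda>(x, \<omega>). x ## \<omega>) p) \<partial>(M \<Otimes>\<^sub>M stream_space M))"
    by (subst S.nn_integral_fst[symmetric]) auto
  also have "\<dots> = (\<integral>\<^sup>+\<omega>. indicator A \<omega> \<partial>distr (M \<Otimes>\<^sub>M stream_space M) (stream_space M) (\<lambda>(x, \<omega>). x ## \<omega>))"
    by (subst nn_integral_distr) auto
  finally show "emeasure (stream_space M) A =
      emeasure (distr (M \<Otimes>\<^sub>M stream_space M) (stream_space M) (\<lambda>(x, \<omega>). x ## \<omega>)) A"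
    by simp
qed simp

text \<open>Variances of independent terms add up: in the square of head plus tail, the cross term
  integrates to a multiple of the mean of Y, which is 0. The bound b only provides
  integrability.\<close>

lemma (in prob_space) stream_sum_second_moment:
  fixes Y :: "'a \<Rightarrow> real"
  assumes [measurable]: "Y \<in> borel_measurable M" and b: "\<And>x. \<bar>Y x\<bar> \<le> b" and mean: "expectation Y = 0"
  shows "(\<integral>\<omega>. (\<Sum>j<k. Y (\<omega> !! j))\<^sup>2 \<partial>stream_space M) = real k * expectation (\<lambda>x. (Y x)\<^sup>2)"
proof (induction k)
  case (Suc k)
  interpret S: prob_space "stream_space M" by (rule prob_space_stream_space)
  interpret P: pair_prob_space M "stream_space M" ..
  have b0: "0 \<le> b" using b[of undefined] by linarith
  let ?Z = "\<lambda>\<omega>. \<Sum>j<k. Y (\<omega> !! j)"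
  have Zb: "\<bar>?Z \<omega>\<bar> \<le> real k * b" for \<omega>
    by (rule order.trans[OF sum_abs]) (use sum_bounded_above[of "{..<k}" "\<lambda>j. \<bar>Y (\<omega> !! j)\<bar>" b] b in auto)
  have sq: "z\<^sup>2 \<le> a\<^sup>2" if "\<bar>z\<bar> \<le> a" for z a :: real
    using that by (metis abs_ge_zero power2_abs power_mono)
  have iY [simp]: "integrable M Y"
    by (rule integrable_const_bound[where B = b]) (auto simp: b)
  have iY2 [simp]: "integrable M (\<lambda>x. (Y x)\<^sup>2)"
    by (rule integrable_const_bound[where B = "b\<^sup>2"]) (auto intro: sq b)
  have iZ [simp]: "integrable (stream_space M) ?Z"
    by (rule S.integrable_const_bound[where B = "real k * b"]) (auto intro: Zb)
  have iZ2 [simp]: "integrable (stream_space M) (\<lambda>\<omega>. (?Z \<omega>)\<^sup>2)"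
    by (rule S.integrable_const_bound[where B = "(real k * b)\<^sup>2"]) (auto intro: sq Zb)
  have YZ: "\<bar>Y x + ?Z \<omega>\<bar> \<le> b + real k * b" for x \<omega>
    using b[of x] Zb[of \<omega>] by linarith
  have iP: "integrable (M \<Otimes>\<^sub>M stream_space M) (\<lambda>(x, \<omega>). (Y x + ?Z \<omega>)\<^sup>2)"
    by (rule P.integrable_const_bound[where B = "(b + real k * b)\<^sup>2"]) (auto simp: split_beta' intro!: AE_I2 sq YZ)
  have "(\<integral>\<omega>. (\<Sum>j<Suc k. Y (\<omega> !! j))\<^sup>2 \<partial>stream_space M) =
      (\<integral>p. (case p of (x, \<omega>) \<Rightarrow> (Y x + ?Z \<omega>)\<^sup>2) \<partial>(M \<Otimes>\<^sub>M stream_space M))"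
    by (subst stream_space_eq_distr_pair, subst integral_distr)
       (auto simp: sum.lessThan_Suc_shift split_beta' simp del: sum.lessThan_Suc)
  also have "\<dots> = (\<integral>x. \<integral>\<omega>. (Y x + ?Z \<omega>)\<^sup>2 \<partial>stream_space M \<partial>M)"
    by (subst P.integral_fst'[OF iP, symmetric]) simp
  also have "\<dots> = (\<integral>x. (Y x)\<^sup>2 + 2 * Y x * (\<integral>\<omega>. ?Z \<omega> \<partial>stream_space M)
      + (\<integral>\<omega>. (?Z \<omega>)\<^sup>2 \<partial>stream_space M) \<partial>M)"
  proof (rule Bochner_Integration.integral_cong[OF refl])
    fix x
    have "(\<integral>\<omega>. (Y x + ?Z \<omega>)\<^sup>2 \<partial>stream_space M) =
        (\<integral>\<omega>. ((Y x)\<^sup>2 + 2 * Y x * ?Z \<omega>) + (?Z \<omega>)\<^sup>2 \<partial>stream_space M)"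
      by (simp add: power2_sum algebra_simps)
    also have "\<dots> = (\<integral>\<omega>. (Y x)\<^sup>2 + 2 * Y x * ?Z \<omega> \<partial>stream_space M) + (\<integral>\<omega>. (?Z \<omega>)\<^sup>2 \<partial>stream_space M)"
      by (rule Bochner_Integration.integral_add) auto
    also have "(\<integral>\<omega>. (Y x)\<^sup>2 + 2 * Y x * ?Z \<omega> \<partial>stream_space M) =
        (Y x)\<^sup>2 + 2 * Y x * (\<integral>\<omega>. ?Z \<omega> \<partial>stream_space M)"
      by (subst Bochner_Integration.integral_add) (auto simp: S.prob_space)
    finally show "(\<integral>\<omega>. (Y x + ?Z \<omega>)\<^sup>2 \<partial>stream_space M) =
        (Y x)\<^sup>2 + 2 * Y x * (\<integral>\<omega>. ?Z \<omega> \<partial>stream_space M) + (\<integral>\<omega>. (?Z \<omega>)\<^sup>2 \<partial>stream_space M)" .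
  qed
  also have "\<dots> = expectation (\<lambda>x. (Y x)\<^sup>2) + (\<integral>\<omega>. (?Z \<omega>)\<^sup>2 \<partial>stream_space M)"
    using mean by (simp add: prob_space)
  finally show ?case by (simp add: Suc.IH algebra_simps)
qed simp

text \<open>From 0 \<le> F \<le> b the variance is at most E F^2 \<le> b E F. For a small mean this
  is far better than b^2; it is what makes a sample of size about W / \<mu> sufficient.\<close>

lemma (in prob_space) stream_chebyshev:
  fixes F :: "'a \<Rightarrow> real"
  assumes [measurable]: "F \<in> borel_measurable M" and b: "\<And>x. 0 \<le> F x" "\<And>x. F x \<le> b"
    and err: "0 < err" and k: "0 < k"
  shows "measure (stream_space M)
      {\<omega> \<in> space (stream_space M). err < \<bar>(\<Sum>j<k. F (\<omega> !! j)) / real k - expectation F\<bar>}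
    \<le> b * expectation F / (real k * err\<^sup>2)"
proof -
  interpret S: prob_space "stream_space M" by (rule prob_space_stream_space)
  let ?a = "expectation F" and ?Y = "\<lambda>x. F x - expectation F"
  have Fb: "\<bar>F x\<bar> \<le> b" for x using b[of x] by simp
  have iF [simp]: "integrable M F"
    by (rule integrable_const_bound[where B = b]) (auto intro: Fb)
  have iF2 [simp]: "integrable M (\<lambda>x. (F x)\<^sup>2)"
    by (rule integrable_const_bound[where B = "b\<^sup>2"]) (auto intro!: power_mono b)
  have "expectation (\<lambda>x. (?Y x)\<^sup>2) = expectation (\<lambda>x. (F x)\<^sup>2) - ?a\<^sup>2"
    by (rule variance_eq) auto
  also have "\<dots> \<le> expectation (\<lambda>x. b * F x)"
  proof -
    have "expectation (\<lambda>x. (F x)\<^sup>2) \<le> expectation (\<lambda>x. b * F x)"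
      by (rule integral_mono) (auto simp: power2_eq_square iF2[unfolded power2_eq_square] intro: mult_right_mono b)
    then show ?thesis by (smt (verit) zero_le_power2)
  qed
  finally have var: "expectation (\<lambda>x. (?Y x)\<^sup>2) \<le> b * ?a" by simp
  have Yb: "\<bar>?Y x\<bar> \<le> b + \<bar>?a\<bar>" for x using Fb[of x] by linarith
  let ?Z = "\<lambda>\<omega>. \<Sum>j<k. ?Y (\<omega> !! j)"
  have Zb: "\<bar>?Z \<omega>\<bar> \<le> real k * (b + \<bar>?a\<bar>)" for \<omega>
    by (rule order.trans[OF sum_abs])
       (use sum_bounded_above[of "{..<k}" "\<lambda>j. \<bar>?Y (\<omega> !! j)\<bar>" "b + \<bar>?a\<bar>"] Yb in auto)
  have iZ2: "integrable (stream_space M) (\<lambda>\<omega>. (?Z \<omega>)\<^sup>2)"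
    by (rule S.integrable_const_bound[where B = "(real k * (b + \<bar>?a\<bar>))\<^sup>2"])
       (auto intro!: order.trans[OF _ power_mono[OF Zb]])
  have eq: "(\<Sum>j<k. F (\<omega> !! j)) / real k - ?a = ?Z \<omega> / real k" for \<omega>
    using k by (simp add: sum_subtractf field_simps)
  have "measure (stream_space M) {\<omega> \<in> space (stream_space M). err < \<bar>(\<Sum>j<k. F (\<omega> !! j)) / real k - ?a\<bar>}
      \<le> measure (stream_space M) {\<omega> \<in> space (stream_space M). (real k * err)\<^sup>2 \<le> (?Z \<omega>)\<^sup>2}"
  proof (rule S.finite_measure_mono, safe)
    fix \<omega> assume "err < \<bar>(\<Sum>j<k. F (\<omega> !! j)) / real k - ?a\<bar>"
    then have "real k * err \<le> \<bar>?Z \<omega>\<bar>" unfolding eq using k by (simp add: field_simps)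
    then show "(real k * err)\<^sup>2 \<le> (?Z \<omega>)\<^sup>2"
      using err by (metis abs_le_square_iff abs_of_nonneg less_imp_le mult_nonneg_nonneg of_nat_0_le_iff)
  qed measurable
  also have "\<dots> \<le> (\<integral>\<omega>. (?Z \<omega>)\<^sup>2 \<partial>stream_space M) / (real k * err)\<^sup>2"
    by (rule integral_Markov_inequality_measure[where A = "{}", OF iZ2]) (use k err in auto)
  also have "\<dots> = real k * expectation (\<lambda>x. (?Y x)\<^sup>2) / (real k * err)\<^sup>2"
    by (subst stream_sum_second_moment[OF _ Yb]) (auto simp: prob_space)
  also have "\<dots> \<le> real k * (b * ?a) / (real k * err)\<^sup>2"
    by (intro divide_right_mono mult_left_mono var) auto
  also have "\<dots> = b * ?a / (real k * err\<^sup>2)"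
    using k by (simp add: power2_eq_square)
  finally show ?thesis .
qed

section \<open>Weakest preconditions\<close>

text \<open>Total correctness with a postcondition that sees the running time. By
  \<open>exec_deterministic\<close> the halting run is unique, so its existence says everything
  about the program.\<close>

definition wp :: "(real \<Rightarrow> real) \<Rightarrow> nat \<Rightarrow> nat \<Rightarrow> com \<Rightarrow> (nat \<Rightarrow> state \<Rightarrow> bool) \<Rightarrow> state \<Rightarrow> bool" where
  "wp \<phi> d m c Q s \<longleftrightarrow> (\<exists>t s'. exec \<phi> d m c s t s' \<and> Q t s')"

lemma wp_Skip: "wp \<phi> d m Skip Q s \<longleftrightarrow> Q 1 s"
  unfolding wp_def by (metis exec.Skip exec_SkipE)

lemma wp_NSet: "wp \<phi> d m (NSet a e) Q s \<longleftrightarrow> nval a s < m \<and> Q (1 + ncost a + ncost e) (s\<lparr>nmem := (nmem s)(nval a s := nval e s)\<rparr>)"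
  unfolding wp_def
proof (rule iffI, elim exE conjE)
  fix t s' assume "exec \<phi> d m (NSet a e) s t s'" "Q t s'"
  then show "nval a s < m \<and> Q (1 + ncost a + ncost e) (s\<lparr>nmem := (nmem s)(nval a s := nval e s)\<rparr>)"
    by (elim exec_NSetE) simp
qed (use exec.NSet in blast)

lemma wp_RSet: "wp \<phi> d m (RSet a e) Q s \<longleftrightarrow> nval a s < m \<and> Q (1 + ncost a + rcost e) (s\<lparr>rmem := (rmem s)(nval a s := rval \<phi> d e s)\<rparr>)"
  unfolding wp_def
proof (rule iffI, elim exE conjE)
  fix t s' assume "exec \<phi> d m (RSet a e) s t s'" "Q t s'"
  then show "nval a s < m \<and> Q (1 + ncost a + rcost e) (s\<lparr>rmem := (rmem s)(nval a s := rval \<phi> d e s)\<rparr>)"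
    by (elim exec_RSetE) simp
qed (use exec.RSet in blast)

lemma wp_VSet: "wp \<phi> d m (VSet a e) Q s \<longleftrightarrow> nval a s < m \<and> Q (1 + ncost a + vcost e) (s\<lparr>vmem := (vmem s)(nval a s := vval d e s)\<rparr>)"
  unfolding wp_def
proof (rule iffI, elim exE conjE)
  fix t s' assume "exec \<phi> d m (VSet a e) s t s'" "Q t s'"
  then show "nval a s < m \<and> Q (1 + ncost a + vcost e) (s\<lparr>vmem := (vmem s)(nval a s := vval d e s)\<rparr>)"
    by (elim exec_VSetE) simp
qed (use exec.VSet in blast)

lemma wp_RandNat: "wp \<phi> d m (RandNat a e) Q s \<longleftrightarrow> nval a s < m \<and> Q (1 + ncost a + ncost e) (s\<lparr>nmem := (nmem s)(nval a s := nat \<lfloor>shd (utape s) * real (nval e s)\<rfloor>), utape := stl (utape s)\<rparr>)"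
  unfolding wp_def
proof (rule iffI, elim exE conjE)
  fix t s' assume "exec \<phi> d m (RandNat a e) s t s'" "Q t s'"
  then show "nval a s < m \<and> Q (1 + ncost a + ncost e) (s\<lparr>nmem := (nmem s)(nval a s := nat \<lfloor>shd (utape s) * real (nval e s)\<rfloor>), utape := stl (utape s)\<rparr>)"
    by (elim exec_RandNatE) simp
qed (use exec.RandNat in blast)

lemma wp_RandGauss: "wp \<phi> d m (RandGauss a) Q s \<longleftrightarrow> nval a s < m \<and> Q (1 + ncost a) (s\<lparr>vmem := (vmem s)(nval a s := shd (gtape s)), gtape := stl (gtape s)\<rparr>)"
  unfolding wp_def
proof (rule iffI, elim exE conjE)
  fix t s' assume "exec \<phi> d m (RandGauss a) s t s'" "Q t s'"
  then show "nval a s < m \<and> Q (1 + ncost a) (s\<lparr>vmem := (vmem s)(nval a s := shd (gtape s)), gtape := stl (gtape s)\<rparr>)"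
    by (elim exec_RandGaussE) simp
qed (use exec.RandGauss in blast)

lemma wp_Cond: "wp \<phi> d m (Cond b c1 c2) Q s \<longleftrightarrow>
    (if bval \<phi> d b s then wp \<phi> d m c1 (\<lambda>t. Q (1 + bcost b + t)) s
     else wp \<phi> d m c2 (\<lambda>t. Q (1 + bcost b + t)) s)"
  unfolding wp_def
proof (rule iffI, elim exE conjE)
  fix t s' assume "exec \<phi> d m (Cond b c1 c2) s t s'" "Q t s'"
  then show "if bval \<phi> d b s then \<exists>t s'. exec \<phi> d m c1 s t s' \<and> Q (1 + bcost b + t) s'
     else \<exists>t s'. exec \<phi> d m c2 s t s' \<and> Q (1 + bcost b + t) s'"
    by (elim exec_CondE) auto
next
  assume "if bval \<phi> d b s then \<exists>t s'. exec \<phi> d m c1 s t s' \<and> Q (1 + bcost b + t) s'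
     else \<exists>t s'. exec \<phi> d m c2 s t s' \<and> Q (1 + bcost b + t) s'"
  then show "\<exists>t s'. exec \<phi> d m (Cond b c1 c2) s t s' \<and> Q t s'"
    using exec.CondTrue exec.CondFalse by (cases "bval \<phi> d b s") fastforce+
qed

lemma wp_Seq: "wp \<phi> d m (Seq c1 c2) Q s \<longleftrightarrow> wp \<phi> d m c1 (\<lambda>t1. wp \<phi> d m c2 (\<lambda>t2. Q (1 + t1 + t2))) s"
  unfolding wp_def
proof (rule iffI, elim exE conjE)
  fix t s' assume "exec \<phi> d m (Seq c1 c2) s t s'" "Q t s'"
  then show "\<exists>t1 s1. exec \<phi> d m c1 s t1 s1 \<and> (\<exists>t2 s2. exec \<phi> d m c2 s1 t2 s2 \<and> Q (1 + t1 + t2) s2)"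
    by (elim exec_SeqE) auto
qed (use exec.Seq in blast)

lemmas wp_simps = wp_Skip wp_NSet wp_RSet wp_VSet wp_RandNat wp_RandGauss wp_Cond wp_Seq

lemma wp_mono:
  "wp \<phi> d m c Q s \<Longrightarrow> (\<And>t s'. Q t s' \<Longrightarrow> Q' t s') \<Longrightarrow> wp \<phi> d m c Q' s"
  unfolding wp_def by blast

text \<open>\<open>V\<close> is the time spent so far; it may depend on the state, for amortized bounds.\<close>

lemma wp_Loop:
  assumes "I 0 s"
    and step: "\<And>i s. i < N \<Longrightarrow> I i s \<Longrightarrow> bval \<phi> d b s \<and>
      wp \<phi> d m c (\<lambda>t s'. V i s + t + 1 + bcost b \<le> V (Suc i) s' \<and> I (Suc i) s') s"
    and exit: "\<And>s. I N s \<Longrightarrow> \<not> bval \<phi> d b s"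
  shows "wp \<phi> d m (Loop b c) (\<lambda>t s'. V 0 s + t \<le> V N s' + 1 + bcost b \<and> I N s') s"
proof -
  have "wp \<phi> d m (Loop b c) (\<lambda>t s'. V i s + t \<le> V N s' + 1 + bcost b \<and> I N s') s"
    if "i \<le> N" "I i s" for i s
    using that
  \<comment> \<open>Downward induction: the run from iteration i is assembled from one iteration and
    the run that follows it.\<close>
  proof (induction i arbitrary: s rule: inc_induct)
    case base
    then show ?case
      unfolding wp_def
      by (intro exI[of _ "1 + bcost b"] exI[of _ s] conjI exec.LoopFalse exit) auto
  next
    case (step i)
    from assms(2)[OF step.hyps(2) step.prems] obtain t1 s1 where 1:
      "bval \<phi> d b s" "exec \<phi> d m c s t1 s1" "V i s + t1 + 1 + bcost b \<le> V (Suc i) s1" "I (Suc i) s1"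
      unfolding wp_def by blast
    from step.IH[OF 1(4)] obtain t2 s2 where 2:
      "exec \<phi> d m (Loop b c) s1 t2 s2" "V (Suc i) s1 + t2 \<le> V N s2 + 1 + bcost b" "I N s2"
      unfolding wp_def by blast
    show ?case
      unfolding wp_def using 1(3) 2(2,3)
      by (intro exI[of _ "1 + bcost b + t1 + t2"] exI[of _ s2] conjI
          exec.LoopTrue[OF 1(1,2) 2(1)]) auto
  qed
  from this[of 0 s] assms(1) show ?thesis by simp
qed

lemma wp_Loop_const:
  assumes "I 0 s"
    and step: "\<And>i s. i < N \<Longrightarrow> I i s \<Longrightarrow> bval \<phi> d b s \<and>
      wp \<phi> d m c (\<lambda>t s'. t + 1 + bcost b \<le> T \<and> I (Suc i) s') s"
    and exit: "\<And>s. I N s \<Longrightarrow> \<not> bval \<phi> d b s"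
  shows "wp \<phi> d m (Loop b c) (\<lambda>t s'. t \<le> N * T + 1 + bcost b \<and> I N s') s"
proof -
  have "wp \<phi> d m (Loop b c) (\<lambda>t s'. 0 * T + t \<le> N * T + 1 + bcost b \<and> I N s') s"
    by (rule wp_Loop[where V = "\<lambda>i s. i * T"], rule assms(1))
       (use step exit in \<open>force elim!: wp_mono\<close>)+
  then show ?thesis by simp
qed

section \<open>The preprocessing program\<close>

text \<open>Memory layout of both programs. Naturals: 0 \<open>n\<close>, 2 \<open>K\<close>, 3 the number \<open>N\<close> of filters,
  4 the sample size \<open>B\<close> of level one, 5 the total sample size \<open>M = 2 n B\<close>, 6 the class \<open>k\<close>,
  7 the filter \<open>f\<close>, 8 the sample index \<open>j\<close>, 9 the position in a list, 10 the number of list entries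
  read, 11 the current stamp, 12 the level \<open>v\<close>; from 20 on the \<open>M\<close> stamps, and behind them, for each \<open>k\<close>
  and \<open>f\<close>, a block of \<open>M + 1\<close> cells with the number of samples that pass the filter and their indices
  in increasing order. Reals: 0 \<open>\<delta>\<close> and later the answer, 1 \<open>\<epsilon>\<close>, 2 \<open>G\<close>, 3 \<open>\<Lambda>\<close>, 4 an inner product,
  5 the sign \<open>\<sigma>\<close>, 6 the sum of a scan, 7 the estimate for the class, 8 the sum over the classes, 9 the
  budget. Vectors: the \<open>N\<close> filters, followed by the \<open>M\<close> samples.

  \<open>G = exp (100 sqrt K) = n\<^bsup>o(1)\<^esup>\<close> absorbs all lower-order factors.\<close>

abbreviation nv :: "nat \<Rightarrow> nexp" where "nv i \<equiv> NLoad (NConst i)"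
abbreviation rv :: "nat \<Rightarrow> rexp" where "rv i \<equiv> RLoad (NConst i)"
abbreviation rc :: "nat \<Rightarrow> rexp" where "rc i \<equiv> RNat (NConst i)"
abbreviation incr :: "nat \<Rightarrow> com" where "incr i \<equiv> NSet (NConst i) (NAdd (nv i) (NConst 1))"

definition radius_exp :: rexp where
  "radius_exp = RDiv (RNat (NAdd (NSub (nv 6) (nv 2)) (NSub (nv 2) (nv 6)))) (RNat (nv 2))"

text \<open>Squares are compared because the machine has no square root, and \<open>exp (ln z / 2)\<close> is \<open>1\<close> for
  \<open>z = 0\<close>.\<close>

definition pass_bexp :: bexp where
  "pass_bexp = BAnd (BNot (RLess (rv 4) (rc 0)))
     (BNot (RLess (RMul (rv 4) (rv 4)) (RMul (rv 3) (RMul radius_exp (RAdd (rc 1) radius_exp)))))"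

definition list_addr :: "nexp \<Rightarrow> nexp" where
  "list_addr e = NAdd (NAdd (NConst 20) (nv 5))
     (NAdd (NMul (NAdd (NMul (nv 6) (nv 3)) (nv 7)) (NAdd (nv 5) (NConst 1))) e)"

definition sample_step :: com where
  "sample_step = Seq (RandNat (NConst 8) (nv 0))
     (Seq (VSet (NAdd (nv 3) (nv 5)) (VInput (nv 8))) (incr 5))"

definition gauss_step :: com where
  "gauss_step = Seq (RandGauss (nv 3)) (incr 3)"

text \<open>The counter at offset 0 is incremented first, so that its new value is the offset of the
  new entry.\<close>

definition build_step :: com where
  "build_step = Seq (RSet (NConst 4) (RDot (VLoad (nv 7)) (VLoad (NAdd (nv 3) (nv 8)))))
     (Seq (Cond pass_bexp
        (Seq (NSet (list_addr (NConst 0)) (NAdd (NLoad (list_addr (NConst 0))) (NConst 1)))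
          (NSet (list_addr (NLoad (list_addr (NConst 0)))) (nv 8)))
        Skip)
      (incr 8))"

definition build_list :: com where
  "build_list = Seq (NSet (NConst 8) (NConst 0))
     (Seq (Loop (NLess (nv 8) (nv 5)) build_step) (incr 7))"

definition build_class :: com where
  "build_class = Seq (NSet (NConst 7) (NConst 0))
     (Seq (Loop (NLess (nv 7) (nv 3)) build_list) (incr 6))"

definition pre_main :: com where
  "pre_main =
     Seq (RSet (NConst 3) (RMul (RSub (rc 1) (rv 0)) (RLn (RNat (nv 0)))))
    (Seq (NSet (NConst 2) (NConst 2))
    (Seq (Loop (RLess (RNat (nv 2)) (RLn (RNat (nv 0)))) (incr 2))
    (Seq (RSet (NConst 2) (RExp (RMul (rc 100) (RExp (RDiv (RLn (RNat (nv 2))) (rc 2))))))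
    (Seq (RSet (NConst 9) (RDiv (RMul (RMul (rv 2) (RMul (rv 2) (rv 2))) (RExp (rv 3))) (RMul (rv 1) (rv 1))))
    (Seq (Loop (RLess (RNat (nv 3)) (RMul (rv 2) (RExp (rv 3)))) gauss_step)
    (Seq (Loop (RLess (RNat (nv 4)) (RDiv (rv 2) (RMul (rv 1) (rv 1)))) (incr 4))
    (Seq (Loop (NLess (nv 5) (NMul (NMul (NConst 2) (nv 0)) (nv 4))) sample_step)
    (Seq (NSet (NConst 6) (NConst 0))
         (Loop (NLess (nv 6) (NAdd (NMul (NConst 2) (nv 2)) (NConst 1))) build_class)))))))))"

text \<open>For \<epsilon> \<ge> 1 the number 0 is an admissible answer, as kernel means are
  nonnegative. This settles the range of large \<epsilon>, where the cost bound falls to its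
  floor.\<close>

definition pre_prog :: com where
  "pre_prog = Cond (RLess (rv 1) (rc 1)) pre_main Skip"

text \<open>The sum of two truncated differences is \<bar>k - K\<bar>, computed in the same way by
  \<open>radius_exp\<close>. Class k consists of the inner products in [k/K - 1, (k+1)/K -
  1).\<close>

definition radius :: "nat \<Rightarrow> nat \<Rightarrow> real" where
  "radius K k = real ((k - K) + (K - k)) / real K"

definition side :: "nat \<Rightarrow> nat \<Rightarrow> real" where
  "side K k = (if k < K then - 1 else 1)"

text \<open>Mirrors \<open>RandNat\<close> followed by \<open>VInput\<close>, including the zero
  vector that the machine returns for an index out of range.\<close>

definition pick :: "nat \<Rightarrow> rvec list \<Rightarrow> real \<Rightarrow> rvec" where
  "pick d xs u = (let i = nat \<lfloor>u * real (length xs)\<rfloor> in if i < length xs then xs ! i else zero_rvec d)"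

definition passes :: "real \<Rightarrow> nat \<Rightarrow> nat \<Rightarrow> real \<Rightarrow> bool" where
  "passes \<Lambda> K k a \<longleftrightarrow> 0 \<le> a \<and> \<Lambda> * (radius K k * (1 + radius K k)) \<le> a * a"

definition stored :: "state \<Rightarrow> nat \<Rightarrow> nat list \<Rightarrow> bool" where
  "stored s b l \<longleftrightarrow> nmem s b = length l \<and> (\<forall>e<length l. nmem s (b + Suc e) = l ! e)"

definition agree :: "nat set \<Rightarrow> nat set \<Rightarrow> state \<Rightarrow> state \<Rightarrow> bool" where
  "agree A R s s' \<longleftrightarrow> (\<forall>a. a \<notin> A \<longrightarrow> nmem s' a = nmem s a) \<and> (\<forall>a. a \<notin> R \<longrightarrow> rmem s' a = rmem s a) \<and>
     vmem s' = vmem s \<and> inputs s' = inputs s"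

section \<open>Correctness and running time of preprocessing\<close>

lemma bval_pass:
  assumes "nmem s 2 = K" "nmem s 6 = k" "rmem s 3 = \<Lambda>"
  shows "bval \<phi> d pass_bexp s \<longleftrightarrow> passes \<Lambda> K k (rmem s 4)"
  using assms by (auto simp: pass_bexp_def passes_def radius_def radius_exp_def not_less)

lemma bcost_pass: "bcost pass_bexp = 53"
  by (simp add: pass_bexp_def radius_exp_def)

lemma nval_list_addr:
  assumes "nmem s 5 = M" "nmem s 3 = N" "nmem s 6 = k" "nmem s 7 = f"
  shows "nval (list_addr e) s = 20 + M + (k * N + f) * (M + 1) + nval e s"
  using assms by (simp add: list_addr_def)

lemma ncost_list_addr: "ncost (list_addr e) = 19 + ncost e"
  by (simp add: list_addr_def)

text \<open>Counting up is how the machine obtains the ceiling of a real, at a cost proportional to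
  the result; K and B are computed in this way.\<close>

lemma wp_count_up:
  assumes x: "\<And>v. rval \<phi> d X (s\<lparr>nmem := (nmem s)(c := v)\<rparr>) = x" and "c < m"
    and "nmem s c = i0" "K = max i0 (nat \<lceil>x\<rceil>)"
  shows "wp \<phi> d m (Loop (RLess (RNat (nv c)) X) (incr c))
    (\<lambda>t s'. t \<le> (K - i0) * (rcost X + 12) + rcost X + 5 \<and> s' = s\<lparr>nmem := (nmem s)(c := K)\<rparr>) s"
proof -
  let ?I = "\<lambda>i s'. s' = s\<lparr>nmem := (nmem s)(c := i0 + i)\<rparr>"
  have "wp \<phi> d m (Loop (RLess (RNat (nv c)) X) (incr c))
    (\<lambda>t s'. t \<le> (K - i0) * (rcost X + 12) + 1 + bcost (RLess (RNat (nv c)) X) \<and> ?I (K - i0) s') s"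
  proof (rule wp_Loop_const)
    show "?I 0 s" using assms(3) by (cases s) auto
  next
    fix i s' assume i: "i < K - i0" and "?I i s'"
    then have s': "s' = s\<lparr>nmem := (nmem s)(c := i0 + i)\<rparr>" by simp
    from i assms(4) have "real (i0 + i) < x" by linarith
    then show "bval \<phi> d (RLess (RNat (nv c)) X) s' \<and> wp \<phi> d m (incr c)
        (\<lambda>t s''. t + 1 + bcost (RLess (RNat (nv c)) X) \<le> rcost X + 12 \<and> ?I (Suc i) s'') s'"
      using \<open>c < m\<close> by (simp add: s' x wp_simps)
  next
    fix s' assume "?I (K - i0) s'"
    moreover have "x \<le> real (i0 + (K - i0))" using assms(4) by linarith
    ultimately show "\<not> bval \<phi> d (RLess (RNat (nv c)) X) s'" by (simp add: x)
  qed
  then show ?thesis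
    by (rule wp_mono) (use assms(4) in auto)
qed

lemma wp_gauss_loop:
  assumes x: "rmem s 2 * exp (rmem s 3) = x" and "nmem s 3 = 0" "N = nat \<lceil>x\<rceil>" "N \<le> m" "3 < m"
  shows "wp \<phi> d m (Loop (RLess (RNat (nv 3)) (RMul (rv 2) (RExp (rv 3)))) gauss_step)
    (\<lambda>t s'. t \<le> N * 30 + 15 \<and> s' = s\<lparr>nmem := (nmem s)(3 := N),
       vmem := (\<lambda>a. if a < N then gtape s !! a else vmem s a), gtape := sdrop N (gtape s)\<rparr>) s"
proof -
  let ?b = "RLess (RNat (nv 3)) (RMul (rv 2) (RExp (rv 3)))"
  let ?I = "\<lambda>i s'. s' = s\<lparr>nmem := (nmem s)(3 := i),
       vmem := (\<lambda>a. if a < i then gtape s !! a else vmem s a), gtape := sdrop i (gtape s)\<rparr>"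
  have "wp \<phi> d m (Loop ?b gauss_step) (\<lambda>t s'. t \<le> N * 30 + 1 + bcost ?b \<and> ?I N s') s"
  proof (rule wp_Loop_const)
    show "?I 0 s" using assms(2) by (cases s) auto
  next
    fix i s' assume i: "i < N" and "?I i s'"
    then have s': "s' = s\<lparr>nmem := (nmem s)(3 := i),
       vmem := (\<lambda>a. if a < i then gtape s !! a else vmem s a), gtape := sdrop i (gtape s)\<rparr>" by simp
    from i assms(3) have "real i < x" by linarith
    moreover have "(\<lambda>a. if a < i then gtape s !! a else vmem s a)(i := gtape s !! i) =
        (\<lambda>a. if a < Suc i then gtape s !! a else vmem s a)"
      by (auto simp: fun_eq_iff less_Suc_eq)
    ultimately show "bval \<phi> d ?b s' \<and> wp \<phi> d m gauss_step (\<lambda>t s''. t + 1 + bcost ?b \<le> 30 \<and> ?I (Suc i) s'') s'"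
      using assms i by (simp add: s' gauss_step_def wp_simps sdrop_simps)
  next
    fix s' assume "?I N s'"
    moreover have "x \<le> real N" using assms(3) by linarith
    ultimately show "\<not> bval \<phi> d ?b s'" by (simp add: x)
  qed
  then show ?thesis by (rule wp_mono) auto
qed

lemma wp_sample_loop:
  assumes "nmem s 5 = 0" "nmem s 0 = length xs" "nmem s 4 = B" "nmem s 3 = N" "inputs s = xs"
    and M: "M = 2 * length xs * B" and m: "N + M \<le> m" "8 < m"
  shows "wp \<phi> d m (Loop (NLess (nv 5) (NMul (NMul (NConst 2) (nv 0)) (nv 4))) sample_step)
    (\<lambda>t s'. t \<le> M * 40 + 20 \<and> nmem s' 5 = M \<and> (\<forall>a. a \<noteq> 5 \<longrightarrow> a \<noteq> 8 \<longrightarrow> nmem s' a = nmem s a) \<and>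
       rmem s' = rmem s \<and> inputs s' = xs \<and>
       vmem s' = (\<lambda>a. if N \<le> a \<and> a < N + M then pick d xs (utape s !! (a - N)) else vmem s a)) s"
proof -
  let ?b = "NLess (nv 5) (NMul (NMul (NConst 2) (nv 0)) (nv 4))"
  let ?I = "\<lambda>i (s' :: state). nmem s' 5 = i \<and> (\<forall>a. a \<noteq> 5 \<longrightarrow> a \<noteq> 8 \<longrightarrow> nmem s' a = nmem s a) \<and>
       rmem s' = rmem s \<and> inputs s' = xs \<and> utape s' = sdrop i (utape s) \<and>
       vmem s' = (\<lambda>a. if N \<le> a \<and> a < N + i then pick d xs (utape s !! (a - N)) else vmem s a)"
  have "wp \<phi> d m (Loop ?b sample_step) (\<lambda>t s'. t \<le> M * 40 + 1 + bcost ?b \<and> ?I M s') s"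
  proof (rule wp_Loop_const[where I = ?I and N = M])
    show "?I 0 s" using assms by (auto simp: fun_eq_iff)
  next
    fix i and s' :: state assume i: "i < M" and I: "?I i s'"
    have "N + i < m" using m i by simp
    then show "bval \<phi> d ?b s' \<and> wp \<phi> d m sample_step (\<lambda>t s''. t + 1 + bcost ?b \<le> 40 \<and> ?I (Suc i) s'') s'"
      using assms(2-5) i I m M
      by (simp add: sample_step_def wp_simps) (auto simp: fun_eq_iff pick_def Let_def less_Suc_eq)
  next
    fix s' :: state assume "?I M s'"
    then show "\<not> bval \<phi> d ?b s'" using assms(2-5) M by simp
  qed
  then show ?thesis by (rule wp_mono) auto
qed

lemma wp_build_step:
  assumes c: "nmem s 5 = M" "nmem s 3 = N" "nmem s 6 = k" "nmem s 7 = f" "nmem s 8 = j" "nmem s 2 = K"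
      "rmem s 3 = \<Lambda>"
    and b: "b = 20 + M + (k * N + f) * (M + 1)" and m: "b + M < m"
    and l: "stored s b l" "length l \<le> j" and j: "j < M"
    and p: "p \<longleftrightarrow> passes \<Lambda> K k (dotp d (vmem s f) (vmem s (N + j)))"
  shows "wp \<phi> d m build_step (\<lambda>t s'. t \<le> 193 \<and> agree ({8} \<union> {b..b + M}) {4} s s' \<and>
      stored s' b (if p then l @ [j] else l) \<and> nmem s' 8 = Suc j) s"
proof -
  have bl: "b + length l < m" "b + Suc (length l) < m" "20 \<le> b" "b \<le> b + M" "Suc (length l) \<le> M"
    using l m b j by auto
  have ne: "b \<noteq> 8" "b \<noteq> 4" "b \<noteq> 5" "b \<noteq> 3" "b \<noteq> 6" "b \<noteq> 7" "b + Suc (length l) \<noteq> 8" using bl by auto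
  have A: "\<And>s e. nmem s 5 = M \<Longrightarrow> nmem s 3 = N \<Longrightarrow> nmem s 6 = k \<Longrightarrow> nmem s 7 = f \<Longrightarrow>
      nval (list_addr e) s = b + nval e s"
    unfolding b by (rule nval_list_addr)
  have st: "stored s' b (l @ [j])" if "nmem s' b = Suc (length l)" "nmem s' (b + Suc (length l)) = j"
    "\<And>e. e < length l \<Longrightarrow> nmem s' (b + Suc e) = nmem s (b + Suc e)" for s'
    using l(1) that unfolding stored_def by (auto simp: nth_append less_Suc_eq)
  define s1 where "s1 = s\<lparr>rmem := (rmem s)(4 := dotp d (vmem s f) (vmem s (N + j)))\<rparr>"
  have pass: "bval \<phi> d pass_bexp s1 \<longleftrightarrow> p"
    unfolding p using c by (subst bval_pass[where K = K and k = k and \<Lambda> = \<Lambda>]) (auto simp: s1_def)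
  show ?thesis
  proof (cases p)
    case True
    define s2 where "s2 = s1\<lparr>nmem := (nmem s1)(b := Suc (length l))\<rparr>"
    define s3 where "s3 = s2\<lparr>nmem := (nmem s2)(b + Suc (length l) := j)\<rparr>"
    have 2: "nval (list_addr (NConst 0)) s1 = b" "nmem s1 b = length l"
      using c l by (auto simp: A s1_def stored_def)
    have 3: "nval (list_addr (NLoad (list_addr (NConst 0)))) s2 = b + Suc (length l)"
      using c ne by (simp add: A s2_def s1_def)
    have 4: "nmem s2 8 = j" "nmem s2 = (nmem s)(b := Suc (length l))" using c ne by (auto simp: s2_def s1_def)
    have "wp \<phi> d m build_step (\<lambda>t s'. t \<le> 193 \<and> s' = s3\<lparr>nmem := (nmem s3)(8 := Suc j)\<rparr>) s"
      unfolding build_step_def wp_simps using c bl pass True 2 3 4 ne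
      by (simp add: s1_def[symmetric] ncost_list_addr bcost_pass s2_def[symmetric] s3_def[symmetric])
        (simp add: s3_def)
    then show ?thesis
    proof (rule wp_mono)
      fix t s' assume "t \<le> 193 \<and> s' = s3\<lparr>nmem := (nmem s3)(8 := Suc j)\<rparr>"
      then have t: "t \<le> 193" and s': "s' = s3\<lparr>nmem := (nmem s3)(8 := Suc j)\<rparr>" by auto
      have "stored s' b (l @ [j])"
        by (rule st) (use bl ne in \<open>auto simp: s' s3_def s2_def s1_def\<close>)
      moreover have "agree ({8} \<union> {b..b + M}) {4} s s'"
        using bl by (auto simp: agree_def s' s3_def s2_def s1_def)
      ultimately show "t \<le> 193 \<and> agree ({8} \<union> {b..b + M}) {4} s s' \<and>
          stored s' b (if p then l @ [j] else l) \<and> nmem s' 8 = Suc j"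
        using True t by (simp add: s')
    qed
  next
    case False
    have "wp \<phi> d m build_step (\<lambda>t s'. t \<le> 193 \<and> s' = s1\<lparr>nmem := (nmem s1)(8 := Suc j)\<rparr>) s"
      unfolding build_step_def wp_simps using c bl pass False
      by (simp add: s1_def[symmetric] bcost_pass) (simp add: s1_def)
    then show ?thesis
    proof (rule wp_mono)
      fix t s' assume "t \<le> 193 \<and> s' = s1\<lparr>nmem := (nmem s1)(8 := Suc j)\<rparr>"
      then show "t \<le> 193 \<and> agree ({8} \<union> {b..b + M}) {4} s s' \<and>
          stored s' b (if p then l @ [j] else l) \<and> nmem s' 8 = Suc j"
        using False l(1) bl by (auto simp: agree_def s1_def stored_def)
    qed
  qed
qed

lemma wp_build_list:
  assumes c: "nmem s 5 = M" "nmem s 3 = N" "nmem s 6 = k" "nmem s 7 = f" "nmem s 2 = K" "rmem s 3 = \<Lambda>"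
    and b: "b = 20 + M + (k * N + f) * (M + 1)" and m: "b + M < m" and z: "nmem s b = 0"
    and p: "\<And>j. j < M \<Longrightarrow> P j \<longleftrightarrow> passes \<Lambda> K k (dotp d (vmem s f) (vmem s (N + j)))"
  shows "wp \<phi> d m build_list (\<lambda>t s'. t \<le> M * 200 + 30 \<and> agree ({7, 8} \<union> {b..b + M}) {4} s s' \<and>
      stored s' b (filter P [0..<M]) \<and> nmem s' 7 = Suc f) s"
proof -
  let ?b = "NLess (nv 8) (nv 5)"
  let ?I = "\<lambda>j (s' :: state). agree ({8} \<union> {b..b + M}) {4} s s' \<and> stored s' b (filter P [0..<j]) \<and> nmem s' 8 = j"
  let ?s = "s\<lparr>nmem := (nmem s)(8 := 0)\<rparr>"
  have b20: "20 \<le> b" using b by simp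
  have "wp \<phi> d m (Loop ?b build_step) (\<lambda>t s'. t \<le> M * 200 + 1 + bcost ?b \<and> ?I M s') ?s"
  proof (rule wp_Loop_const[where I = ?I and N = M])
    show "?I 0 ?s" using z b20 by (auto simp: agree_def stored_def)
  next
    fix j and s' :: state assume j: "j < M" and I: "?I j s'"
    have r: "nmem s' 5 = M" "nmem s' 3 = N" "nmem s' 6 = k" "nmem s' 7 = f" "nmem s' 2 = K" "rmem s' 3 = \<Lambda>"
      "vmem s' = vmem s" "nmem s' 8 = j" "stored s' b (filter P [0..<j])"
      using I c b20 by (auto simp: agree_def)
    have "wp \<phi> d m build_step (\<lambda>t s''. t \<le> 193 \<and> agree ({8} \<union> {b..b + M}) {4} s' s'' \<and>
      stored s'' b (if P j then filter P [0..<j] @ [j] else filter P [0..<j]) \<and> nmem s'' 8 = Suc j) s'"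
      by (rule wp_build_step[OF r(1-4) r(8) r(5,6) b m r(9)])
         (use j p[OF j] r(7) in \<open>auto intro: order.trans[OF length_filter_le]\<close>)
    then have "wp \<phi> d m build_step (\<lambda>t s''. t + 1 + bcost ?b \<le> 200 \<and> ?I (Suc j) s'') s'"
      by (rule wp_mono) (use I in \<open>auto simp: agree_def split: if_splits\<close>)
    then show "bval \<phi> d ?b s' \<and> wp \<phi> d m build_step (\<lambda>t s''. t + 1 + bcost ?b \<le> 200 \<and> ?I (Suc j) s'') s'"
      using j r by simp
  next
    fix s' :: state assume "?I M s'"
    then show "\<not> bval \<phi> d ?b s'" using c b20 by (auto simp: agree_def)
  qed
  then have "wp \<phi> d m (Seq (Loop ?b build_step) (incr 7))
      (\<lambda>t s'. t \<le> M * 200 + 20 \<and> agree ({7, 8} \<union> {b..b + M}) {4} s s' \<and>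
      stored s' b (filter P [0..<M]) \<and> nmem s' 7 = Suc f) ?s"
    unfolding wp_simps by (rule wp_mono) (use c m b20 in \<open>auto simp: agree_def stored_def\<close>)
  moreover have "8 < m" using m b20 by simp
  ultimately show ?thesis
    by (auto simp: build_list_def wp_Seq[of _ _ _ "NSet _ _"] wp_NSet elim!: wp_mono)
qed

definition list_base :: "nat \<Rightarrow> nat \<Rightarrow> nat" where
  "list_base M q = 20 + M + q * (M + 1)"

text \<open>The cells behind the first \<open>q\<close> lists must still be zero, since the counters are not
  initialized by the program.\<close>

definition filled :: "(nat \<Rightarrow> nat \<Rightarrow> nat \<Rightarrow> bool) \<Rightarrow> nat \<Rightarrow> nat \<Rightarrow> nat \<Rightarrow> state \<Rightarrow> bool" where
  "filled P M N q s \<longleftrightarrow>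
     (\<forall>k f. f < N \<longrightarrow> k * N + f < q \<longrightarrow> stored s (list_base M (k * N + f)) (filter (P k f) [0..<M])) \<and>
     (\<forall>a \<ge> list_base M q. nmem s a = 0)"

definition same_params :: "state \<Rightarrow> state \<Rightarrow> bool" where
  "same_params s s' \<longleftrightarrow> (\<forall>a. a < 20 \<longrightarrow> a \<notin> {6, 7, 8} \<longrightarrow> nmem s' a = nmem s a) \<and>
     (\<forall>a. 20 \<le> a \<longrightarrow> a < 20 + nmem s 5 \<longrightarrow> nmem s' a = nmem s a) \<and>
     (\<forall>a. a \<noteq> 4 \<longrightarrow> rmem s' a = rmem s a) \<and> vmem s' = vmem s \<and> inputs s' = inputs s"

lemma list_base_mono: "q < q' \<Longrightarrow> list_base M q + M < list_base M q'"
proof -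
  assume "q < q'"
  then have "Suc q * (M + 1) \<le> q' * (M + 1)" by (intro mult_right_mono) auto
  then show ?thesis by (simp add: list_base_def)
qed

lemma filled_Suc:
  assumes "filled P M N (k * N + f) s" "f < N"
    and ag: "agree ({7, 8} \<union> {b..b + M}) {4} s s'" and b: "b = list_base M (k * N + f)"
    and st: "stored s' b (filter (P k f) [0..<M])"
  shows "filled P M N (Suc (k * N + f)) s'"
  unfolding filled_def
proof (intro conjI allI impI)
  fix k' f' assume f': "f' < N" and lt: "k' * N + f' < Suc (k * N + f)"
  show "stored s' (list_base M (k' * N + f')) (filter (P k' f') [0..<M])"
  proof (cases "k' * N + f' = k * N + f")
    case True
    \<comment> \<open>Division with remainder by N recovers class and filter from the number of a
      list.\<close>
    then have "(k' * N + f') div N = (k * N + f) div N" "(k' * N + f') mod N = (k * N + f) mod N" by simp_all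
    then have "k' = k" "f' = f" using f' \<open>f < N\<close> by simp_all
    then show ?thesis using st b by simp
  next
    case False
    with lt have q: "k' * N + f' < k * N + f" by simp
    then have 1: "stored s (list_base M (k' * N + f')) (filter (P k' f') [0..<M])"
      using assms(1) f' by (simp add: filled_def)
    have 2: "list_base M (k' * N + f') + M < b" unfolding b by (rule list_base_mono) fact
    have "length (filter (P k' f') [0..<M]) \<le> M"
      using length_filter_le[of "P k' f'" "[0..<M]"] by simp
    moreover have "nmem s' a = nmem s a" if "list_base M (k' * N + f') \<le> a" "a \<le> list_base M (k' * N + f') + M" for a
      using ag that 2 unfolding agree_def by (auto simp: list_base_def)
    ultimately show ?thesis using 1 unfolding stored_def by auto
  qed
next
  fix a assume a: "list_base M (Suc (k * N + f)) \<le> a"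
  then have "b + M < a" using list_base_mono[of "k * N + f" "Suc (k * N + f)" M] b by simp
  moreover have "20 \<le> b" by (simp add: b list_base_def)
  ultimately show "nmem s' a = 0"
    using ag assms(1) unfolding agree_def filled_def by (auto simp: b)
qed

lemma wp_build_class:
  assumes c: "nmem s 5 = M" "nmem s 3 = N" "nmem s 6 = k" "nmem s 2 = K" "rmem s 3 = \<Lambda>"
    and m: "list_base M (Suc k * N) \<le> m" "20 < m" and F: "filled P M N (k * N) s"
    and p: "\<And>f j. f < N \<Longrightarrow> j < M \<Longrightarrow> P k f j \<longleftrightarrow> passes \<Lambda> K k (dotp d (vmem s f) (vmem s (N + j)))"
  shows "wp \<phi> d m build_class (\<lambda>t s'. t \<le> N * (M * 200 + 40) + 30 \<and> same_params s s' \<and>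
      filled P M N (Suc k * N) s' \<and> nmem s' 6 = Suc k) s"
proof -
  let ?b = "NLess (nv 7) (nv 3)"
  let ?I = "\<lambda>f (s' :: state). same_params s s' \<and> filled P M N (k * N + f) s' \<and> nmem s' 7 = f \<and> nmem s' 6 = k"
  let ?s = "s\<lparr>nmem := (nmem s)(7 := 0)\<rparr>"
  have "wp \<phi> d m (Loop ?b build_list) (\<lambda>t s'. t \<le> N * (M * 200 + 40) + 1 + bcost ?b \<and> ?I N s') ?s"
  proof (rule wp_Loop_const[where I = ?I and N = N])
    show "?I 0 ?s" using F c by (auto simp: same_params_def filled_def stored_def list_base_def)
  next
    fix f and s' :: state assume f: "f < N" and I: "?I f s'"
    have r: "nmem s' 5 = M" "nmem s' 3 = N" "nmem s' 6 = k" "nmem s' 7 = f" "nmem s' 2 = K" "rmem s' 3 = \<Lambda>"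
      "vmem s' = vmem s"
      using I c by (auto simp: same_params_def)
    define b where "b = list_base M (k * N + f)"
    have b': "b = 20 + M + (k * N + f) * (M + 1)" by (simp add: b_def list_base_def)
    have "b + M < list_base M (Suc k * N)" unfolding b_def by (rule list_base_mono) (use f in simp)
    then have bm: "b + M < m" using m by simp
    have z: "nmem s' b = 0" using I by (simp add: filled_def b_def)
    have "wp \<phi> d m build_list (\<lambda>t s''. t \<le> M * 200 + 30 \<and> agree ({7, 8} \<union> {b..b + M}) {4} s' s'' \<and>
      stored s'' b (filter (P k f) [0..<M]) \<and> nmem s'' 7 = Suc f) s'"
      by (rule wp_build_list[OF r(1-6) b' bm z]) (use p f r(7) in auto)
    then have "wp \<phi> d m build_list (\<lambda>t s''. t + 1 + bcost ?b \<le> M * 200 + 40 \<and> ?I (Suc f) s'') s'"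
    proof (rule wp_mono)
      fix t and s'' :: state
      assume *: "t \<le> M * 200 + 30 \<and> agree ({7, 8} \<union> {b..b + M}) {4} s' s'' \<and>
        stored s'' b (filter (P k f) [0..<M]) \<and> nmem s'' 7 = Suc f"
      have "filled P M N (Suc (k * N + f)) s''"
        by (rule filled_Suc[OF _ f _ b_def]) (use I * in auto)
      moreover have "same_params s s''" "nmem s'' 6 = k"
        using I * c b' by (auto simp: same_params_def agree_def)
      ultimately show "t + 1 + bcost ?b \<le> M * 200 + 40 \<and> ?I (Suc f) s''" using * by simp
    qed
    then show "bval \<phi> d ?b s' \<and> wp \<phi> d m build_list (\<lambda>t s''. t + 1 + bcost ?b \<le> M * 200 + 40 \<and> ?I (Suc f) s'') s'"
      using f r by simp
  next
    fix s' :: state assume "?I N s'"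
    then show "\<not> bval \<phi> d ?b s'" using c by (auto simp: same_params_def)
  qed
  then have "wp \<phi> d m (Seq (Loop ?b build_list) (incr 6))
      (\<lambda>t s'. t \<le> N * (M * 200 + 40) + 20 \<and> same_params s s' \<and>
      filled P M N (Suc k * N) s' \<and> nmem s' 6 = Suc k) ?s"
    unfolding wp_simps
  proof (rule wp_mono)
    fix t and s' :: state assume *: "t \<le> N * (M * 200 + 40) + 1 + bcost ?b \<and> ?I N s'"
    have "filled P M N (Suc k * N) (s'\<lparr>nmem := (nmem s')(6 := Suc k)\<rparr>)"
      using * by (auto simp: filled_def stored_def list_base_def add.commute)
    then show "nval (NConst 6) s' < m \<and> 1 + t + (1 + ncost (NConst 6) + ncost (NAdd (nv 6) (NConst 1)))
        \<le> N * (M * 200 + 40) + 20 \<and>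
       same_params s (s'\<lparr>nmem := (nmem s')(nval (NConst 6) s' := nval (NAdd (nv 6) (NConst 1)) s')\<rparr>) \<and>
       filled P M N (Suc k * N) (s'\<lparr>nmem := (nmem s')(nval (NConst 6) s' := nval (NAdd (nv 6) (NConst 1)) s')\<rparr>) \<and>
       nmem (s'\<lparr>nmem := (nmem s')(nval (NConst 6) s' := nval (NAdd (nv 6) (NConst 1)) s')\<rparr>) 6 = Suc k"
      using * m by (auto simp: same_params_def)
  qed
  then show ?thesis
    using m by (auto simp: build_class_def wp_Seq[of _ _ _ "NSet _ _"] wp_NSet elim!: wp_mono)
qed

lemma wp_build_table:
  assumes c: "nmem s 5 = M" "nmem s 3 = N" "nmem s 6 = 0" "nmem s 2 = K" "rmem s 3 = \<Lambda>"
    and m: "list_base M ((2 * K + 1) * N) \<le> m" "20 < m" and F: "\<forall>a \<ge> 20. nmem s a = 0"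
    and p: "\<And>k f j. f < N \<Longrightarrow> j < M \<Longrightarrow> P k f j \<longleftrightarrow> passes \<Lambda> K k (dotp d (vmem s f) (vmem s (N + j)))"
  shows "wp \<phi> d m (Loop (NLess (nv 6) (NAdd (NMul (NConst 2) (nv 2)) (NConst 1))) build_class)
    (\<lambda>t s'. t \<le> (2 * K + 1) * (N * (M * 200 + 40) + 50) + 20 \<and> same_params s s' \<and>
      filled P M N ((2 * K + 1) * N) s') s"
proof -
  let ?b = "NLess (nv 6) (NAdd (NMul (NConst 2) (nv 2)) (NConst 1))"
  let ?I = "\<lambda>k (s' :: state). same_params s s' \<and> filled P M N (k * N) s' \<and> nmem s' 6 = k"
  have "wp \<phi> d m (Loop ?b build_class)
    (\<lambda>t s'. t \<le> (2 * K + 1) * (N * (M * 200 + 40) + 50) + 1 + bcost ?b \<and> ?I (2 * K + 1) s') s"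
  proof (rule wp_Loop_const[where I = ?I and N = "2 * K + 1"])
    show "?I 0 s" using F c by (auto simp: same_params_def filled_def list_base_def)
  next
    fix k and s' :: state assume k: "k < 2 * K + 1" and I: "?I k s'"
    have r: "nmem s' 5 = M" "nmem s' 3 = N" "nmem s' 6 = k" "nmem s' 2 = K" "rmem s' 3 = \<Lambda>" "vmem s' = vmem s"
      using I c by (auto simp: same_params_def)
    have "Suc k * N * (M + 1) \<le> (2 * K + 1) * N * (M + 1)" using k by (intro mult_right_mono) auto
    then have "list_base M (Suc k * N) \<le> m" using m(1) by (simp add: list_base_def)
    from wp_build_class[where P = P and s = s', OF r(1-5) this m(2)] I p r(6)
    have "wp \<phi> d m build_class (\<lambda>t s''. t \<le> N * (M * 200 + 40) + 30 \<and> same_params s' s'' \<and>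
      filled P M N (Suc k * N) s'' \<and> nmem s'' 6 = Suc k) s'" by auto
    then have "wp \<phi> d m build_class (\<lambda>t s''. t + 1 + bcost ?b \<le> N * (M * 200 + 40) + 50 \<and> ?I (Suc k) s'') s'"
    proof (rule wp_mono)
      fix t and s'' :: state
      assume *: "t \<le> N * (M * 200 + 40) + 30 \<and> same_params s' s'' \<and>
        filled P M N (Suc k * N) s'' \<and> nmem s'' 6 = Suc k"
      have "same_params s s''" using I * r(1) c(1) by (auto simp: same_params_def)
      then show "t + 1 + bcost ?b \<le> N * (M * 200 + 40) + 50 \<and> ?I (Suc k) s''" using * by simp
    qed
    then show "bval \<phi> d ?b s' \<and>
        wp \<phi> d m build_class (\<lambda>t s''. t + 1 + bcost ?b \<le> N * (M * 200 + 40) + 50 \<and> ?I (Suc k) s'') s'"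
      using k r by simp
  next
    fix s' :: state assume "?I (2 * K + 1) s'"
    then show "\<not> bval \<phi> d ?b s'" using c by (auto simp: same_params_def)
  qed
  then show ?thesis by (rule wp_mono) auto
qed

lemma wp_SeqI:
  assumes "wp \<phi> d m c1 (\<lambda>t s'. t \<le> T1 \<and> P s') s"
    and "\<And>s'. P s' \<Longrightarrow> wp \<phi> d m c2 (\<lambda>t s''. t \<le> T2 \<and> Q s'') s'" and "T1 + T2 + 1 \<le> T"
  shows "wp \<phi> d m (Seq c1 c2) (\<lambda>t s''. t \<le> T \<and> Q s'') s"
  unfolding wp_Seq
  by (rule wp_mono[OF assms(1)], elim conjE, drule assms(2), erule wp_mono) (use assms(3) in auto)

text \<open>The interface between the two programs. All stamps equal the current stamp 0, so that
  the first scan, which has stamp 1, meets only fresh samples.\<close>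

definition prepared :: "nat \<Rightarrow> nat \<Rightarrow> nat \<Rightarrow> nat \<Rightarrow> nat \<Rightarrow> nat \<Rightarrow> real \<Rightarrow> real \<Rightarrow> real \<Rightarrow> real \<Rightarrow>
    (nat \<Rightarrow> rvec) \<Rightarrow> (nat \<Rightarrow> rvec) \<Rightarrow> state \<Rightarrow> bool" where
  "prepared d n K N B M \<epsilon> G \<Lambda> bud gs sm s \<longleftrightarrow>
     nmem s 0 = n \<and> nmem s 2 = K \<and> nmem s 3 = N \<and> nmem s 4 = B \<and> nmem s 5 = M \<and> nmem s 11 = 0 \<and>
     (\<forall>a. 20 \<le> a \<longrightarrow> a < 20 + M \<longrightarrow> nmem s a = 0) \<and>
     rmem s 1 = \<epsilon> \<and> rmem s 2 = G \<and> rmem s 3 = \<Lambda> \<and> rmem s 9 = bud \<and>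
     (\<forall>f<N. vmem s f = gs f) \<and> (\<forall>j<M. vmem s (N + j) = sm j) \<and>
     (\<forall>k f. k < 2 * K + 1 \<longrightarrow> f < N \<longrightarrow> stored s (list_base M (k * N + f))
        (filter (\<lambda>j. passes \<Lambda> K k (dotp d (gs f) (sm j))) [0..<M]))"

definition pre_time :: "nat \<Rightarrow> nat \<Rightarrow> nat \<Rightarrow> nat \<Rightarrow> nat" where
  "pre_time K N B M = K * 16 + N * 30 + B * 20 + M * 40 + (2 * K + 1) * (N * (M * 200 + 40) + 50) + 400"

lemma wp_pre_main:
  fixes \<omega> :: "real stream \<times> rvec stream"
  assumes n: "n = length xs" and \<Lambda>: "\<Lambda> = (1 - \<delta>) * ln (real n)" and K: "K = max 2 (nat \<lceil>ln (real n)\<rceil>)"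
    and G: "G = exp (100 * exp (ln (real K) / 2))" and N: "N = nat \<lceil>G * exp \<Lambda>\<rceil>"
    and B: "B = nat \<lceil>G / (\<epsilon> * \<epsilon>)\<rceil>" and M: "M = 2 * n * B"
    and bud: "bud = G * (G * G) * exp \<Lambda> / (\<epsilon> * \<epsilon>)"
    and m: "list_base M ((2 * K + 1) * N) \<le> m"
  shows "wp \<phi> d m pre_main (\<lambda>t s. t \<le> pre_time K N B M \<and>
      prepared d n K N B M \<epsilon> G \<Lambda> bud (\<lambda>f. snd \<omega> !! f) (\<lambda>j. pick d xs (fst \<omega> !! j)) s)
    (init_state n d \<delta> \<epsilon> xs \<omega>)"
proof -
  let ?gs = "\<lambda>f. snd \<omega> !! f" and ?sm = "\<lambda>j. pick d xs (fst \<omega> !! j)"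
  let ?prep = "prepared d n K N B M \<epsilon> G \<Lambda> bud ?gs ?sm"
  have "0 < G * exp \<Lambda>" by (simp add: G)
  then have N1: "1 \<le> N" unfolding N by linarith
  define Z where "Z = (2 * K + 1) * N * (M + 1)"
  \<comment> \<open>As N \<ge> 1, room for the table implies room for the N + M vectors, so that one
    bound m serves all memories.\<close>
  have "1 * (M + 1) \<le> Z"
    unfolding Z_def by (rule mult_right_mono) (use N1 in auto)
  moreover have "N \<le> Z" by (simp add: Z_def)
  moreover have "20 + M + Z \<le> m" using m by (simp only: list_base_def Z_def)
  ultimately have mm: "N + M \<le> m" "N \<le> m" "20 < m" by auto
  define s0 where "s0 = init_state n d \<delta> \<epsilon> xs \<omega>"
  define s1 where "s1 = s0\<lparr>rmem := (rmem s0)(3 := \<Lambda>), nmem := (nmem s0)(2 := K)\<rparr>"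
  define s2 where "s2 = s1\<lparr>rmem := (rmem s1)(2 := G, 9 := bud)\<rparr>"
  define s3 where "s3 = s2\<lparr>nmem := (nmem s2)(3 := N),
       vmem := (\<lambda>a. if a < N then gtape s2 !! a else vmem s2 a), gtape := sdrop N (gtape s2)\<rparr>"
  define s4 where "s4 = s3\<lparr>nmem := (nmem s3)(4 := B)\<rparr>"
  define tab where "tab = Loop (NLess (nv 6) (NAdd (NMul (NConst 2) (nv 2)) (NConst 1))) build_class"
  define c6 where "c6 = Seq (NSet (NConst 6) (NConst 0)) tab"
  define c5 where "c5 = Seq (Loop (NLess (nv 5) (NMul (NMul (NConst 2) (nv 0)) (nv 4))) sample_step) c6"
  define c4 where "c4 = Seq (Loop (RLess (RNat (nv 4)) (RDiv (rv 2) (RMul (rv 1) (rv 1)))) (incr 4)) c5"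
  define c3 where "c3 = Seq (Loop (RLess (RNat (nv 3)) (RMul (rv 2) (RExp (rv 3)))) gauss_step) c4"
  define c2 where "c2 = Seq (RSet (NConst 2) (RExp (RMul (rc 100) (RExp (RDiv (RLn (RNat (nv 2))) (rc 2))))))
    (Seq (RSet (NConst 9) (RDiv (RMul (RMul (rv 2) (RMul (rv 2) (rv 2))) (RExp (rv 3))) (RMul (rv 1) (rv 1)))) c3)"
  define c1 where "c1 = Seq (Loop (RLess (RNat (nv 2)) (RLn (RNat (nv 0)))) (incr 2)) c2"
  let ?T6 = "(2 * K + 1) * (N * (M * 200 + 40) + 50)"
  have s4: "nmem s4 = (\<lambda>_. 0)(0 := n, 1 := d, 2 := K, 3 := N, 4 := B)"
    "rmem s4 = (\<lambda>_. 0)(0 := \<delta>, 1 := \<epsilon>, 2 := G, 3 := \<Lambda>, 9 := bud)" "inputs s4 = xs" "utape s4 = fst \<omega>"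
    "vmem s4 = (\<lambda>a. if a < N then snd \<omega> !! a else zero_rvec d)"
    by (auto simp: s4_def s3_def s2_def s1_def s0_def init_state_def fun_eq_iff)
  \<comment> \<open>The program is verified from its end: c5, c4, and so on are its remainders, each
    started in the explicit state in which its predecessor halts.\<close>
  have 5: "wp \<phi> d m c5 (\<lambda>t s. t \<le> ?T6 + M * 40 + 60 \<and> ?prep s) s4"
    unfolding c5_def wp_Seq
  proof (rule wp_mono[OF wp_sample_loop[where xs = xs and B = B and N = N and M = M]])
    fix t and s :: state
    assume *: "t \<le> M * 40 + 20 \<and> nmem s 5 = M \<and> (\<forall>a. a \<noteq> 5 \<longrightarrow> a \<noteq> 8 \<longrightarrow> nmem s a = nmem s4 a) \<and>
       rmem s = rmem s4 \<and> inputs s = xs \<and>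
       vmem s = (\<lambda>a. if N \<le> a \<and> a < N + M then pick d xs (utape s4 !! (a - N)) else vmem s4 a)"
    define s6 where "s6 = s\<lparr>nmem := (nmem s)(6 := 0)\<rparr>"
    have v: "vmem s6 f = snd \<omega> !! f" if "f < N" for f using that * by (simp add: s6_def s4)
    have w: "vmem s6 (N + j) = ?sm j" if "j < M" for j using that * by (simp add: s6_def s4)
    have "wp \<phi> d m tab (\<lambda>t s'. t \<le> ?T6 + 20 \<and> same_params s6 s' \<and>
      filled (\<lambda>k f j. passes \<Lambda> K k (dotp d (?gs f) (?sm j))) M N ((2 * K + 1) * N) s') s6"
      unfolding tab_def
      by (rule wp_build_table) (use * mm m v w in \<open>simp_all add: s6_def s4\<close>)
    then have "wp \<phi> d m tab (\<lambda>t s'. t \<le> ?T6 + 20 \<and> ?prep s') s6"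
    proof (rule wp_mono)
      fix t and s' :: state
      assume **: "t \<le> ?T6 + 20 \<and> same_params s6 s' \<and>
        filled (\<lambda>k f j. passes \<Lambda> K k (dotp d (?gs f) (?sm j))) M N ((2 * K + 1) * N) s'"
      have "k * N + f < (2 * K + 1) * N" if "k < 2 * K + 1" "f < N" for k f
      proof -
        have "k * N + f < Suc k * N" using that by simp
        also have "\<dots> \<le> (2 * K + 1) * N" using that by (intro mult_right_mono) auto
        finally show ?thesis .
      qed
      then have "stored s' (list_base M (k * N + f))
        (filter (\<lambda>j. passes \<Lambda> K k (dotp d (?gs f) (?sm j))) [0..<M])" if "k < 2 * K + 1" "f < N" for k f
        using that ** by (simp add: filled_def)
      moreover have "nmem s' a = nmem s6 a" if "a < 20" "a \<notin> {6, 7, 8}" for a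
        using that ** by (auto simp: same_params_def)
      moreover have "nmem s' a = nmem s6 a" if "20 \<le> a" "a < 20 + M" for a
        using that ** * by (auto simp: same_params_def s6_def)
      moreover have "rmem s' a = rmem s6 a" if "a \<noteq> 4" for a
        using that ** by (auto simp: same_params_def)
      moreover have "vmem s' = vmem s6" using ** by (simp add: same_params_def)
      ultimately show "t \<le> ?T6 + 20 \<and> ?prep s'"
        using ** * v w by (simp add: prepared_def s6_def s4)
    qed
    then show "wp \<phi> d m c6 (\<lambda>t2 s. 1 + t + t2 \<le> ?T6 + M * 40 + 60 \<and> ?prep s) s"
      unfolding c6_def wp_Seq wp_NSet using mm * by (auto simp: s6_def elim!: wp_mono)
  qed (use n M mm in \<open>simp_all add: s4\<close>)
  have "wp \<phi> d m (Loop (RLess (RNat (nv 4)) (RDiv (rv 2) (RMul (rv 1) (rv 1)))) (incr 4))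
      (\<lambda>t s. t \<le> B * 20 + 13 \<and> s = s4) s3"
    by (rule wp_mono[OF wp_count_up[where x = "G / (\<epsilon> * \<epsilon>)" and ?i0.0 = 0 and K = B]])
       (use mm in \<open>auto simp: s4_def s3_def s2_def s1_def s0_def init_state_def B\<close>)
  then have 4: "wp \<phi> d m c4 (\<lambda>t s. t \<le> ?T6 + M * 40 + B * 20 + 80 \<and> ?prep s) s3"
    unfolding c4_def by (rule wp_SeqI) (use 5 in auto)
  have "wp \<phi> d m (Loop (RLess (RNat (nv 3)) (RMul (rv 2) (RExp (rv 3)))) gauss_step)
      (\<lambda>t s. t \<le> N * 30 + 15 \<and> s = s3) s2"
    by (rule wp_mono[OF wp_gauss_loop[where x = "G * exp \<Lambda>" and N = N]])
       (use mm N in \<open>auto simp: s3_def s2_def s1_def s0_def init_state_def\<close>)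
  then have 3: "wp \<phi> d m c3 (\<lambda>t s. t \<le> ?T6 + M * 40 + B * 20 + N * 30 + 100 \<and> ?prep s) s2"
    unfolding c3_def by (rule wp_SeqI) (use 4 in auto)
  have 2: "wp \<phi> d m c2 (\<lambda>t s. t \<le> ?T6 + M * 40 + B * 20 + N * 30 + 200 \<and> ?prep s) s1"
  proof -
    have "rmem s1 3 = \<Lambda>" "rmem s1 1 = \<epsilon>" "nmem s1 2 = K"
      by (simp_all add: s1_def s0_def init_state_def)
    then show ?thesis
      unfolding c2_def wp_simps using mm 3
      by (auto simp: s2_def[unfolded bud G] G[symmetric] bud elim!: wp_mono)
  qed
  let ?s = "s0\<lparr>rmem := (rmem s0)(3 := \<Lambda>), nmem := (nmem s0)(2 := 2)\<rparr>"
  have "wp \<phi> d m (Loop (RLess (RNat (nv 2)) (RLn (RNat (nv 0)))) (incr 2))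
      (\<lambda>t s. t \<le> K * 16 + 9 \<and> s = s1) ?s"
    by (rule wp_mono[OF wp_count_up[where x = "ln (real n)" and ?i0.0 = 2 and K = K]])
       (use mm K in \<open>auto simp: s1_def s0_def init_state_def\<close>)
  then have 1: "wp \<phi> d m c1 (\<lambda>t s. t \<le> ?T6 + M * 40 + B * 20 + N * 30 + K * 16 + 220 \<and> ?prep s) ?s"
    unfolding c1_def by (rule wp_SeqI) (use 2 in auto)
  have 0: "rmem s0 0 = \<delta>" "nmem s0 0 = n" by (simp_all add: s0_def init_state_def)
  have pm: "pre_main = Seq (RSet (NConst 3) (RMul (RSub (rc 1) (rv 0)) (RLn (RNat (nv 0)))))
    (Seq (NSet (NConst 2) (NConst 2)) c1)"
    by (simp add: pre_main_def c1_def c2_def c3_def c4_def c5_def c6_def tab_def)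
  show ?thesis
    unfolding s0_def[symmetric] pm using 1 mm
    by (simp add: 0 wp_Seq wp_RSet wp_NSet \<Lambda>[symmetric] pre_time_def) (erule wp_mono, simp)
qed

section \<open>The query program\<close>

definition class_bexp :: bexp where
  "class_bexp = BAnd
     (BNot (RLess (RMul (RAdd (rc 1) (rv 4)) (RNat (nv 2))) (RNat (nv 6))))
     (RLess (RMul (RAdd (rc 1) (rv 4)) (RNat (nv 2))) (RNat (NAdd (nv 6) (NConst 1))))"

text \<open>A sample of level v consists of the indices below v B, and lists are increasing. Hence
  the third test may stop at the first index outside the sample, and one table serves all levels.
  Behind the end of a list this test reads an unrelated cell, which is harmless because the first
  test fails there.\<close>

definition scan_guard :: bexp where
  "scan_guard = BAnd (NLess (nv 9) (NLoad (list_addr (NConst 0))))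
     (BAnd (RLess (RNat (nv 10)) (rv 9))
       (NLess (NLoad (list_addr (NAdd (nv 9) (NConst 1)))) (NMul (nv 12) (nv 4))))"

text \<open>A sample caught by several filters must be counted once only: it is stamped with the number
  of the current scan, and stamps only grow.\<close>

definition scan_step :: com where
  "scan_step = Seq (NSet (NConst 8) (NLoad (list_addr (NAdd (nv 9) (NConst 1)))))
     (Seq (Cond (NLess (NLoad (NAdd (NConst 20) (nv 8))) (nv 11))
        (Seq (NSet (NAdd (NConst 20) (nv 8)) (nv 11))
        (Seq (RSet (NConst 4) (RDot (VLoad (NAdd (nv 3) (nv 8))) (VInput (NConst 0))))
             (Cond class_bexp (RSet (NConst 6) (RAdd (rv 6) (RExp (RPhi (rv 4))))) Skip)))
        Skip)
     (Seq (incr 9) (incr 10)))"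

text \<open>Of the N filters, which suffice for the largest radius, a class of radius r uses only
  the first G exp (\<Lambda> r), rounded up: enough for recall, while further ones would raise the
  expected number of collisions.\<close>

definition filter_guard :: bexp where
  "filter_guard = RLess (RNat (nv 7)) (RMul (rv 2) (RExp (RMul (rv 3) radius_exp)))"

definition filter_step :: com where
  "filter_step = Seq (RSet (NConst 4) (RMul (rv 5) (RDot (VLoad (nv 7)) (VInput (NConst 0)))))
     (Seq (Cond pass_bexp (Seq (NSet (NConst 9) (NConst 0)) (Loop scan_guard scan_step)) Skip)
     (incr 7))"

text \<open>An aborted scan leaves real cell 7 alone. A scan whose counter reaches the budget counts
  as aborted even if it happened to be complete, because the counter cannot distinguish the
  two.\<close>

definition level_step :: com where
  "level_step = Seq (incr 11) (Seq (NSet (NConst 10) (NConst 0)) (Seq (RSet (NConst 6) (rc 0))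
     (Seq (NSet (NConst 7) (NConst 0)) (Seq (Loop filter_guard filter_step)
     (Seq (Cond (RLess (RNat (nv 10)) (rv 9))
            (RSet (NConst 7) (RDiv (rv 6) (RNat (NMul (nv 12) (nv 4))))) Skip)
          (NSet (NConst 12) (NAdd (nv 12) (nv 12))))))))"

definition class_step :: com where
  "class_step = Seq (Cond (NLess (nv 6) (nv 2)) (RSet (NConst 5) (RSub (rc 0) (rc 1))) (RSet (NConst 5) (rc 1)))
     (Seq (RSet (NConst 7) (rc 0)) (Seq (NSet (NConst 12) (NConst 1))
     (Seq (Loop (NLess (nv 12) (NMul (NConst 2) (nv 0))) level_step)
     (Seq (RSet (NConst 8) (RAdd (rv 8) (rv 7))) (incr 6)))))"

definition qry_main :: com where
  "qry_main = Seq (NSet (NConst 6) (NConst 0)) (Seq (RSet (NConst 8) (rc 0))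
     (Seq (Loop (NLess (nv 6) (NAdd (NMul (NConst 2) (nv 2)) (NConst 1))) class_step)
       (RSet (NConst 0) (rv 8))))"

definition qry_prog :: com where
  "qry_prog = Cond (RLess (rv 1) (rc 1)) qry_main (RSet (NConst 0) (rc 0))"

definition class_weight :: "(real \<Rightarrow> real) \<Rightarrow> nat \<Rightarrow> nat \<Rightarrow> real \<Rightarrow> real" where
  "class_weight \<phi> K k \<rho> = (if real k \<le> (1 + \<rho>) * real K \<and> (1 + \<rho>) * real K < real k + 1
     then exp (if \<rho> \<in> {-1..1} then \<phi> \<rho> else 0) else 0)"

section \<open>The outcome of a query as a function of filters and samples\<close>

locale search =
  fixes \<phi> :: "real \<Rightarrow> real" and d n K N B M :: nat and G \<Lambda> bud :: real
    and gs sm :: "nat \<Rightarrow> rvec" and y :: rvec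
begin

definition cand :: "nat \<Rightarrow> nat \<Rightarrow> nat \<Rightarrow> nat set" where
  "cand k f L = {j. j < L \<and> passes \<Lambda> K k (dotp d (gs f) (sm j))}"

definition ypass :: "nat \<Rightarrow> nat \<Rightarrow> bool" where
  "ypass k f \<longleftrightarrow> passes \<Lambda> K k (side K k * dotp d (gs f) y)"

definition nfilters :: "nat \<Rightarrow> nat" where
  "nfilters k = nat \<lceil>G * exp (\<Lambda> * radius K k)\<rceil>"

definition found :: "nat \<Rightarrow> nat \<Rightarrow> nat \<Rightarrow> nat set" where
  "found k f L = (\<Union>f' \<in> {f'. f' < f \<and> ypass k f'}. cand k f' L)"

text \<open>With multiplicity: a sample caught by several filters is read every time, although
  \<open>found\<close> contains it once.\<close>

definition scan_cost :: "nat \<Rightarrow> nat \<Rightarrow> nat \<Rightarrow> nat" where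
  "scan_cost k f L = (\<Sum>f'<f. if ypass k f' then card (cand k f' L) else 0)"

definition weight :: "nat \<Rightarrow> nat \<Rightarrow> real" where
  "weight k j = class_weight \<phi> K k (dotp d (sm j) y)"

definition est :: "nat \<Rightarrow> nat \<Rightarrow> real" where
  "est k v = (\<Sum>j\<in>found k (nfilters k) (v * B). weight k j) / real (v * B)"

fun lastval :: "nat \<Rightarrow> nat \<Rightarrow> real" where
  "lastval k 0 = 0"
| "lastval k (Suc i) = (if real (scan_cost k (nfilters k) (2 ^ i * B)) < bud then est k (2 ^ i) else lastval k i)"

definition nlevels :: nat where
  "nlevels = (LEAST J. 2 * n \<le> 2 ^ J)"

definition answer :: real where
  "answer = (\<Sum>k<2 * K + 1. lastval k nlevels)"

definition qry_time :: nat where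
  "qry_time = (2 * K + 1) * (nlevels * (N * 300 + nat \<lceil>bud\<rceil> * 300 + 300) + 300) + 300"

lemma nlevels_less: "i < nlevels \<Longrightarrow> 2 ^ i < 2 * n"
  unfolding nlevels_def by (metis not_less_Least not_le)

lemma nlevels: "2 * n \<le> 2 ^ nlevels"
  unfolding nlevels_def by (rule LeastI[of _ "2 * n"]) (simp add: less_imp_le)

end

section \<open>Correctness and running time of a query\<close>

locale prepared_search = search +
  fixes m :: nat and \<epsilon> :: real and s0 :: state
  assumes prep: "prepared d n K N B M \<epsilon> G \<Lambda> bud gs sm s0"
    and M: "M = 2 * n * B" and m: "20 + M \<le> m" "20 < m"
    and N: "\<And>k. k < 2 * K + 1 \<Longrightarrow> nfilters k \<le> N"
begin

definition qframe :: "state \<Rightarrow> bool" where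
  "qframe s \<longleftrightarrow> (\<forall>a. a \<notin> {6..12} \<union> {20..<20 + M} \<longrightarrow> nmem s a = nmem s0 a) \<and>
     (\<forall>a. a \<notin> {0, 4, 5, 6, 7, 8} \<longrightarrow> rmem s a = rmem s0 a) \<and> vmem s = vmem s0 \<and> inputs s = [y]"

text \<open>S is the set of samples met in the current scan. In memory it is encoded as the samples
  that bear the current stamp; since no stamp is larger, incrementing the current stamp empties S in
  constant time.\<close>

definition qinv :: "nat \<Rightarrow> nat \<Rightarrow> nat \<Rightarrow> nat \<Rightarrow> nat set \<Rightarrow> nat \<Rightarrow> real \<Rightarrow> real \<Rightarrow> state \<Rightarrow> bool" where
  "qinv k f v st S c val ans s \<longleftrightarrow> qframe s \<and> nmem s 6 = k \<and> nmem s 7 = f \<and> nmem s 12 = v \<and> nmem s 11 = st \<and>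
     nmem s 10 = c \<and> rmem s 5 = side K k \<and> rmem s 7 = val \<and> rmem s 8 = ans \<and>
     rmem s 6 = (\<Sum>j\<in>S. weight k j) \<and> S \<subseteq> {..<M} \<and>
     (\<forall>j<M. nmem s (20 + j) \<le> st \<and> (nmem s (20 + j) = st \<longleftrightarrow> j \<in> S))"

definition entries :: "nat \<Rightarrow> nat \<Rightarrow> nat list" where
  "entries k f = filter (\<lambda>j. passes \<Lambda> K k (dotp d (gs f) (sm j))) [0..<M]"

lemma qframeD:
  assumes "qframe s"
  shows "nmem s 0 = n" "nmem s 2 = K" "nmem s 3 = N" "nmem s 4 = B" "nmem s 5 = M"
    "rmem s 2 = G" "rmem s 3 = \<Lambda>" "rmem s 9 = bud" "inputs s = [y]"
    "f < N \<Longrightarrow> vmem s f = gs f" "j < M \<Longrightarrow> vmem s (N + j) = sm j"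
    "k < 2 * K + 1 \<Longrightarrow> f < N \<Longrightarrow> stored s (list_base M (k * N + f)) (entries k f)"
proof -
  show "stored s (list_base M (k * N + f)) (entries k f)" if "k < 2 * K + 1" "f < N"
  proof -
    have "nmem s a = nmem s0 a" if "list_base M (k * N + f) \<le> a" for a
      using assms that by (simp add: qframe_def list_base_def)
    moreover have "stored s0 (list_base M (k * N + f)) (entries k f)"
      using prep that by (simp add: prepared_def entries_def)
    ultimately show ?thesis by (simp add: stored_def)
  qed
qed (use assms prep in \<open>auto simp: qframe_def prepared_def\<close>)

lemma bval_class:
  assumes "qframe s" "nmem s 6 = k"
  shows "exp (rval \<phi> d (RPhi (rv 4)) s) * of_bool (bval \<phi> d class_bexp s) = class_weight \<phi> K k (rmem s 4)"
  using assms qframeD(2)[OF assms(1)] by (auto simp: class_bexp_def class_weight_def not_less)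

lemma bcost_class: "bcost class_bexp = 30"
  by (simp add: class_bexp_def)

lemma wp_scan_step:
  assumes I: "qinv k f v st S c val ans s" and k: "k < 2 * K + 1" and f: "f < N"
    and i: "nmem s 9 = i" "i < length (entries k f)" and j: "j = entries k f ! i"
  shows "wp \<phi> d m scan_step (\<lambda>t s'. t \<le> 200 \<and> qinv k f v st (insert j S) (Suc c) val ans s' \<and> nmem s' 9 = Suc i) s"
proof -
  have fr: "qframe s" using I by (simp add: qinv_def)
  note D = qframeD[OF fr]
  have r: "nmem s 6 = k" "nmem s 7 = f" "nmem s 12 = v" "nmem s 11 = st" "nmem s 10 = c"
    using I by (auto simp: qinv_def)
  have "j \<in> set (entries k f)" using i j by simp
  then have jM: "j < M" by (simp add: entries_def)
  have "nval (list_addr (NAdd (nv 9) (NConst 1))) s = list_base M (k * N + f) + Suc i"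
    using nval_list_addr[OF D(5,3) r(1,2)] i by (simp add: list_base_def)
  then have ld: "nmem s (nval (list_addr (NAdd (nv 9) (NConst 1))) s) = j"
    using D(12)[OF k f] i j by (simp add: stored_def)
  define s1 where "s1 = s\<lparr>nmem := (nmem s)(8 := j)\<rparr>"
  have fr1: "qframe s1" using fr by (auto simp: qframe_def s1_def)
  have marks: "nmem s (20 + j) \<le> st" "nmem s (20 + j) = st \<longleftrightarrow> j \<in> S" using I jM by (auto simp: qinv_def)
  show ?thesis
  proof (cases "j \<in> S")
    case True
    have "wp \<phi> d m scan_step (\<lambda>t s'. t \<le> 200 \<and> s' = s1\<lparr>nmem := (nmem s1)(9 := Suc i, 10 := Suc c)\<rparr>) s"
      unfolding scan_step_def wp_simps using ld True marks m r i
      by (simp add: ncost_list_addr s1_def)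
    then show ?thesis
    proof (rule wp_mono)
      fix t s' assume "t \<le> 200 \<and> s' = s1\<lparr>nmem := (nmem s1)(9 := Suc i, 10 := Suc c)\<rparr>"
      then show "t \<le> 200 \<and> qinv k f v st (insert j S) (Suc c) val ans s' \<and> nmem s' 9 = Suc i"
        using I True by (auto simp: qinv_def qframe_def s1_def insert_absorb)
    qed
  next
    case False
    with marks have lt: "nmem s (20 + j) < st" by auto
    define s2 where "s2 = s1\<lparr>nmem := (nmem s1)(20 + j := st), rmem := (rmem s1)(4 := dotp d (sm j) y)\<rparr>"
    have fr2: "qframe s2" using fr1 jM by (auto simp: qframe_def s2_def)
    define s3 where "s3 = s2\<lparr>rmem := (rmem s2)(6 := rmem s 6 + weight k j)\<rparr>"
    have "nmem s2 6 = k" using r by (simp add: s2_def s1_def)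
    from bval_class[OF fr2 this] have w: "exp (rval \<phi> d (RPhi (rv 4)) s2) * of_bool (bval \<phi> d class_bexp s2) = weight k j"
      by (simp add: weight_def s2_def)
    have "(rmem s2)(6 := rmem s 6) = rmem s2" by (auto simp: s2_def s1_def fun_eq_iff)
    then have idle: "s2 = s3" if "weight k j = 0" using that by (simp add: s3_def)
    have s3': "bval \<phi> d class_bexp s2 \<Longrightarrow> s2\<lparr>rmem := (rmem s2)(6 := rmem s2 6 + exp (rval \<phi> d (RPhi (rv 4)) s2))\<rparr> = s3"
      "\<not> bval \<phi> d class_bexp s2 \<Longrightarrow> s2 = s3"
      using w by (simp add: s3_def s2_def s1_def) (rule idle, use w in simp)
    have s2': "s1\<lparr>nmem := (nmem s1)(20 + j := st), rmem := (rmem s1)(4 := dotp d (vmem s (N + j)) y)\<rparr> = s2"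
      using D(11)[OF jM] by (simp add: s2_def)
    have "wp \<phi> d m (Cond class_bexp (RSet (NConst 6) (RAdd (rv 6) (RExp (RPhi (rv 4))))) Skip)
        (\<lambda>t s'. t \<le> 60 \<and> s' = s3) s2"
      unfolding wp_simps using m s3' by (auto simp: bcost_class simp del: rval.simps(9))
    then have "wp \<phi> d m (Cond class_bexp (RSet (NConst 6) (RAdd (rv 6) (RExp (RPhi (rv 4))))) Skip)
        (\<lambda>t s'. t \<le> 60 \<and> s' = s3)
          (s1\<lparr>nmem := (nmem s1)(20 + j := st), rmem := (rmem s1)(4 := dotp d (vmem s (N + j)) y)\<rparr>)"
      unfolding s2' .
    moreover have "nmem s1 8 = j" "nmem s1 11 = st" "nmem s1 3 = N" "inputs s1 = [y]" "vmem s1 = vmem s" "rmem s1 = rmem s"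
      "nmem s1 (20 + j) < st" "20 + j < m"
      using r D lt m jM by (auto simp: s1_def)
    moreover have "nmem s3 9 = i" "nmem s3 10 = c" using r i by (auto simp: s3_def s2_def s1_def)
    ultimately have "wp \<phi> d m scan_step (\<lambda>t s'. t \<le> 200 \<and> s' = s3\<lparr>nmem := (nmem s3)(9 := Suc i, 10 := Suc c)\<rparr>) s"
      unfolding scan_step_def wp_Seq wp_NSet wp_RSet wp_Cond[where b = "NLess (NLoad (NAdd (NConst 20) (nv 8))) (nv 11)"]
      using ld m
      by (simp add: ncost_list_addr s1_def[symmetric] del: wp_Cond) (erule wp_mono, simp)
    then show ?thesis
    proof (rule wp_mono)
      fix t s' assume *: "t \<le> 200 \<and> s' = s3\<lparr>nmem := (nmem s3)(9 := Suc i, 10 := Suc c)\<rparr>"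
      have "finite S" using I finite_subset by (auto simp: qinv_def)
      then show "t \<le> 200 \<and> qinv k f v st (insert j S) (Suc c) val ans s' \<and> nmem s' 9 = Suc i"
        using I * False jM by (auto simp: qinv_def qframe_def s3_def s2_def s1_def)
    qed
  qed
qed

lemma bval_scan_guard:
  assumes I: "qinv k f v st S c val ans s" and k: "k < 2 * K + 1" and f: "f < N" and i: "nmem s 9 = i"
  shows "bval \<phi> d scan_guard s \<longleftrightarrow> i < length (entries k f) \<and> real c < bud \<and> entries k f ! i < v * B"
proof -
  have fr: "qframe s" using I by (simp add: qinv_def)
  note D = qframeD[OF fr]
  have r: "nmem s 6 = k" "nmem s 7 = f" "nmem s 12 = v" "nmem s 10 = c"
    using I by (auto simp: qinv_def)
  have "nval (list_addr (NAdd (nv 9) (NConst 1))) s = list_base M (k * N + f) + Suc i"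
    "nval (list_addr (NConst 0)) s = list_base M (k * N + f)"
    using nval_list_addr[OF D(5,3) r(1,2)] i by (simp_all add: list_base_def)
  then show ?thesis
    using D(12)[OF k f] D(4,8) r i by (auto simp: scan_guard_def stored_def)
qed

lemma bcost_scan_guard: "bcost scan_guard = 62"
  by (simp add: scan_guard_def ncost_list_addr)

text \<open>The time is paid for by the increase of the counter from c to c', up to a constant. The
  set S' is described only if the budget is not exhausted; otherwise the scan is going to be
  discarded.\<close>

lemma wp_scan:
  assumes I: "qinv k f v st S c val ans s" and k: "k < 2 * K + 1" and f: "f < N"
    and v: "v * B \<le> M" and i: "nmem s 9 = 0"
  shows "wp \<phi> d m (Loop scan_guard scan_step) (\<lambda>t s'. \<exists>c' S'. t + c * 270 \<le> c' * 270 + 70 \<and>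
      qinv k f v st S' c' val ans s' \<and> c \<le> c' \<and> c' \<le> c + card (cand k f (v * B)) \<and> c' \<le> max c (nat \<lceil>bud\<rceil>) \<and>
      (real c' < bud \<longrightarrow> c' = c + card (cand k f (v * B)) \<and> S' = S \<union> cand k f (v * B))) s"
proof -
  define l where "l = entries k f"
  let ?C = "cand k f (v * B)"
  have C: "?C = {j \<in> set l. j < v * B}" using v by (auto simp: cand_def l_def entries_def)
  have finC: "finite ?C" by (simp add: C)
  have srt: "sorted_wrt (<) l" unfolding l_def entries_def by (rule sorted_wrt_filter) simp
  have dist: "distinct l" unfolding l_def entries_def by simp
  let ?go = "\<lambda>i. i < length l \<and> real (c + i) < bud \<and> l ! i < v * B"
  \<comment> \<open>The number of rounds: the first position at which the guard fails.\<close>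
  define e where "e = (LEAST i. \<not> ?go i)"
  have "\<not> ?go (length l)" by simp
  then have stop: "\<not> ?go e" and "e \<le> length l" unfolding e_def by (rule LeastI, rule Least_le)
  have go: "?go i" if "i < e" for i using not_less_Least[of i "\<lambda>i. \<not> ?go i"] that unfolding e_def by blast
  have card_take: "card (set (take e l)) = e"
    using dist \<open>e \<le> length l\<close> by (simp add: distinct_card)
  have takeC: "set (take e l) \<subseteq> ?C"
  proof
    fix j assume "j \<in> set (take e l)"
    then obtain i where "i < e" "j = l ! i" using \<open>e \<le> length l\<close> by (auto simp: in_set_conv_nth)
    then show "j \<in> ?C" using go[of i] by (auto simp: C)
  qed
  then have eC: "e \<le> card ?C" using card_mono[OF finC] card_take by metis
  \<comment> \<open>If the budget is not the reason for stopping, the list has ended or its entry e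
    lies outside the sample; by monotonicity so do all later entries.\<close>
  have full: "set (take e l) = ?C" if "real (c + e) < bud"
  proof (rule equalityI[OF takeC], rule subsetI)
    fix j assume "j \<in> ?C"
    then obtain i where i: "i < length l" "j = l ! i" "l ! i < v * B" by (auto simp: C in_set_conv_nth)
    have "i < e"
    proof (rule ccontr)
      assume "\<not> i < e"
      then have "e \<le> i" by simp
      then have "l ! e \<le> l ! i"
        using sorted_wrt_nth_less[OF srt, of e i] i(1) by (cases "e = i") auto
      then show False using stop that i \<open>e \<le> i\<close> by auto
    qed
    then show "j \<in> set (take e l)" using i by (auto simp: in_set_conv_nth intro!: exI[of _ i])
  qed
  let ?I = "\<lambda>i (s' :: state). qinv k f v st (S \<union> set (take i l)) (c + i) val ans s' \<and> nmem s' 9 = i"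
  have "wp \<phi> d m (Loop scan_guard scan_step) (\<lambda>t s'. t \<le> e * 270 + 1 + bcost scan_guard \<and> ?I e s') s"
  proof (rule wp_Loop_const[where I = ?I and N = e])
    show "?I 0 s" using I i by simp
  next
    fix i and s' :: state assume i: "i < e" and I': "?I i s'"
    then have len: "i < length (entries k f)" using go l_def by blast
    have "insert (l ! i) (S \<union> set (take i l)) = S \<union> set (take (Suc i) l)"
      using len by (simp add: take_Suc_conv_app_nth l_def)
    then have "wp \<phi> d m scan_step (\<lambda>t s''. t + 1 + bcost scan_guard \<le> 270 \<and> ?I (Suc i) s'') s'"
      using I' by (intro wp_mono[OF wp_scan_step[OF conjunct1[OF I'] k f conjunct2[OF I'] len refl]])
        (auto simp: bcost_scan_guard l_def)
    moreover have "bval \<phi> d scan_guard s'"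
      using bval_scan_guard[OF conjunct1[OF I'] k f conjunct2[OF I']] go[OF i] by (simp add: l_def)
    ultimately show "bval \<phi> d scan_guard s' \<and>
      wp \<phi> d m scan_step (\<lambda>t s''. t + 1 + bcost scan_guard \<le> 270 \<and> ?I (Suc i) s'') s'" by simp
  next
    fix s' :: state assume I': "?I e s'"
    then show "\<not> bval \<phi> d scan_guard s'"
      using bval_scan_guard[OF conjunct1[OF I'] k f conjunct2[OF I']] stop by (simp add: l_def)
  qed
  then show ?thesis
  proof (rule wp_mono)
    fix t s' assume *: "t \<le> e * 270 + 1 + bcost scan_guard \<and> ?I e s'"
    have "c + e \<le> max c (nat \<lceil>bud\<rceil>)"
    proof (cases e)
      case (Suc e')
      then have "real (c + e') < bud" using go[of e'] by simp
      then have "c + e \<le> nat \<lceil>bud\<rceil>" using Suc by linarith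
      then show ?thesis by simp
    qed simp
    moreover have "c + e = c + card ?C \<and> S \<union> set (take e l) = S \<union> ?C" if "real (c + e) < bud"
      using full[OF that] card_take by simp
    ultimately show "\<exists>c' S'. t + c * 270 \<le> c' * 270 + 70 \<and> qinv k f v st S' c' val ans s' \<and> c \<le> c' \<and>
        c' \<le> c + card ?C \<and> c' \<le> max c (nat \<lceil>bud\<rceil>) \<and> (real c' < bud \<longrightarrow> c' = c + card ?C \<and> S' = S \<union> ?C)"
      using * eC by (intro exI[of _ "c + e"] exI[of _ "S \<union> set (take e l)"]) (auto simp: bcost_scan_guard)
  qed
qed

text \<open>The counter never exceeds the true cost. So a counter below the budget means a complete
  scan, and a counter that has reached it certifies that the true cost has reached it too, in
  agreement with \<open>lastval\<close>.\<close>

definition finv :: "nat \<Rightarrow> nat \<Rightarrow> nat \<Rightarrow> nat \<Rightarrow> real \<Rightarrow> real \<Rightarrow> state \<Rightarrow> bool" where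
  "finv k f v st val ans s \<longleftrightarrow> (\<exists>c S. qinv k f v st S c val ans s \<and> c \<le> scan_cost k f (v * B) \<and>
     c \<le> nat \<lceil>bud\<rceil> \<and>
     (real c < bud \<longrightarrow> c = scan_cost k f (v * B) \<and> S = found k f (v * B)))"

lemma found_Suc: "found k (Suc f) L = found k f L \<union> (if ypass k f then cand k f L else {})"
  by (auto simp: found_def less_Suc_eq)

lemma wp_filter_step:
  assumes F: "finv k f v st val ans s" and k: "k < 2 * K + 1" and f: "f < N" and v: "v * B \<le> M"
  shows "wp \<phi> d m filter_step (\<lambda>t s'. t + nmem s 10 * 270 \<le> nmem s' 10 * 270 + 200 \<and>
      finv k (Suc f) v st val ans s') s"
proof -
  from F obtain c S where I: "qinv k f v st S c val ans s" and c: "c \<le> scan_cost k f (v * B)" "c \<le> nat \<lceil>bud\<rceil>"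
    "real c < bud \<longrightarrow> c = scan_cost k f (v * B) \<and> S = found k f (v * B)"
    unfolding finv_def by blast
  have fr: "qframe s" using I by (simp add: qinv_def)
  note D = qframeD[OF fr]
  have r: "nmem s 6 = k" "nmem s 7 = f" "nmem s 10 = c" "rmem s 5 = side K k"
    using I by (auto simp: qinv_def)
  define s1 where "s1 = s\<lparr>rmem := (rmem s)(4 := side K k * dotp d (gs f) y)\<rparr>"
  have I1: "qinv k f v st S c val ans s1" using I by (auto simp: qinv_def qframe_def s1_def)
  have pass: "bval \<phi> d pass_bexp s1 \<longleftrightarrow> ypass k f"
    using bval_pass[of s1 K k \<Lambda>] r D by (simp add: s1_def ypass_def)
  define s2 where "s2 = s1\<lparr>nmem := (nmem s1)(9 := 0)\<rparr>"
  have I2: "qinv k f v st S c val ans s2" using I1 by (auto simp: qinv_def qframe_def s2_def)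
  let ?P = "\<lambda>c' S'. c \<le> c' \<and> c' \<le> scan_cost k (Suc f) (v * B) \<and> c' \<le> nat \<lceil>bud\<rceil> \<and>
      (real c' < bud \<longrightarrow> c' = scan_cost k (Suc f) (v * B) \<and> S' = found k (Suc f) (v * B))"
  have "wp \<phi> d m (Cond pass_bexp (Seq (NSet (NConst 9) (NConst 0)) (Loop scan_guard scan_step)) Skip)
    (\<lambda>t s'. \<exists>c' S'. t + c * 270 \<le> c' * 270 + 140 \<and> qinv k f v st S' c' val ans s' \<and> ?P c' S') s1"
  proof (cases "ypass k f")
    case True
    have "wp \<phi> d m (Loop scan_guard scan_step) (\<lambda>t s'. \<exists>c' S'. t + c * 270 \<le> c' * 270 + 70 \<and>
      qinv k f v st S' c' val ans s' \<and> c \<le> c' \<and> c' \<le> c + card (cand k f (v * B)) \<and> c' \<le> max c (nat \<lceil>bud\<rceil>) \<and>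
      (real c' < bud \<longrightarrow> c' = c + card (cand k f (v * B)) \<and> S' = S \<union> cand k f (v * B))) s2"
      by (rule wp_scan[OF I2 k f v]) (simp add: s2_def)
    then have "wp \<phi> d m (Loop scan_guard scan_step) (\<lambda>t s'. \<exists>c' S'. t + c * 270 \<le> c' * 270 + 70 \<and>
      qinv k f v st S' c' val ans s' \<and> ?P c' S') s2"
    proof (rule wp_mono, elim exE conjE, intro exI conjI)
      fix t s' c' S'
      assume *: "c \<le> c'" "c' \<le> c + card (cand k f (v * B))" "c' \<le> max c (nat \<lceil>bud\<rceil>)"
        "real c' < bud \<longrightarrow> c' = c + card (cand k f (v * B)) \<and> S' = S \<union> cand k f (v * B)"
      have sc: "scan_cost k (Suc f) (v * B) = scan_cost k f (v * B) + card (cand k f (v * B))"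
        using True by (simp add: scan_cost_def)
      show "c' \<le> scan_cost k (Suc f) (v * B)" using * c sc by linarith
      show "c' \<le> nat \<lceil>bud\<rceil>" using * c by simp
      show "real c' < bud \<longrightarrow> c' = scan_cost k (Suc f) (v * B) \<and> S' = found k (Suc f) (v * B)"
        using * c sc True by (auto simp: found_Suc)
    qed
    then show ?thesis
      using True pass m by (simp add: wp_simps bcost_pass s2_def[symmetric]) (erule wp_mono, force)
  next
    case False
    then have "?P c S" using c by (auto simp: scan_cost_def found_Suc)
    then show ?thesis
      using False pass I1 by (auto simp: wp_simps bcost_pass intro!: exI[of _ c] exI[of _ S])
  qed
  then have "wp \<phi> d m (Seq (Cond pass_bexp (Seq (NSet (NConst 9) (NConst 0)) (Loop scan_guard scan_step)) Skip) (incr 7))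
      (\<lambda>t s'. t + c * 270 \<le> nmem s' 10 * 270 + 170 \<and> finv k (Suc f) v st val ans s') s1"
    unfolding wp_Seq wp_NSet
  proof (rule wp_mono, elim exE conjE)
    fix t s' c' S'
    assume t: "t + c * 270 \<le> c' * 270 + 140" and I': "qinv k f v st S' c' val ans s'"
      and P: "c \<le> c'" "c' \<le> scan_cost k (Suc f) (v * B)" "c' \<le> nat \<lceil>bud\<rceil>"
        "real c' < bud \<longrightarrow> c' = scan_cost k (Suc f) (v * B) \<and> S' = found k (Suc f) (v * B)"
    let ?s = "s'\<lparr>nmem := (nmem s')(7 := Suc f)\<rparr>"
    have "qinv k (Suc f) v st S' c' val ans ?s" using I' by (auto simp: qinv_def qframe_def)
    then have "finv k (Suc f) v st val ans ?s" unfolding finv_def using P by blast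
    moreover have "nmem s' 7 = f" "nmem s' 10 = c'" using I' by (auto simp: qinv_def)
    ultimately show "nval (NConst 7) s' < m \<and>
        1 + t + (1 + ncost (NConst 7) + ncost (NAdd (nv 7) (NConst 1))) + c * 270
        \<le> nmem (s'\<lparr>nmem := (nmem s')(nval (NConst 7) s' := nval (NAdd (nv 7) (NConst 1)) s')\<rparr>) 10 * 270 + 170 \<and>
       finv k (Suc f) v st val ans (s'\<lparr>nmem := (nmem s')(nval (NConst 7) s' := nval (NAdd (nv 7) (NConst 1)) s')\<rparr>)"
      using t m by simp
  qed
  moreover have "rmem s 5 * dotp d (vmem s (nmem s 7)) (inputs s ! 0) = side K k * dotp d (gs f) y"
    using r D(9) D(10)[OF f] by simp
  ultimately show ?thesis
    unfolding filter_step_def wp_Seq[of _ _ _ "RSet (NConst 4) _"] wp_RSet using m r D(9) D(10)[OF f]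
    by (simp add: s1_def[symmetric]) (erule wp_mono, simp)
qed

lemma wp_filter_loop:
  assumes F: "finv k 0 v st val ans s" and c: "nmem s 10 = 0" and k: "k < 2 * K + 1" and v: "v * B \<le> M"
  shows "wp \<phi> d m (Loop filter_guard filter_step) (\<lambda>t s'. t \<le> N * 250 + nat \<lceil>bud\<rceil> * 270 + 100 \<and>
      finv k (nfilters k) v st val ans s') s"
proof -
  have cost: "bcost filter_guard = 27" by (simp add: filter_guard_def radius_exp_def)
  have guard: "bval \<phi> d filter_guard s' \<longleftrightarrow> f < nfilters k" if "finv k f v st val ans s'" for f s'
  proof -
    obtain c S where I: "qinv k f v st S c val ans s'" using \<open>finv k f v st val ans s'\<close> by (auto simp: finv_def)
    then have fr: "qframe s'" and r: "nmem s' 6 = k" "nmem s' 7 = f" by (auto simp: qinv_def)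
    have "bval \<phi> d filter_guard s' \<longleftrightarrow> real f < G * exp (\<Lambda> * radius K k)"
      using qframeD[OF fr] r by (simp add: filter_guard_def radius_exp_def radius_def)
    also have "\<dots> \<longleftrightarrow> f < nfilters k" unfolding nfilters_def by linarith
    finally show ?thesis .
  qed
  have "wp \<phi> d m (Loop filter_guard filter_step) (\<lambda>t s'. (nmem s 10 * 270 + 0 * 250) + t
        \<le> (nmem s' 10 * 270 + nfilters k * 250) + 1 + bcost filter_guard \<and>
      finv k (nfilters k) v st val ans s') s"
  \<comment> \<open>List entries are charged to cell 10, which stays within the rounded budget. The
    total is therefore a sum of the number of filters and the budget, however the entries are
    distributed over the lists.\<close>
  proof (rule wp_Loop[where I = "\<lambda>f. finv k f v st val ans" and V = "\<lambda>f s. nmem s 10 * 270 + f * 250"])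
    fix f s' assume f: "f < nfilters k" and I: "finv k f v st val ans s'"
    have "f < N" using f N[OF k] by simp
    from wp_filter_step[OF I k this v]
    have "wp \<phi> d m filter_step (\<lambda>t s''. nmem s' 10 * 270 + f * 250 + t + 1 + bcost filter_guard
        \<le> nmem s'' 10 * 270 + Suc f * 250 \<and> finv k (Suc f) v st val ans s'') s'"
      by (rule wp_mono) (simp add: cost)
    then show "bval \<phi> d filter_guard s' \<and> wp \<phi> d m filter_step (\<lambda>t s''. nmem s' 10 * 270 + f * 250 + t + 1 + bcost filter_guard
        \<le> nmem s'' 10 * 270 + Suc f * 250 \<and> finv k (Suc f) v st val ans s'') s'"
      using guard[OF I] f by simp
  next
    fix s' assume "finv k (nfilters k) v st val ans s'"
    then show "\<not> bval \<phi> d filter_guard s'" using guard by simp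
  qed (use F in auto)
  then show ?thesis
  proof (rule wp_mono, elim conjE, intro conjI)
    fix t s' assume t: "nmem s 10 * 270 + 0 * 250 + t \<le> nmem s' 10 * 270 + nfilters k * 250 + 1 + bcost filter_guard"
      and I: "finv k (nfilters k) v st val ans s'"
    have "nmem s' 10 \<le> nat \<lceil>bud\<rceil>" using I by (auto simp: finv_def qinv_def)
    then show "t \<le> N * 250 + nat \<lceil>bud\<rceil> * 270 + 100" using t N[OF k] c cost by simp
  qed
qed

definition linv :: "nat \<Rightarrow> nat \<Rightarrow> real \<Rightarrow> real \<Rightarrow> state \<Rightarrow> bool" where
  "linv k v val ans s \<longleftrightarrow> qframe s \<and> nmem s 6 = k \<and> nmem s 12 = v \<and> rmem s 5 = side K k \<and>
     rmem s 7 = val \<and> rmem s 8 = ans \<and> (\<forall>j<M. nmem s (20 + j) \<le> nmem s 11)"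

lemma wp_level_step:
  assumes I: "linv k (2 ^ i) (lastval k i) ans s" and k: "k < 2 * K + 1" and i: "2 ^ i < 2 * n"
  shows "wp \<phi> d m level_step (\<lambda>t s'. t \<le> N * 250 + nat \<lceil>bud\<rceil> * 270 + 200 \<and>
      linv k (2 ^ Suc i) (lastval k (Suc i)) ans s') s"
proof -
  let ?v = "2 ^ i :: nat" and ?val = "lastval k i"
  have v: "?v * B \<le> M" unfolding M by (rule mult_right_mono) (use i in auto)
  define st where "st = nmem s 11 + 1"
  define s1 where "s1 = s\<lparr>rmem := (rmem s)(6 := 0), nmem := (nmem s)(11 := st, 10 := 0, 7 := 0)\<rparr>"
  have Q: "qinv k 0 ?v st {} 0 ?val ans s1"
    using I by (auto simp: linv_def qinv_def qframe_def s1_def st_def less_Suc_eq_le)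
  then have F: "finv k 0 ?v st ?val ans s1"
    unfolding finv_def by (intro exI[of _ 0] exI[of _ "{}"]) (auto simp: scan_cost_def found_def)
  have W: "wp \<phi> d m (Loop filter_guard filter_step) (\<lambda>t s'. t \<le> N * 250 + nat \<lceil>bud\<rceil> * 270 + 100 \<and>
      finv k (nfilters k) ?v st ?val ans s') s1"
    by (rule wp_filter_loop[OF F _ k v]) (simp add: s1_def)
  let ?fin = "Seq (Cond (RLess (RNat (nv 10)) (rv 9))
            (RSet (NConst 7) (RDiv (rv 6) (RNat (NMul (nv 12) (nv 4))))) Skip)
          (NSet (NConst 12) (NAdd (nv 12) (nv 12)))"
  have fin: "wp \<phi> d m ?fin (\<lambda>t s''. t \<le> 50 \<and> linv k (2 ^ Suc i) (lastval k (Suc i)) ans s'') s'"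
    if F': "finv k (nfilters k) ?v st ?val ans s'" for s'
  proof -
    obtain c S where Q': "qinv k (nfilters k) ?v st S c ?val ans s'" and c: "c \<le> scan_cost k (nfilters k) (?v * B)"
      "real c < bud \<longrightarrow> c = scan_cost k (nfilters k) (?v * B) \<and> S = found k (nfilters k) (?v * B)"
      using F' unfolding finv_def by blast
    then have fr: "qframe s'" and r: "nmem s' 10 = c" "nmem s' 12 = ?v" "rmem s' 6 = (\<Sum>j\<in>S. weight k j)"
      "rmem s' 7 = ?val" by (auto simp: qinv_def)
    note D = qframeD[OF fr]
    let ?L = "\<lambda>x. s'\<lparr>rmem := (rmem s')(7 := x), nmem := (nmem s')(12 := 2 ^ i + 2 ^ i)\<rparr>"
    have L: "linv k (2 ^ Suc i) x ans (?L x)" for x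
      using Q' by (auto simp: linv_def qinv_def qframe_def)
    show ?thesis
    proof (cases "real c < bud")
      case True
      then have "lastval k (Suc i) = (\<Sum>j\<in>S. weight k j) / real (?v * B)"
        using c by (simp add: est_def)
      then show ?thesis using True D r m L[of "lastval k (Suc i)"] by (simp add: wp_simps)
    next
      case False
      have same: "s'\<lparr>rmem := (rmem s')(7 := ?val)\<rparr> = s'" using r(4) by (cases s') auto
      have "\<not> real (scan_cost k (nfilters k) (?v * B)) < bud" using False c(1) by linarith
      then have "lastval k (Suc i) = ?val" by simp
      then show ?thesis using False D r m L[of ?val] by (simp add: wp_simps same)
    qed
  qed
  have "wp \<phi> d m (Seq (Loop filter_guard filter_step) ?fin)
      (\<lambda>t s'. t \<le> N * 250 + nat \<lceil>bud\<rceil> * 270 + 151 \<and> linv k (2 ^ Suc i) (lastval k (Suc i)) ans s') s1"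
    by (rule wp_SeqI[OF W fin]) auto
  then show ?thesis
    unfolding level_step_def wp_Seq[of _ _ _ "incr 11"] wp_Seq[of _ _ _ "NSet _ (NConst 0)"]
      wp_Seq[of _ _ _ "RSet _ _"] wp_NSet wp_RSet
    using m by (simp add: s1_def[unfolded st_def] del: lastval.simps(2)) (erule wp_mono, simp)
qed

lemma wp_level_loop:
  assumes I: "linv k 1 0 ans s" and k: "k < 2 * K + 1"
  shows "wp \<phi> d m (Loop (NLess (nv 12) (NMul (NConst 2) (nv 0))) level_step)
    (\<lambda>t s'. t \<le> nlevels * (N * 300 + nat \<lceil>bud\<rceil> * 300 + 300) + 100 \<and>
      linv k (2 ^ nlevels) (lastval k nlevels) ans s') s"
proof -
  let ?b = "NLess (nv 12) (NMul (NConst 2) (nv 0))"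
  let ?I = "\<lambda>i. linv k (2 ^ i) (lastval k i) ans"
  have g: "bval \<phi> d ?b s' \<longleftrightarrow> 2 ^ i < 2 * n" if "?I i s'" for i s'
    using that qframeD(1) by (auto simp: linv_def)
  have "wp \<phi> d m (Loop ?b level_step)
    (\<lambda>t s'. t \<le> nlevels * (N * 300 + nat \<lceil>bud\<rceil> * 300 + 300) + 1 + bcost ?b \<and> ?I nlevels s') s"
  proof (rule wp_Loop_const[where I = ?I and N = nlevels])
    show "?I 0 s" using I by simp
  next
    fix i s' assume i: "i < nlevels" and I': "?I i s'"
    from wp_level_step[OF I' k nlevels_less[OF i]]
    have "wp \<phi> d m level_step (\<lambda>t s''. t + 1 + bcost ?b \<le> N * 300 + nat \<lceil>bud\<rceil> * 300 + 300 \<and> ?I (Suc i) s'') s'"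
      by (rule wp_mono) auto
    then show "bval \<phi> d ?b s' \<and>
      wp \<phi> d m level_step (\<lambda>t s''. t + 1 + bcost ?b \<le> N * 300 + nat \<lceil>bud\<rceil> * 300 + 300 \<and> ?I (Suc i) s'') s'"
      using g[OF I'] nlevels_less[OF i] by simp
  next
    fix s' assume "?I nlevels s'"
    from g[OF this] show "\<not> bval \<phi> d ?b s'" using nlevels by simp
  qed
  then show ?thesis by (rule wp_mono) auto
qed

definition cinv :: "nat \<Rightarrow> real \<Rightarrow> state \<Rightarrow> bool" where
  "cinv k ans s \<longleftrightarrow> qframe s \<and> nmem s 6 = k \<and> rmem s 8 = ans \<and> (\<forall>j<M. nmem s (20 + j) \<le> nmem s 11)"

lemma wp_class_step:
  assumes I: "cinv k ans s" and k: "k < 2 * K + 1"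
  shows "wp \<phi> d m class_step (\<lambda>t s'. t \<le> nlevels * (N * 300 + nat \<lceil>bud\<rceil> * 300 + 300) + 200 \<and>
      cinv (Suc k) (ans + lastval k nlevels) s') s"
proof -
  define s1 where "s1 = s\<lparr>rmem := (rmem s)(5 := side K k, 7 := 0), nmem := (nmem s)(12 := 1)\<rparr>"
  have L: "linv k 1 0 ans s1" using I by (auto simp: cinv_def linv_def qframe_def s1_def)
  let ?c = "Seq (RSet (NConst 8) (RAdd (rv 8) (rv 7))) (incr 6)"
  have fin: "wp \<phi> d m ?c (\<lambda>t s''. t \<le> 30 \<and> cinv (Suc k) (ans + lastval k nlevels) s'') s'"
    if "linv k (2 ^ nlevels) (lastval k nlevels) ans s'" for s'
    using that m by (simp add: wp_simps) (auto simp: linv_def cinv_def qframe_def)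
  have W: "wp \<phi> d m (Seq (Loop (NLess (nv 12) (NMul (NConst 2) (nv 0))) level_step) ?c)
    (\<lambda>t s'. t \<le> nlevels * (N * 300 + nat \<lceil>bud\<rceil> * 300 + 300) + 150 \<and>
      cinv (Suc k) (ans + lastval k nlevels) s') s1"
    by (rule wp_SeqI[OF wp_level_loop[OF L k] fin]) auto
  have "nmem s 2 = K" "nmem s 6 = k" using I qframeD(2) by (auto simp: cinv_def)
  moreover have "bcost (NLess (nv 6) (nv 2)) = 5" by simp
  ultimately show ?thesis
    unfolding class_step_def wp_Seq[of _ _ _ "Cond _ _ _"] wp_Cond wp_Seq[of _ _ _ "RSet _ (rc 0)"]
      wp_Seq[of _ _ _ "NSet _ _"] wp_NSet wp_RSet
    using m W by (cases "k < K") (auto simp: side_def s1_def elim!: wp_mono)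
qed

lemma wp_qry_main:
  assumes "s = s0\<lparr>inputs := [y]\<rparr>"
  shows "wp \<phi> d m qry_main (\<lambda>t s'. t \<le> qry_time \<and> rmem s' 0 = answer) s"
proof -
  let ?b = "NLess (nv 6) (NAdd (NMul (NConst 2) (nv 2)) (NConst 1))"
  let ?T = "nlevels * (N * 300 + nat \<lceil>bud\<rceil> * 300 + 300) + 300"
  let ?I = "\<lambda>k. cinv k (\<Sum>k'<k. lastval k' nlevels)"
  define s1 where "s1 = s\<lparr>nmem := (nmem s)(6 := 0), rmem := (rmem s)(8 := 0)\<rparr>"
  have g: "bval \<phi> d ?b s' \<longleftrightarrow> k < 2 * K + 1" if "?I k s'" for k s'
    using that qframeD(2) by (auto simp: cinv_def)
  have W: "wp \<phi> d m (Loop ?b class_step) (\<lambda>t s'. t \<le> (2 * K + 1) * ?T + 1 + bcost ?b \<and> ?I (2 * K + 1) s') s1"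
  proof (rule wp_Loop_const[where I = ?I and N = "2 * K + 1"])
    show "?I 0 s1" using prep assms by (auto simp: cinv_def qframe_def s1_def prepared_def)
  next
    fix k s' assume k: "k < 2 * K + 1" and I': "?I k s'"
    from wp_class_step[OF I' k]
    have "wp \<phi> d m class_step (\<lambda>t s''. t + 1 + bcost ?b \<le> ?T \<and> ?I (Suc k) s'') s'"
      by (rule wp_mono) auto
    then show "bval \<phi> d ?b s' \<and> wp \<phi> d m class_step (\<lambda>t s''. t + 1 + bcost ?b \<le> ?T \<and> ?I (Suc k) s'') s'"
      using g[OF I'] k by simp
  next
    fix s' assume "?I (2 * K + 1) s'"
    from g[OF this] show "\<not> bval \<phi> d ?b s'" by simp
  qed
  have fin: "wp \<phi> d m (RSet (NConst 0) (rv 8)) (\<lambda>t s''. t \<le> 20 \<and> rmem s'' 0 = answer) s'"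
    if "?I (2 * K + 1) s'" for s'
    using that m by (simp add: wp_simps cinv_def answer_def)
  have "wp \<phi> d m (Seq (Loop ?b class_step) (RSet (NConst 0) (rv 8)))
      (\<lambda>t s'. t \<le> (2 * K + 1) * ?T + 100 \<and> rmem s' 0 = answer) s1"
    by (rule wp_SeqI[OF W fin]) auto
  then show ?thesis
    unfolding qry_main_def wp_Seq[of _ _ _ "NSet _ _"] wp_Seq[of _ _ _ "RSet _ (rc 0)"] wp_NSet wp_RSet
    using m by (simp add: s1_def) (erule wp_mono, simp add: qry_time_def)
qed

end

section \<open>Collision probabilities\<close>

lemma passes_iff:
  assumes "0 \<le> \<Lambda>"
  shows "passes \<Lambda> K k a \<longleftrightarrow> sqrt (\<Lambda> * (radius K k * (1 + radius K k))) \<le> a"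
proof -
  have "0 \<le> radius K k" by (simp add: radius_def)
  then have nonneg: "0 \<le> \<Lambda> * (radius K k * (1 + radius K k))" using assms by simp
  show ?thesis
    unfolding passes_def power2_eq_square[symmetric]
    using nonneg real_sqrt_le_iff real_le_rsqrt real_le_lsqrt real_sqrt_ge_zero
    by (smt (verit) real_sqrt_le_mono real_sqrt_abs real_sqrt_pow2 power_mono)
qed

definition hits :: "nat \<Rightarrow> real \<Rightarrow> nat \<Rightarrow> nat \<Rightarrow> rvec \<Rightarrow> rvec \<Rightarrow> rvec set" where
  "hits d \<Lambda> K k y x = {g \<in> space (gauss_rvec d).
     passes \<Lambda> K k (dotp d g x) \<and> passes \<Lambda> K k (side K k * dotp d g y)}"

lemma sets_hits [measurable]: "hits d \<Lambda> K k y x \<in> sets (gauss_rvec d)"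
  unfolding hits_def passes_def dotp_commute[of d _ x] dotp_commute[of d _ y] by measurable

lemma side_square [simp]: "side K k * side K k = 1"
  by (simp add: side_def)

lemma radius_bounds:
  assumes "k < 2 * K + 1" "0 < K"
  shows "0 \<le> radius K k" "radius K k \<le> 1"
proof -
  have "k - K + (K - k) \<le> K" using assms by auto
  then show "0 \<le> radius K k" "radius K k \<le> 1" using assms by (auto simp: radius_def simp flip: of_nat_add)
qed

text \<open>Chernoff in the direction l (x + \<sigma> y). The optimal l is t / v; the value t / u,
  optimal at the class itself, is used for every x. This makes the exponent affine in v, equal to -
  \<Lambda> r at v = u.\<close>

lemma hits_upper_bound:
  assumes "dotp d x x = 1" "dotp d y y = 1" and "0 \<le> \<Lambda>" "0 \<le> radius K k"
  defines "u \<equiv> 1 + radius K k" and "v \<equiv> 1 + side K k * dotp d x y"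
  shows "measure (gauss_rvec d) (hits d \<Lambda> K k y x) \<le> exp (\<Lambda> * radius K k * (v - 2 * u) / u)"
proof -
  let ?r = "radius K k" and ?s = "side K k"
  define t where "t = sqrt (\<Lambda> * (?r * (1 + ?r)))"
  have u: "0 < u" using assms by (simp add: u_def)
  have t2: "t * t = \<Lambda> * ?r * u" and t0: "0 \<le> t" using assms by (auto simp: t_def u_def mult.assoc)
  define l where "l = t / u"
  have l0: "0 \<le> l" using t0 u by (simp add: l_def)
  let ?h = "\<lambda>i. l * (x i + ?s * y i)"
  have h: "dotp d ?h g = l * (dotp d x g + ?s * dotp d y g)" for g
    by (simp only: dotp_scale_left dotp_add_left)
  have "dotp d ?h x = l * v" "dotp d ?h y = l * (dotp d x y + ?s)"
    unfolding h v_def by (simp_all add: assms dotp_commute[of d y x])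
  then have hh: "dotp d ?h ?h = l * (l * v + ?s * (l * (dotp d x y + ?s)))"
    unfolding h[of ?h] by (simp add: dotp_commute[of d _ ?h])
  also have "\<dots> = 2 * l * l * v"
  proof -
    have "?s * (l * (dotp d x y + ?s)) = l * (?s * dotp d x y + ?s * ?s)" by (simp add: algebra_simps del: side_square)
    then show ?thesis by (simp add: v_def algebra_simps)
  qed
  finally have hh: "dotp d ?h ?h = 2 * l * l * v" .
  have "measure (gauss_rvec d) (hits d \<Lambda> K k y x) \<le> exp (dotp d ?h ?h / 2 - l * (2 * t))"
  proof (rule gauss_chernoff)
    fix g assume "g \<in> hits d \<Lambda> K k y x"
    then have "t \<le> dotp d x g" "t \<le> ?s * dotp d y g"
      using passes_iff[OF \<open>0 \<le> \<Lambda>\<close>] by (auto simp: hits_def t_def dotp_commute)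
    then have "2 * t \<le> dotp d x g + ?s * dotp d y g" by simp
    then show "l * (2 * t) \<le> dotp d ?h g" unfolding h using l0 by (rule mult_left_mono)
  qed measurable
  also have "dotp d ?h ?h / 2 - l * (2 * t) = (t * t) * (v - 2 * u) / (u * u)"
  proof -
    have lu: "t = l * u" using u by (simp add: l_def)
    show ?thesis unfolding hh lu using u by (simp add: field_simps)
  qed
  also have "\<dots> = \<Lambda> * ?r * (v - 2 * u) / u"
    unfolding t2 using u by simp
  finally show ?thesis .
qed

text \<open>For \<open>v = 1 + \<sigma> \<langle>z, y\<rangle>\<close>, the left-hand side is \<open>1 / \<Lambda>\<close> times the logarithm of the ratio of the
  collision bounds for \<open>z\<close> and for a point of the class, linearized at the class. The choice
  \<open>t\<^sup>2 = \<Lambda> r (1 + r)\<close> is made so that this inequality holds.\<close>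

lemma tangent_bound:
  fixes r v :: real
  assumes "0 \<le> r" "r \<le> 1" "0 \<le> v" "v \<le> 2"
  shows "r * (v - (1 + r)) / (1 + r) \<le> 1 - \<bar>v - (1 + r)\<bar>"
proof (cases "1 + r \<le> v")
  case True
  then have w: "0 \<le> v - (1 + r)" "v - (1 + r) \<le> 1 - r" using assms by auto
  \<comment> \<open>Multiplied out, the claim is (v - (1 + r)) (1 + 2 r) \<le> 1 + r, and v \<le> 2
    bounds the first factor by 1 - r. On the other side of the class it reduces to 1 + r - v \<le> 1
    + r.\<close>
  have "(v - (1 + r)) * (1 + 2 * r) \<le> (1 - r) * (1 + 2 * r)"
    by (rule mult_right_mono) (use w assms in auto)
  also have "\<dots> \<le> 1 + r" using assms by (simp add: algebra_simps)
  finally show ?thesis using True assms by (simp add: field_simps)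
next
  case False
  then have "(1 + r) - v \<le> 1 + r" using assms by simp
  with False show ?thesis using assms by (simp add: field_simps)
qed

text \<open>With c = t / u and v = u, the main term q / 2 of \<open>gauss_pair_lower_bound\<close>
  is t^2 / u = \<Lambda> r, which matches the upper bound. The safety margin 2, the width of the
  class and the term 2 sqrt q contribute O (1 + t), and t = O (sqrt K). The constant 88 stays below
  the 100 in G.\<close>

lemma hits_lower_bound:
  assumes xy: "dotp d x x = 1" "dotp d y y = 1" and \<Lambda>: "0 \<le> \<Lambda>" "\<Lambda> \<le> real K" and K: "2 \<le> K"
    and k: "k < 2 * K + 1" and cl: "\<bar>side K k * dotp d x y - radius K k\<bar> \<le> 1 / real K"
  shows "exp (- \<Lambda> * radius K k - 88 * sqrt (real K)) \<le> measure (gauss_rvec d) (hits d \<Lambda> K k y x)"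
proof -
  let ?r = "radius K k" and ?s = "side K k"
  have r: "0 \<le> ?r" "?r \<le> 1" using radius_bounds[OF k] K by auto
  define t where "t = sqrt (\<Lambda> * (?r * (1 + ?r)))"
  define u where "u = 1 + ?r"
  have u: "1 \<le> u" "u \<le> 2" using r by (auto simp: u_def)
  have t2: "t * t = \<Lambda> * ?r * u" and t0: "0 \<le> t" using \<Lambda> r by (auto simp: t_def u_def mult.assoc)
  define v where "v = 1 + ?s * dotp d x y"
  \<comment> \<open>The relative deviation of v from u that the width 1/K of a class allows.\<close>
  define a where "a = 1 / (real K * u)"
  have Kinv: "1 / real K \<le> 1 / 2" "0 < 1 / real K" using K by auto
  have au: "a * u = 1 / real K" using u by (simp add: a_def)
  have a: "0 < a" "a \<le> 1 / 2"
  proof -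
    show "0 < a" using u K by (simp add: a_def)
    have "a * 1 \<le> a * u" using u \<open>0 < a\<close> by (intro mult_left_mono) auto
    then show "a \<le> 1 / 2" using au Kinv by linarith
  qed
  have v: "u * (1 - a) \<le> v" "v \<le> u * (1 + a)"
    using cl au unfolding abs_le_iff v_def u_def by (auto simp: algebra_simps)
  have w: "1 / 2 \<le> u * (1 - a)"
    using mult_mono[of 1 u "1 / 2" "1 - a"] u a by simp
  have v5: "0 < v" "v \<le> 5 / 2"
  proof -
    have "u * (1 - a) = u - 1 / real K" "u * (1 + a) = u + 1 / real K" using au by (simp_all add: algebra_simps)
    then show "0 < v" "v \<le> 5 / 2" using v Kinv u w by linarith+
  qed
  \<comment> \<open>The value of c that lifts both means to t + 2 for the smallest v in the
    class.\<close>
  define c where "c = (t + 2) / (u * (1 - a))"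
  have c0: "0 < c" using t0 w by (simp add: c_def)
  have wne: "u * (1 - a) \<noteq> 0" using w by linarith
  then have "t + 2 = c * (u * (1 - a))" using nonzero_eq_divide_eq[of "u * (1 - a)" c "t + 2"] c_def by simp
  also have "\<dots> \<le> c * v" using v c0 by (intro mult_left_mono) auto
  finally have cv: "t + 2 \<le> c * v" .
  let ?y = "\<lambda>i. ?s * y i" and ?q = "2 * c * c * v"
  have xy': "dotp d ?y ?y = 1" "dotp d x ?y = ?s * dotp d x y"
  proof -
    have "dotp d ?y ?y = ?s * ?s * dotp d y y"
      by (simp only: dotp_scale_left dotp_scale_right mult.assoc)
    then show "dotp d ?y ?y = 1" by (simp add: xy)
  qed (simp only: dotp_scale_right)
  have "exp (- ?q / 2 - 2 * sqrt ?q) / 2 \<le>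
    measure (gauss_rvec d) {g \<in> space (gauss_rvec d). t \<le> dotp d x g \<and> t \<le> dotp d ?y g}"
    using gauss_pair_lower_bound[OF xy(1) xy', of t c] cv c0 v5(1) by (simp add: v_def)
  also have "\<dots> = measure (gauss_rvec d) (hits d \<Lambda> K k y x)"
    unfolding hits_def passes_iff[OF \<Lambda>(1)] t_def[symmetric] dotp_scale_left dotp_commute[of d _ x]
      dotp_commute[of d _ y] ..
  finally have main: "exp (- ?q / 2 - 2 * sqrt ?q) / 2 \<le> measure (gauss_rvec d) (hits d \<Lambda> K k y x)" .
  have c2: "c \<le> 2 * (t + 2)"
  proof -
    have "(t + 2) * 1 \<le> (t + 2) * (2 * (u * (1 - a)))" using w t0 by (intro mult_left_mono) auto
    then show ?thesis unfolding c_def using w by (simp add: field_simps)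
  qed
  have "?q \<le> (5 * (t + 2))\<^sup>2"
  proof -
    have "c * c \<le> (2 * (t + 2)) * (2 * (t + 2))" using c0 c2 by (intro mult_mono) auto
    then have "(c * c) * v \<le> ((2 * (t + 2)) * (2 * (t + 2))) * (5 / 2)"
      by (rule mult_mono) (use v5 t0 \<open>c * c \<le> _\<close> in auto)
    also have "\<dots> = 10 * (t + 2)\<^sup>2" by (simp add: power2_eq_square algebra_simps)
    finally have "?q \<le> 20 * (t + 2)\<^sup>2" by (simp add: mult.assoc)
    also have "\<dots> \<le> 25 * (t + 2)\<^sup>2" by simp
    also have "\<dots> = (5 * (t + 2))\<^sup>2" by (simp only: power_mult_distrib) simp
    finally show ?thesis .
  qed
  then have sq: "sqrt ?q \<le> 5 * (t + 2)"
    using t0 by (intro real_le_lsqrt) auto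
  have q2: "?q / 2 \<le> \<Lambda> * ?r + 34 + 24 * t"
  proof -
    \<comment> \<open>A linear bound for (1 + a) / (1 - a)^2, valid for a \<le> 1/2.\<close>
    have poly: "1 + a \<le> (1 + 10 * a) * ((1 - a) * (1 - a))"
    proof -
      have "(1 + 10 * a) * ((1 - a) * (1 - a)) - (1 + a) = a * ((1 - 2 * a) * (7 - 5 * a))"
        by (simp add: algebra_simps)
      moreover have "0 \<le> a * ((1 - 2 * a) * (7 - 5 * a))" using a by simp
      ultimately show ?thesis by linarith
    qed
    have "?q / 2 = c * c * v" by simp
    also have "\<dots> = (t + 2) * (t + 2) * v / ((u * (1 - a)) * (u * (1 - a)))"
    proof -
      have "(b / w) * (b / w) * v = b * b * v / (w * w)" for b w :: real by simp
      then show ?thesis unfolding c_def .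
    qed
    also have "\<dots> \<le> (t + 2) * (t + 2) * (u * (1 + a)) / ((u * (1 - a)) * (u * (1 - a)))"
      using v w by (intro divide_right_mono mult_left_mono) auto
    also have "\<dots> = ((t + 2) * (t + 2) / u) * ((1 + a) / ((1 - a) * (1 - a)))"
    proof -
      have "b * b * (u * e) / ((u * w) * (u * w)) = (b * b / u) * (e / (w * w))" for b e w :: real
        using u by (simp add: ac_simps)
      then show ?thesis .
    qed
    also have "\<dots> \<le> ((t + 2) * (t + 2) / u) * (1 + 10 * a)"
      using poly a u by (intro mult_left_mono) (auto simp: divide_le_eq)
    also have "\<dots> = t * t / u + 10 * (a * (t * t / u)) + ((4 * t + 4) / u) * (1 + 10 * a)"
      using u by (simp add: field_simps)
    also have "t * t / u = \<Lambda> * ?r" using t2 u by simp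
    \<comment> \<open>Here \<Lambda> \<le> K enters: the width of the class costs the main term only
      a constant.\<close>
    also have "a * (\<Lambda> * ?r) \<le> 1"
    proof -
      have "a * (\<Lambda> * ?r) \<le> a * (real K * u)"
        using a \<Lambda> r u by (intro mult_left_mono mult_mono) auto
      also have "\<dots> = 1" using u K by (simp add: a_def)
      finally show ?thesis .
    qed
    also have "((4 * t + 4) / u) * (1 + 10 * a) \<le> (4 * t + 4) * 6"
    proof (rule mult_mono)
      have "(4 * t + 4) * 1 \<le> (4 * t + 4) * u" using u t0 by (intro mult_left_mono) auto
      then show "(4 * t + 4) / u \<le> 4 * t + 4" using u by (simp add: divide_le_eq)
    qed (use a u t0 in auto)
    finally show ?thesis by simp
  qed
  define p where "p = sqrt (real K)"
  have p: "p * p = real K" "7 / 5 \<le> p"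
  proof -
    have "(7 / 5)\<^sup>2 \<le> real K" using K by (simp add: power2_eq_square)
    then show "7 / 5 \<le> p" unfolding p_def by (rule real_le_rsqrt)
  qed (simp add: p_def)
  have "t \<le> sqrt 2 * p"
    unfolding t_def p_def real_sqrt_mult[symmetric]
  proof (rule real_sqrt_le_mono)
    have "\<Lambda> * (?r * (1 + ?r)) \<le> real K * (1 * 2)" using \<Lambda> r by (intro mult_mono) auto
    then show "\<Lambda> * (?r * (1 + ?r)) \<le> 2 * real K" by simp
  qed
  also have "sqrt 2 \<le> (142 / 100 :: real)" by (rule real_le_lsqrt) (auto simp: power2_eq_square)
  finally have tp: "t \<le> 142 / 100 * p" using p(2) by (simp add: mult_right_mono)
  \<comment> \<open>The losses add up to 55 + 34 t, where the additional exp (- 1) pays for the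
    factor 1/2. With t \<le> 1.42 p and 1.4 \<le> p this is below 88 p.\<close>
  have "exp (- \<Lambda> * ?r - 88 * p) \<le> exp (- ?q / 2 - 2 * sqrt ?q - 1)"
    unfolding exp_le_cancel_iff using q2 sq tp p(2) by simp
  also have "\<dots> = exp (- ?q / 2 - 2 * sqrt ?q) * exp (- 1)" by (simp add: mult_exp_exp)
  also have "\<dots> \<le> exp (- ?q / 2 - 2 * sqrt ?q) * (1 / 2)"
  proof (rule mult_left_mono)
    have "2 \<le> exp (1::real)" using exp_ge_add_one_self[of 1] by simp
    then show "exp (- 1) \<le> (1 / 2 :: real)" by (simp add: exp_minus field_simps)
  qed simp
  finally show ?thesis using main by (simp add: p_def)
qed

section \<open>Uniform sampling from the data set\<close>

abbreviation unif :: "real measure" where "unif \<equiv> uniform_measure lborel {0..1}"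

lemma prob_space_unif: "prob_space unif"
  by (rule prob_space_uniform_measure) auto

lemma pick_index:
  assumes "i < length xs" "real i / real (length xs) \<le> u" "u < real (Suc i) / real (length xs)"
  shows "pick d xs u = xs ! i"
proof -
  have "0 < length xs" using assms(1) by linarith
  then have "0 < real (length xs)" by simp
  then have "real i \<le> u * real (length xs)" "u * real (length xs) < real (Suc i)"
    using assms by (auto simp: divide_le_eq less_divide_eq)
  then have "\<lfloor>u * real (length xs)\<rfloor> = int i" by (simp add: floor_eq_iff)
  then show ?thesis using assms by (simp add: pick_def)
qed

lemma pick_in_set:
  assumes "xs \<noteq> []" "0 \<le> u" "u < 1"
  shows "pick d xs u \<in> set xs"
proof -
  have "u * real (length xs) < real (length xs)" using assms by simp
  then have "nat \<lfloor>u * real (length xs)\<rfloor> < length xs"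
    using assms by (simp add: nat_less_iff floor_less_iff)
  then show ?thesis by (simp add: pick_def)
qed

text \<open>The drawn vector depends on u through a natural number only, so F is required to be
  measurable in x alone, for each fixed z.\<close>

lemma measurable_comp_pick:
  assumes "\<And>z. (\<lambda>x. F z x) \<in> measurable A C" and u [measurable]: "u \<in> borel_measurable A"
  shows "(\<lambda>x. F (pick d xs (u x)) x) \<in> measurable A C"
proof -
  have "(\<lambda>x. F (if i < length xs then xs ! i else zero_rvec d) x) \<in> measurable A C" for i
    by (rule assms)
  moreover have "(\<lambda>x. nat \<lfloor>u x * real (length xs)\<rfloor>) \<in> measurable A (count_space UNIV)" by measurable
  ultimately show ?thesis
    unfolding pick_def Let_def by (rule measurable_compose_countable)
qed

lemma emeasure_unif_cell:
  assumes "i < n"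
  shows "emeasure unif {real i / real n..<real (Suc i) / real n} = ennreal (1 / real n)"
proof -
  have n: "0 < real n" using assms by simp
  have "real (Suc i) \<le> real n" using assms by simp
  then have sub: "{0..1} \<inter> {real i / real n..<real (Suc i) / real n} = {real i / real n..<real (Suc i) / real n}"
  proof -
    have 1: "real (Suc i) / real n \<le> 1" "0 \<le> real i / real n"
      using n \<open>real (Suc i) \<le> real n\<close> by (auto simp: divide_le_eq)
    have "x \<in> {0..1}" if "x \<in> {real i / real n..<real (Suc i) / real n}" for x
      using 1 that unfolding atLeastLessThan_iff atLeastAtMost_iff by linarith
    then show ?thesis by blast
  qed
  have "emeasure unif {real i / real n..<real (Suc i) / real n} =
      emeasure lborel ({0..1} \<inter> {real i / real n..<real (Suc i) / real n}) / emeasure lborel {0..1::real}"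
    by (rule emeasure_uniform_measure) auto
  also have "\<dots> = ennreal (real (Suc i) / real n - real i / real n)"
  proof -
    have "real i / real n \<le> real (Suc i) / real n" using n by (simp add: divide_right_mono)
    then show ?thesis
      unfolding sub using divide_ennreal[of "real (Suc i) / real n - real i / real n" 1]
      by (simp del: of_nat_Suc)
  qed
  also have "real (Suc i) / real n - real i / real n = 1 / real n"
    using n by (simp add: field_simps)
  finally show ?thesis .
qed

lemma AE_unif: "AE u in unif. 0 \<le> u \<and> u < 1"
proof -
  have "AE u in lborel. u \<in> {0..1} \<longrightarrow> 0 \<le> u \<and> u < (1::real)"
    using AE_lborel_singleton[of 1] by eventually_elim auto
  then show ?thesis by (simp add: AE_uniform_measure)
qed

text \<open>Outside a null set, u lies in exactly one of n cells of measure 1/n, and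
  \<open>pick\<close> is constant on each of them.\<close>

lemma nn_integral_pick:
  fixes h :: "rvec \<Rightarrow> ennreal"
  assumes "xs \<noteq> []"
  shows "(\<integral>\<^sup>+u. h (pick d xs u) \<partial>unif) = (\<Sum>i<length xs. h (xs ! i)) * ennreal (1 / real (length xs))"
proof -
  let ?n = "length xs" and ?I = "\<lambda>i. {real i / real (length xs)..<real (Suc i) / real (length xs)}"
  have n: "0 < real ?n" using assms by simp
  have "(\<integral>\<^sup>+u. h (pick d xs u) \<partial>unif) = (\<integral>\<^sup>+u. (\<Sum>i<?n. h (xs ! i) * indicator (?I i) u) \<partial>unif)"
  proof (rule nn_integral_cong_AE, use AE_unif in eventually_elim)
    case (elim u)
    define i where "i = nat \<lfloor>u * real ?n\<rfloor>"
    have "u * real ?n < real ?n" using elim n by simp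
    then have i: "i < ?n" using elim n unfolding i_def by (simp add: nat_less_iff floor_less_iff)
    have "0 \<le> u * real ?n" using elim n by simp
    then have "real i \<le> u * real ?n" "u * real ?n < real (Suc i)" unfolding i_def by linarith+
    then have ui: "u \<in> ?I i" using n by (auto simp: divide_le_eq less_divide_eq)
    have only: "j = i" if "j < ?n" "u \<in> ?I j" for j
    proof -
      have "real j \<le> u * real ?n" "u * real ?n < real (Suc j)"
        using that(2) n by (auto simp: divide_le_eq less_divide_eq)
      then show ?thesis unfolding i_def by linarith
    qed
    have "(\<Sum>j<?n. h (xs ! j) * indicator (?I j) u) = (\<Sum>j\<in>{i}. h (xs ! j) * indicator (?I j) u)"
    proof (rule sum.mono_neutral_right)
      have "u \<notin> ?I j" if "j \<in> {..<?n} - {i}" for j using only that by blast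
      then show "\<forall>j\<in>{..<?n} - {i}. h (xs ! j) * indicator (?I j) u = 0" by simp
    qed (use i in simp_all)
    moreover have "(\<Sum>j\<in>{i}. g j) = g i" for g :: "nat \<Rightarrow> ennreal" by simp
    ultimately have "(\<Sum>j<?n. h (xs ! j) * indicator (?I j) u) = h (xs ! i) * indicator (?I i) u"
      by (simp only:)
    moreover have "indicator (?I i) u = (1 :: ennreal)" using ui by (rule indicator_simps(1))
    moreover have "pick d xs u = xs ! i" using ui by (intro pick_index i) auto
    ultimately show ?case by (simp only: mult_1_right)
  qed
  also have "\<dots> = (\<Sum>i<?n. h (xs ! i) * emeasure unif (?I i))"
    by (subst nn_integral_sum) (auto simp: nn_integral_cmult)
  also have "\<dots> = (\<Sum>i<?n. h (xs ! i) * ennreal (1 / real ?n))"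
    by (intro sum.cong refl arg_cong2[where f = "(*)"] emeasure_unif_cell) simp
  finally show ?thesis by (simp only: sum_distrib_right)
qed

text \<open>For \<open>u = 1\<close> the machine picks the zero vector, which need not satisfy the bounds that hold on
  the data set; \<open>sampled\<close> avoids this null event.\<close>

definition sampled :: "(rvec \<Rightarrow> real) \<Rightarrow> nat \<Rightarrow> rvec list \<Rightarrow> real \<Rightarrow> real" where
  "sampled h d xs u = (if 0 \<le> u \<and> u < 1 then h (pick d xs u) else 0)"

lemma measurable_sampled [measurable]: "sampled h d xs \<in> borel_measurable borel"
proof -
  have [measurable]: "(\<lambda>u. h (pick d xs u)) \<in> borel_measurable borel"
    by (rule measurable_comp_pick[where F = "\<lambda>z u. h z" and u = "\<lambda>u. u"]) simp_all
  show ?thesis unfolding sampled_def by measurable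
qed

lemma expectation_sampled:
  assumes "xs \<noteq> []" and h: "\<And>x. x \<in> set xs \<Longrightarrow> 0 \<le> h x"
  shows "(\<integral>u. sampled h d xs u \<partial>unif) = (\<Sum>i<length xs. h (xs ! i)) / real (length xs)"
proof -
  have nn: "0 \<le> sampled h d xs u" for u
    using pick_in_set[OF assms(1)] h by (simp add: sampled_def)
  have "(\<integral>\<^sup>+u. ennreal (sampled h d xs u) \<partial>unif) = (\<integral>\<^sup>+u. ennreal (h (pick d xs u)) \<partial>unif)"
    by (rule nn_integral_cong_AE, use AE_unif in eventually_elim) (simp add: sampled_def)
  also have "\<dots> = (\<Sum>i<length xs. ennreal (h (xs ! i))) * ennreal (1 / real (length xs))"
    by (rule nn_integral_pick) fact
  also have "\<dots> = ennreal ((\<Sum>i<length xs. h (xs ! i)) / real (length xs))"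
    using h by (subst sum_ennreal) (auto simp: ennreal_mult''[symmetric])
  finally have *: "(\<integral>\<^sup>+u. ennreal (sampled h d xs u) \<partial>unif) = ennreal ((\<Sum>i<length xs. h (xs ! i)) / real (length xs))" .
  have m: "sampled h d xs \<in> borel_measurable unif" by measurable
  have s0: "0 \<le> (\<Sum>i<length xs. h (xs ! i)) / real (length xs)"
    by (intro divide_nonneg_nonneg sum_nonneg h) simp_all
  have "(\<integral>u. sampled h d xs u \<partial>unif) = enn2real (\<integral>\<^sup>+u. ennreal (sampled h d xs u) \<partial>unif)"
    using m by (rule integral_eq_nn_integral) (simp add: nn)
  then show ?thesis unfolding * enn2real_ennreal[OF s0] .
qed

section \<open>Accuracy of the answer\<close>

lemma least_doubling_le:
  assumes "1 \<le> n" "2 \<le> K" "ln (real n) \<le> real K"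
  shows "(LEAST J. 2 * n \<le> 2 ^ J) \<le> 4 * K"
proof (rule Least_le)
  have n: "0 < real n" using assms by simp
  then have "real n \<le> exp (real K)" using assms(3) by (metis exp_ln exp_le_cancel_iff)
  also have "\<dots> \<le> 3 ^ K"
    using power_mono[OF exp_le, of K] by (simp add: exp_of_nat_mult[symmetric])
  finally have "real n \<le> 3 ^ K" .
  moreover have "(2 :: real) ^ 1 \<le> 2 ^ K" using assms by (intro power_increasing) auto
  ultimately have "2 * real n \<le> 2 ^ K * 3 ^ K" using n by (intro mult_mono) auto
  also have "\<dots> = 6 ^ K" by (simp flip: power_mult_distrib)
  also have "\<dots> \<le> 16 ^ K" by (intro power_mono) auto
  also have "\<dots> = 2 ^ (4 * K)" by (simp add: power_mult)
  finally have "real (2 * n) \<le> real (2 ^ (4 * K))" by simp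
  then show "2 * n \<le> 2 ^ (4 * K)" by (simp only: of_nat_le_iff)
qed

text \<open>With G on the right this is 4 K (2 K + 1) (2 K + 1)^2 / G \<le> 1/9, the union bound
  over levels and classes with the Chebyshev bound for each pair.\<close>

lemma constants_le_exp:
  fixes K :: nat and q :: real
  assumes "real K = q * q" "7 / 5 \<le> q"
  shows "36 * real K * (2 * real K + 1) ^ 3 \<le> exp (100 * q)"
proof -
  have K: "real K \<le> exp (2 * q)"
  proof -
    have "q \<le> exp q" using exp_ge_add_one_self[of q] by linarith
    then have "q * q \<le> exp q * exp q" using assms by (intro mult_mono) auto
    then show ?thesis by (simp add: assms mult_exp_exp)
  qed
  have "1 \<le> real K"
    unfolding assms(1) using mult_mono[of 1 q 1 q] assms(2) by simp
  then have "2 * real K + 1 \<le> 3 * real K" by simp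
  also have "\<dots> \<le> exp (2 * q) * exp (2 * q)"
  proof -
    have "3 \<le> exp (2 * q)" using exp_ge_add_one_self[of "2 * q"] assms(2) by linarith
    then show ?thesis using K by (intro mult_mono) auto
  qed
  finally have c: "2 * real K + 1 \<le> exp (4 * q)" by (simp add: mult_exp_exp)
  have "36 \<le> exp (6 * q)"
  proof -
    have "(7 / 5) * (7 / 5) \<le> q * q" using assms(2) by (intro mult_mono) auto
    then show ?thesis
      using exp_lower_Taylor_quadratic[of "6 * q"] assms(2) by (simp add: power2_eq_square)
  qed
  then have "36 * real K * (2 * real K + 1) ^ 3 \<le> exp (6 * q) * exp (2 * q) * exp (4 * q) ^ 3"
    using K c by (intro mult_mono power_mono) auto
  also have "\<dots> = exp (20 * q)"
    by (simp add: mult_exp_exp flip: exp_of_nat_mult)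
  also have "\<dots> \<le> exp (100 * q)" using assms(2) by simp
  finally show ?thesis .
qed

text \<open>Cauchy-Schwarz, read off from the squared lengths of x + y and x - y.\<close>

lemma dotp_bounds:
  assumes "dotp d x x = 1" "dotp d y y = 1"
  shows "dotp d x y \<in> {-1..1}"
proof -
  have nonneg: "0 \<le> dotp d z z" for z unfolding dotp_def by (intro sum_nonneg) simp
  have sq: "dotp d (\<lambda>i. x i + c * y i) (\<lambda>i. x i + c * y i) = 1 + 2 * c * dotp d x y + c * c" for c
    by (simp add: dotp_add_left dotp_add_right dotp_scale_left dotp_scale_right assms dotp_commute[of d y x])
  from nonneg[of "\<lambda>i. x i + 1 * y i"] nonneg[of "\<lambda>i. x i + (- 1) * y i"] show ?thesis
    unfolding sq by simp
qed

lemma class_weight_nonneg: "0 \<le> class_weight \<phi> K k \<rho>"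
  by (simp add: class_weight_def)

lemma class_weight_eq:
  assumes "\<rho> \<in> {-1..1}" "class_weight \<phi> K k \<rho> \<noteq> 0"
  shows "class_weight \<phi> K k \<rho> = exp (\<phi> \<rho>)"
  using assms by (auto simp: class_weight_def split: if_splits)

text \<open>After multiplication by \<sigma> the class is [r, r + 1/K) if K \<le> k and (r - 1/K, r]
  if k < K; the reflection moves r to the other end.\<close>

lemma class_weight_side:
  assumes "0 < K" "class_weight \<phi> K k \<rho> \<noteq> 0"
  shows "\<bar>side K k * \<rho> - radius K k\<bar> \<le> 1 / real K"
proof -
  have b: "real k \<le> (1 + \<rho>) * real K" "(1 + \<rho>) * real K < real k + 1"
    using assms(2) by (auto simp: class_weight_def split: if_splits)
  have "\<bar>(side K k * \<rho> - radius K k) * real K\<bar> \<le> 1"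
  proof (cases "k < K")
    case True
    then have "radius K k * real K = real K - real k" using assms(1) by (simp add: radius_def)
    then have "(side K k * \<rho> - radius K k) * real K = real k - (1 + \<rho>) * real K"
      using True by (simp add: side_def algebra_simps)
    then show ?thesis using b by simp
  next
    case False
    then have "radius K k * real K = real k - real K" using assms(1) by (simp add: radius_def)
    then have "(side K k * \<rho> - radius K k) * real K = (1 + \<rho>) * real K - real k"
      using False by (simp add: side_def algebra_simps)
    then show ?thesis using b by simp
  qed
  then have "\<bar>side K k * \<rho> - radius K k\<bar> * real K \<le> 1" by (simp add: abs_mult)
  then show ?thesis using assms(1) by (simp add: le_divide_eq)
qed

text \<open>The half-open classes partition [-1, 1]. The last one, k = 2 K, is there for \<rho> = 1
  only.\<close>

lemma sum_class_weight:
  assumes "\<rho> \<in> {-1..1}" "0 < K"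
  shows "(\<Sum>k<2 * K + 1. class_weight \<phi> K k \<rho>) = exp (\<phi> \<rho>)"
    and "class_weight \<phi> K (nat \<lfloor>(1 + \<rho>) * real K\<rfloor>) \<rho> = exp (\<phi> \<rho>)"
    and "nat \<lfloor>(1 + \<rho>) * real K\<rfloor> < 2 * K + 1"
    and "class_weight \<phi> K k \<rho> \<noteq> 0 \<Longrightarrow> k = nat \<lfloor>(1 + \<rho>) * real K\<rfloor>"
proof -
  let ?z = "(1 + \<rho>) * real K" let ?k = "nat \<lfloor>(1 + \<rho>) * real K\<rfloor>"
  have z: "0 \<le> ?z" using assms by simp
  have "?z \<le> 2 * real K" by (rule mult_right_mono) (use assms in auto)
  then show lt: "?k < 2 * K + 1" using z by linarith
  have k: "real ?k \<le> ?z" "?z < real ?k + 1" using z by linarith+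
  then show eq: "class_weight \<phi> K ?k \<rho> = exp (\<phi> \<rho>)" using assms by (simp add: class_weight_def)
  show uniq: "k = ?k" if "class_weight \<phi> K k \<rho> \<noteq> 0" for k
  proof -
    have "real k \<le> ?z" "?z < real k + 1" using that by (auto simp: class_weight_def split: if_splits)
    then show ?thesis using k by linarith
  qed
  have "(\<Sum>k<2 * K + 1. class_weight \<phi> K k \<rho>) = (\<Sum>k\<in>{?k}. class_weight \<phi> K k \<rho>)"
  proof (rule sum.mono_neutral_right)
    show "\<forall>i\<in>{..<2 * K + 1} - {?k}. class_weight \<phi> K i \<rho> = 0" using uniq by blast
  qed (use lt in simp_all)
  then show "(\<Sum>k<2 * K + 1. class_weight \<phi> K k \<rho>) = exp (\<phi> \<rho>)" using eq by simp
qed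

section \<open>Deterministic conditions for an accurate answer\<close>

context search
begin

text \<open>Found samples from other classes have weight 0, and under perfect recall no others are
  missing. So the estimate is the sample mean, independent of how the filters behaved.\<close>

lemma est_eq_average:
  assumes "\<And>j. j < v * B \<Longrightarrow> weight k j \<noteq> 0 \<Longrightarrow>
    \<exists>f<nfilters k. ypass k f \<and> passes \<Lambda> K k (dotp d (gs f) (sm j))"
  shows "est k v = (\<Sum>j<v * B. weight k j) / real (v * B)"
proof -
  have "(\<Sum>j\<in>found k (nfilters k) (v * B). weight k j) = (\<Sum>j<v * B. weight k j)"
    by (rule sum.mono_neutral_left) (use assms in \<open>auto simp: found_def cand_def\<close>)
  then show ?thesis by (simp add: est_def)
qed

text \<open>Beyond i0 nothing is assumed about which scans complete: each of them either installs
  another accurate value or keeps the old one.\<close>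

lemma lastval_accurate:
  assumes "i0 < J" "real (scan_cost k (nfilters k) (2 ^ i0 * B)) < bud"
    and "\<And>i. i0 \<le> i \<Longrightarrow> i < J \<Longrightarrow> \<bar>est k (2 ^ i) - m\<bar> \<le> err"
  shows "\<bar>lastval k J - m\<bar> \<le> err"
  using assms
proof (induction J)
  case (Suc J)
  show ?case
  proof (cases "i0 = J")
    case False
    then have "\<bar>lastval k J - m\<bar> \<le> err" using Suc by auto
    then show ?thesis using Suc.prems by simp
  qed (use Suc.prems in simp)
qed simp

lemma lastval_zero:
  assumes "\<And>i. i < J \<Longrightarrow> est k (2 ^ i) = 0"
  shows "lastval k J = 0"
  using assms by (induction J) auto

lemma real_scan_cost:
  "real (scan_cost k F L) = (\<Sum>f<F. \<Sum>j<L. of_bool (passes \<Lambda> K k (dotp d (gs f) (sm j)) \<and> ypass k f))"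
proof -
  have "real (card (cand k f L)) = (\<Sum>j<L. of_bool (passes \<Lambda> K k (dotp d (gs f) (sm j))))" for f
  proof -
    have "cand k f L = {j \<in> {..<L}. passes \<Lambda> K k (dotp d (gs f) (sm j))}" by (auto simp: cand_def)
    then show ?thesis by (simp add: sum.inter_filter[symmetric] of_bool_def)
  qed
  then show ?thesis unfolding scan_cost_def of_nat_sum by (intro sum.cong) auto
qed

end

section \<open>The expected cost of a scan\<close>

abbreviation unif_stream :: "real stream measure" where
  "unif_stream \<equiv> stream_space unif"

abbreviation gauss_stream :: "nat \<Rightarrow> rvec stream measure" where
  "gauss_stream d \<equiv> stream_space (gauss_rvec d)"

lemma prob_space_unif_stream: "prob_space unif_stream"
  by (intro prob_space.prob_space_stream_space prob_space_unif)

lemma prob_space_gauss_stream: "prob_space (gauss_stream d)"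
  by (intro prob_space.prob_space_stream_space prob_space_gauss_rvec)

lemma tapes_eq: "tapes d = unif_stream \<Otimes>\<^sub>M gauss_stream d"
  by (simp add: tapes_def)

text \<open>The scan cost as a function of the tapes, with values in \<open>ennreal\<close> so that
  expectation and sums commute without integrability conditions.\<close>

definition all_hits ::
  "nat \<Rightarrow> real \<Rightarrow> nat \<Rightarrow> nat \<Rightarrow> rvec list \<Rightarrow> rvec \<Rightarrow> nat \<Rightarrow> nat \<Rightarrow> real stream \<times> rvec stream \<Rightarrow> ennreal" where
  "all_hits d \<Lambda> K k xs y F L \<omega> =
     (\<Sum>f<F. \<Sum>j<L. indicator (hits d \<Lambda> K k y (pick d xs (fst \<omega> !! j))) (snd \<omega> !! f))"

lemma measurable_hit [measurable]:
  "(\<lambda>\<omega>. indicator (hits d \<Lambda> K k y (pick d xs (fst \<omega> !! j))) (snd \<omega> !! f) :: ennreal)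
     \<in> borel_measurable (unif_stream \<Otimes>\<^sub>M gauss_stream d)"
  by (rule measurable_comp_pick[where F = "\<lambda>z \<omega>. indicator (hits d \<Lambda> K k y z) (snd \<omega> !! f)"]) measurable

lemma measurable_all_hits [measurable]:
  "all_hits d \<Lambda> K k xs y F L \<in> borel_measurable (unif_stream \<Otimes>\<^sub>M gauss_stream d)"
  unfolding all_hits_def by measurable

text \<open>Samples and filters come from independent tapes. By Tonelli each pair contributes the
  collision probability averaged over the data set; dependence between different pairs does not
  affect the mean.\<close>

lemma nn_integral_all_hits:
  assumes "xs \<noteq> []"
  shows "(\<integral>\<^sup>+\<omega>. all_hits d \<Lambda> K k xs y F L \<omega> \<partial>(unif_stream \<Otimes>\<^sub>M gauss_stream d)) =
    ennreal (real F * real L * ((\<Sum>i<length xs. measure (gauss_rvec d) (hits d \<Lambda> K k y (xs ! i))) / real (length xs)))"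
    (is "_ = ennreal (real F * real L * ?avg)")
proof -
  interpret U: prob_space unif by (rule prob_space_unif)
  interpret G: prob_space "gauss_rvec d" by (rule prob_space_gauss_rvec)
  interpret SG: prob_space "gauss_stream d" by (rule prob_space_gauss_stream)
  let ?p = "\<lambda>x. measure (gauss_rvec d) (hits d \<Lambda> K k y x)"
  have avg0: "0 \<le> ?avg" by (intro divide_nonneg_nonneg sum_nonneg) simp_all
  have m: "(\<lambda>u. ennreal (?p (pick d xs u))) \<in> borel_measurable borel"
    by (rule measurable_comp_pick[where F = "\<lambda>z u. ennreal (?p z)" and u = "\<lambda>u. u"]) simp_all
  have one: "(\<integral>\<^sup>+\<omega>. indicator (hits d \<Lambda> K k y (pick d xs (fst \<omega> !! j))) (snd \<omega> !! f)
      \<partial>(unif_stream \<Otimes>\<^sub>M gauss_stream d)) = ennreal ?avg" for j f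
  proof -
    have "(\<integral>\<^sup>+\<omega>. indicator (hits d \<Lambda> K k y (pick d xs (fst \<omega> !! j))) (snd \<omega> !! f)
      \<partial>(unif_stream \<Otimes>\<^sub>M gauss_stream d)) =
      (\<integral>\<^sup>+us. \<integral>\<^sup>+gs. indicator (hits d \<Lambda> K k y (pick d xs (us !! j))) (gs !! f) \<partial>gauss_stream d \<partial>unif_stream)"
      by (subst SG.nn_integral_fst[symmetric, OF measurable_hit]) simp
    also have "\<dots> = (\<integral>\<^sup>+us. ennreal (?p (pick d xs (us !! j))) \<partial>unif_stream)"
    proof (rule nn_integral_cong)
      fix us :: "real stream"
      have "(\<integral>\<^sup>+gs. indicator (hits d \<Lambda> K k y (pick d xs (us !! j))) (gs !! f) \<partial>gauss_stream d) =
        (\<integral>\<^sup>+g. indicator (hits d \<Lambda> K k y (pick d xs (us !! j))) g \<partial>gauss_rvec d)"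
        by (rule G.nn_integral_stream_snth) measurable
      then show "(\<integral>\<^sup>+gs. indicator (hits d \<Lambda> K k y (pick d xs (us !! j))) (gs !! f) \<partial>gauss_stream d) =
        ennreal (?p (pick d xs (us !! j)))"
        by (simp add: G.emeasure_eq_measure)
    qed
    also have "\<dots> = (\<integral>\<^sup>+u. ennreal (?p (pick d xs u)) \<partial>unif)"
      by (rule U.nn_integral_stream_snth) (use m in simp)
    also have "\<dots> = (\<Sum>i<length xs. ennreal (?p (xs ! i))) * ennreal (1 / real (length xs))"
      by (rule nn_integral_pick) fact
    also have "\<dots> = ennreal ?avg"
      by (simp add: ennreal_mult''[symmetric])
    finally show ?thesis .
  qed
  have "(\<integral>\<^sup>+\<omega>. all_hits d \<Lambda> K k xs y F L \<omega> \<partial>(unif_stream \<Otimes>\<^sub>M gauss_stream d)) =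
      (\<Sum>f<F. \<Sum>j<L. ennreal ?avg)"
    unfolding all_hits_def
    by (subst nn_integral_sum, measurable, intro sum.cong refl)
       (subst nn_integral_sum, measurable, intro sum.cong refl one)
  also have "\<dots> = ennreal (real F * real L * ?avg)"
  proof -
    have "(\<Sum>f<F. \<Sum>j<L. ennreal ?avg) = (\<Sum>f<F. ennreal (\<Sum>j<L. ?avg))"
      by (intro sum.cong refl sum_ennreal avg0)
    also have "\<dots> = ennreal (\<Sum>f<F. \<Sum>j<L. ?avg)"
      by (intro sum_ennreal sum_nonneg avg0)
    also have "(\<Sum>f<F. \<Sum>j<L. ?avg) = real F * real L * ?avg"
      by (simp only: sum_constant card_lessThan mult.assoc)
    finally show ?thesis .
  qed
  finally show ?thesis .
qed

lemma measure_all_hits_ge: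
  assumes "xs \<noteq> []" "0 < bud"
  shows "measure (unif_stream \<Otimes>\<^sub>M gauss_stream d)
      {\<omega> \<in> space (unif_stream \<Otimes>\<^sub>M gauss_stream d). ennreal bud \<le> all_hits d \<Lambda> K k xs y F L \<omega>}
    \<le> real F * real L * ((\<Sum>i<length xs. measure (gauss_rvec d) (hits d \<Lambda> K k y (xs ! i))) / real (length xs)) / bud"
    (is "measure ?P ?T \<le> ?e / bud")
proof -
  interpret SU: prob_space unif_stream by (rule prob_space_unif_stream)
  interpret SG: prob_space "gauss_stream d" by (rule prob_space_gauss_stream)
  interpret P: pair_prob_space unif_stream "gauss_stream d" ..
  have e0: "0 \<le> ?e" by (intro mult_nonneg_nonneg divide_nonneg_nonneg sum_nonneg) simp_all
  have [measurable]: "?T \<in> sets ?P" by measurable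
  have "ennreal bud * emeasure ?P ?T = (\<integral>\<^sup>+\<omega>. ennreal bud * indicator ?T \<omega> \<partial>?P)"
    by (simp add: nn_integral_cmult)
  also have "\<dots> \<le> (\<integral>\<^sup>+\<omega>. all_hits d \<Lambda> K k xs y F L \<omega> \<partial>?P)"
    by (rule nn_integral_mono) (auto simp: indicator_def)
  also have "\<dots> = ennreal ?e" by (rule nn_integral_all_hits) fact
  finally have "ennreal (bud * measure ?P ?T) \<le> ennreal ?e"
    using assms(2) by (simp add: P.emeasure_eq_measure ennreal_mult)
  then have "bud * measure ?P ?T \<le> ?e" using e0 by (simp add: ennreal_le_iff)
  then show ?thesis unfolding pos_le_divide_eq[OF assms(2)] by (simp only: mult.commute)
qed

lemma measure_fst_event:
  assumes "A \<in> sets unif_stream"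
  shows "measure (unif_stream \<Otimes>\<^sub>M gauss_stream d) (A \<times> space (gauss_stream d)) = measure unif_stream A"
proof -
  interpret SG: prob_space "gauss_stream d" by (rule prob_space_gauss_stream)
  show ?thesis using assms by (simp add: measure_def SG.emeasure_pair_measure_Times SG.emeasure_space_1)
qed

lemma measure_snd_event:
  assumes "A \<in> sets (gauss_stream d)"
  shows "measure (unif_stream \<Otimes>\<^sub>M gauss_stream d) (space unif_stream \<times> A) = measure (gauss_stream d) A"
proof -
  interpret SU: prob_space unif_stream by (rule prob_space_unif_stream)
  interpret SG: prob_space "gauss_stream d" by (rule prob_space_gauss_stream)
  show ?thesis using assms by (simp add: measure_def SG.emeasure_pair_measure_Times SU.emeasure_space_1)
qed

section \<open>One data set, one query, and the weights of its classes\<close>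

locale kernel_instance =
  fixes \<phi> :: "real \<Rightarrow> real" and d :: nat and xs :: "rvec list" and y :: rvec
    and \<epsilon> \<Lambda> G bud :: real and K B :: nat
  assumes len: "2 \<le> length xs" and dist: "distinct xs" and sphere: "set xs \<subseteq> unit_sphere d" and y: "y \<in> unit_sphere d"
    and lip: "\<And>a b. a \<in> {-1..1} \<Longrightarrow> b \<in> {-1..1} \<Longrightarrow> \<bar>\<phi> a - \<phi> b\<bar> \<le> \<Lambda> * \<bar>a - b\<bar>"
    and \<Lambda>: "0 \<le> \<Lambda>" "\<Lambda> \<le> real K" and K: "2 \<le> K" "ln (real (length xs)) \<le> real K"
    and \<epsilon>: "0 < \<epsilon>" and G: "G = exp (100 * sqrt (real K))"
    and B: "B = nat \<lceil>G / (\<epsilon> * \<epsilon>)\<rceil>" and bud: "bud = G * (G * G) * exp \<Lambda> / (\<epsilon> * \<epsilon>)"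
begin

abbreviation n :: nat where "n \<equiv> length xs"

definition nf :: "nat \<Rightarrow> nat" where "nf k = nat \<lceil>G * exp (\<Lambda> * radius K k)\<rceil>"
definition w :: "nat \<Rightarrow> rvec \<Rightarrow> real" where "w k x = class_weight \<phi> K k (dotp d x y)"
definition mean :: "nat \<Rightarrow> real" where "mean k = (\<Sum>i<n. w k (xs ! i)) / real n"
definition total :: real where "total = kernel_mean \<phi> d (set xs) y"
definition peak :: "nat \<Rightarrow> real" where "peak k = Max (w k ` set xs)"

lemma n_pos: "0 < real n" "xs \<noteq> []"
  using len by (cases xs; simp)+

lemma unit: "x \<in> set xs \<Longrightarrow> dotp d x x = 1" "dotp d y y = 1"
  using sphere y by (auto simp: unit_sphere_def)

lemma rho: "x \<in> set xs \<Longrightarrow> dotp d x y \<in> {-1..1}"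
  using dotp_bounds unit by blast

lemma w_nonneg: "0 \<le> w k x"
  by (simp add: w_def class_weight_nonneg)

lemma sum_list_set: "(\<Sum>i<n. h (xs ! i)) = (\<Sum>x\<in>set xs. h x)" for h :: "rvec \<Rightarrow> real"
  by (metis (no_types, lifting) atLeast0LessThan dist sum.cong sum_list_distinct_conv_sum_set sum_list_sum_nth length_map nth_map lessThan_iff)

lemma sum_mean: "(\<Sum>k<2 * K + 1. mean k) = total"
proof -
  have "(\<Sum>k<2 * K + 1. mean k) = (\<Sum>k<2 * K + 1. \<Sum>x\<in>set xs. w k x) / real n"
    by (simp only: mean_def sum_list_set sum_divide_distrib)
  also have "(\<Sum>k<2 * K + 1. \<Sum>x\<in>set xs. w k x) = (\<Sum>x\<in>set xs. \<Sum>k<2 * K + 1. w k x)"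
    by (rule sum.swap)
  also have "\<dots> = (\<Sum>x\<in>set xs. exp (\<phi> (dotp d x y)))"
    by (intro sum.cong refl) (use K rho in \<open>simp only: w_def sum_class_weight(1)\<close>)
  finally show ?thesis
    by (simp add: total_def kernel_mean_def distinct_card[OF dist])
qed

lemma mean_nonneg: "0 \<le> mean k"
  unfolding mean_def by (intro divide_nonneg_nonneg sum_nonneg w_nonneg) simp

lemma mean_le_total: "k < 2 * K + 1 \<Longrightarrow> mean k \<le> total"
  unfolding sum_mean[symmetric] by (rule member_le_sum) (auto intro: mean_nonneg)

lemma total_pos: "0 < total"
proof -
  have "0 < (\<Sum>x\<in>set xs. exp (\<phi> (dotp d x y)))"
    by (rule sum_pos) (use n_pos in auto)
  then show ?thesis
    unfolding total_def kernel_mean_def using n_pos by (simp add: distinct_card[OF dist])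
qed

lemma w_le_peak: "x \<in> set xs \<Longrightarrow> w k x \<le> peak k"
  unfolding peak_def by (intro Max_ge) auto

lemma peak_attained: "\<exists>x\<in>set xs. w k x = peak k"
proof -
  have "Max (w k ` set xs) \<in> w k ` set xs" by (rule Max_in) (use n_pos in auto)
  then obtain x where "x \<in> set xs" "Max (w k ` set xs) = w k x" by (rule imageE) auto
  then show ?thesis unfolding peak_def by (intro bexI[of _ x]) simp_all
qed

lemma peak_nonneg: "0 \<le> peak k"
  using peak_attained w_nonneg by metis

text \<open>A point of largest weight alone contributes peak / n to the mean. Hence peak / total
  \<le> n, and the critical sample is among those prepared.\<close>

lemma peak_le: "peak k \<le> real n * mean k"
proof -
  obtain x where x: "x \<in> set xs" "w k x = peak k" using peak_attained by blast
  have "w k x \<le> (\<Sum>x\<in>set xs. w k x)" by (rule member_le_sum) (use x w_nonneg in auto)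
  then show ?thesis using n_pos x by (simp add: mean_def sum_list_set)
qed

lemma K_pos: "0 < K" using K by simp

lemma G_big: "36 * real K * (2 * real K + 1) ^ 3 \<le> G"
proof -
  have "(7 / 5)\<^sup>2 \<le> real K" using K by (simp add: power2_eq_square)
  then have "7 / 5 \<le> sqrt (real K)" by (rule real_le_rsqrt)
  then show ?thesis unfolding G by (intro constants_le_exp) auto
qed

text \<open>The third bound is (2 K + 1) 24 / G \<le> 1/9, the union bound over the classes for the
  scanning cost.\<close>

lemma G_bounds: "1 \<le> G" "0 < G" "216 * (2 * real K + 1) \<le> G"
proof -
  have c: "1 \<le> 2 * real K + 1" "5 \<le> 2 * real K + 1" "2 \<le> real K" using K by auto
  have "3 \<le> (2 * real K + 1) * (2 * real K + 1)"
    using mult_mono[of 5 "2 * real K + 1" 1 "2 * real K + 1"] c by simp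
  then have "(36 * 2) * (3 * (2 * real K + 1)) \<le> (36 * real K) * (((2 * real K + 1) * (2 * real K + 1)) * (2 * real K + 1))"
    using c by (intro mult_mono mult_right_mono) auto
  also have "\<dots> \<le> G" using G_big by (simp add: power3_eq_cube)
  finally show big: "216 * (2 * real K + 1) \<le> G" by simp
  have "1 \<le> 216 * (2 * real K + 1)" by simp
  then show "1 \<le> G" using big by (rule order.trans)
  then show "0 < G" by simp
qed

lemma nf_bounds:
  assumes "k < 2 * K + 1"
  shows "G * exp (\<Lambda> * radius K k) \<le> real (nf k)" "real (nf k) \<le> 2 * (G * exp (\<Lambda> * radius K k))"
proof -
  have "0 \<le> radius K k" using radius_bounds[OF assms K_pos] by simp
  then have "1 \<le> exp (\<Lambda> * radius K k)" using \<Lambda> by simp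
  then have "1 * 1 \<le> G * exp (\<Lambda> * radius K k)" using G_bounds by (intro mult_mono) auto
  then show "G * exp (\<Lambda> * radius K k) \<le> real (nf k)" "real (nf k) \<le> 2 * (G * exp (\<Lambda> * radius K k))"
    unfolding nf_def by linarith+
qed

lemma B_bounds:
  assumes "\<epsilon> < 1"
  shows "G / (\<epsilon> * \<epsilon>) \<le> real B" "real B \<le> 2 * (G / (\<epsilon> * \<epsilon>))" "0 < B"
proof -
  have "\<epsilon> * \<epsilon> \<le> 1 * 1" using \<epsilon> assms by (intro mult_mono) auto
  then have "1 * (\<epsilon> * \<epsilon>) \<le> G" using G_bounds by linarith
  then have "1 \<le> G / (\<epsilon> * \<epsilon>)" using \<epsilon> by (subst pos_le_divide_eq) auto
  then show "G / (\<epsilon> * \<epsilon>) \<le> real B" "real B \<le> 2 * (G / (\<epsilon> * \<epsilon>))" "0 < B"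
    unfolding B by linarith+
qed

text \<open>Both bounds weaken 2 G exp (\<Lambda> (1 - \<beta>)), where \<beta> is the distance of
  \<sigma> \<langle>z, y\<rangle> from r: the first by \<beta> \<ge> 0, the second by the Lipschitz
  condition for z and a point x that attains the peak. As x lies within 1/K of r and \<Lambda> \<le>
  K, passing from r to x costs the factor \<open>exp 1\<close>.\<close>

lemma false_positives:
  assumes k: "k < 2 * K + 1" and peak: "0 < peak k" and z: "z \<in> set xs"
  shows "real (nf k) * measure (gauss_rvec d) (hits d \<Lambda> K k y z) \<le> 2 * G * exp \<Lambda>"
    and "real (nf k) * measure (gauss_rvec d) (hits d \<Lambda> K k y z) \<le>
      2 * G * exp \<Lambda> * (exp 1 * exp (\<phi> (dotp d z y)) / peak k)"
proof -
  let ?r = "radius K k"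
  define v where "v = 1 + side K k * dotp d z y"
  define u where "u = 1 + ?r"
  define \<beta> where "\<beta> = \<bar>v - u\<bar>"
  have r: "0 \<le> ?r" "?r \<le> 1" using radius_bounds[OF k K_pos] by auto
  have v: "0 \<le> v" "v \<le> 2" using rho[OF z] by (auto simp: v_def side_def)
  have u: "0 < u" using r by (simp add: u_def)
  have "real (nf k) * measure (gauss_rvec d) (hits d \<Lambda> K k y z) \<le>
      (2 * (G * exp (\<Lambda> * ?r))) * exp (\<Lambda> * ?r * (v - 2 * u) / u)"
    using nf_bounds[OF k] G_bounds hits_upper_bound[OF unit(1)[OF z] unit(2) \<Lambda>(1) r(1)]
    unfolding u_def v_def by (intro mult_mono) auto
  also have "\<dots> = 2 * G * exp (\<Lambda> * (?r * (v - (1 + ?r)) / (1 + ?r)))"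
  proof -
    have "\<Lambda> * ?r + \<Lambda> * ?r * (v - 2 * u) / u = \<Lambda> * (?r * (v - u) / u)"
      using u by (simp add: field_simps)
    then show ?thesis unfolding u_def[symmetric] by (simp add: mult_exp_exp)
  qed
  also have "\<dots> \<le> 2 * G * exp (\<Lambda> * (1 - \<beta>))"
  proof -
    have "\<Lambda> * (?r * (v - (1 + ?r)) / (1 + ?r)) \<le> \<Lambda> * (1 - \<beta>)"
      unfolding \<beta>_def u_def by (rule mult_left_mono[OF tangent_bound[OF r v] \<Lambda>(1)])
    then show ?thesis using G_bounds by (intro mult_left_mono) auto
  qed
  finally have main: "real (nf k) * measure (gauss_rvec d) (hits d \<Lambda> K k y z) \<le> 2 * G * exp (\<Lambda> * (1 - \<beta>))" .
  have "exp (\<Lambda> * (1 - \<beta>)) \<le> exp \<Lambda>" using \<Lambda> by (simp add: \<beta>_def mult_left_le)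
  then have "2 * G * exp (\<Lambda> * (1 - \<beta>)) \<le> 2 * G * exp \<Lambda>" using G_bounds by (intro mult_left_mono) auto
  with main show "real (nf k) * measure (gauss_rvec d) (hits d \<Lambda> K k y z) \<le> 2 * G * exp \<Lambda>" by linarith
  obtain x where x: "x \<in> set xs" "w k x = peak k" using peak_attained by blast
  have nz: "class_weight \<phi> K k (dotp d x y) \<noteq> 0" using x peak by (simp add: w_def)
  have topx: "peak k = exp (\<phi> (dotp d x y))"
    using x class_weight_eq[OF rho[OF x(1)] nz] by (simp add: w_def)
  have "\<phi> (dotp d x y) - \<phi> (dotp d z y) \<le> \<Lambda> * \<bar>dotp d x y - dotp d z y\<bar>"
    using lip[OF rho[OF x(1)] rho[OF z]] by linarith
  also have "\<bar>dotp d x y - dotp d z y\<bar> \<le> 1 / real K + \<beta>"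
  proof -
    have "\<bar>dotp d x y - dotp d z y\<bar> = \<bar>side K k * dotp d x y - side K k * dotp d z y\<bar>"
      by (simp add: side_def abs_minus_commute)
    also have "\<dots> \<le> \<bar>side K k * dotp d x y - ?r\<bar> + \<bar>?r - side K k * dotp d z y\<bar>" by simp
    also have "\<bar>?r - side K k * dotp d z y\<bar> = \<beta>" by (simp add: \<beta>_def u_def v_def abs_minus_commute)
    finally show ?thesis using class_weight_side[OF K_pos nz] by linarith
  qed
  also have "\<Lambda> * (1 / real K + \<beta>) \<le> 1 + \<Lambda> * \<beta>"
    using \<Lambda> K_pos by (simp add: distrib_left divide_le_eq)
  finally have ph: "\<phi> (dotp d x y) - \<phi> (dotp d z y) \<le> 1 + \<Lambda> * \<beta>"
    using \<Lambda> by (simp add: mult_left_mono)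
  have "exp (\<Lambda> * (1 - \<beta>)) \<le> exp (\<Lambda> + (1 + \<phi> (dotp d z y) - \<phi> (dotp d x y)))"
    using ph by (simp add: algebra_simps)
  also have "\<dots> = exp \<Lambda> * (exp 1 * exp (\<phi> (dotp d z y)) / peak k)"
    by (simp add: topx exp_add exp_diff)
  finally have "2 * G * exp (\<Lambda> * (1 - \<beta>)) \<le> 2 * G * (exp \<Lambda> * (exp 1 * exp (\<phi> (dotp d z y)) / peak k))"
    using G_bounds by (intro mult_left_mono) auto
  with main show "real (nf k) * measure (gauss_rvec d) (hits d \<Lambda> K k y z) \<le>
      2 * G * exp \<Lambda> * (exp 1 * exp (\<phi> (dotp d z y)) / peak k)" by (simp only: mult.assoc)
qed

text \<open>The heart of the time bound: the growth of the critical sample with peak / total is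
  cancelled by rarer collisions. If peak \<le> total, the first bound of
  \<open>false_positives\<close> suffices; otherwise the average of the second is proportional to
  total / peak.\<close>

lemma mean_false_positives:
  assumes k: "k < 2 * K + 1" and peak: "0 < peak k"
  shows "real (nf k) * ((\<Sum>i<n. measure (gauss_rvec d) (hits d \<Lambda> K k y (xs ! i))) / real n) * max 1 (peak k / total)
    \<le> 6 * G * exp \<Lambda>"
proof -
  let ?p = "\<lambda>z. measure (gauss_rvec d) (hits d \<Lambda> K k y z)"
  define S where "S = real (nf k) * ((\<Sum>i<n. ?p (xs ! i)) / real n)"
  have S: "S = (\<Sum>z\<in>set xs. real (nf k) * ?p z) / real n"
    unfolding S_def sum_list_set[of ?p] by (simp add: sum_distrib_left)
  have "(\<Sum>z\<in>set xs. real (nf k) * ?p z) \<le> (\<Sum>z\<in>set xs. 2 * G * exp \<Lambda>)"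
    by (intro sum_mono false_positives(1) k peak)
  then have 1: "S \<le> 2 * G * exp \<Lambda>"
    unfolding S using n_pos by (simp add: divide_le_eq distinct_card[OF dist] mult.commute)
  have "(\<Sum>z\<in>set xs. real (nf k) * ?p z) \<le>
      (\<Sum>z\<in>set xs. 2 * G * exp \<Lambda> * (exp 1 * exp (\<phi> (dotp d z y)) / peak k))"
    by (intro sum_mono false_positives(2) k peak)
  also have "\<dots> = 2 * G * exp \<Lambda> * (exp 1 / peak k) * (\<Sum>z\<in>set xs. exp (\<phi> (dotp d z y)))"
    by (simp add: sum_distrib_left mult.assoc)
  also have "(\<Sum>z\<in>set xs. exp (\<phi> (dotp d z y))) = real n * total"
    using n_pos by (simp add: total_def kernel_mean_def distinct_card[OF dist])
  finally have "S \<le> 2 * G * exp \<Lambda> * (exp 1 / peak k) * (real n * total) / real n"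
    unfolding S by (rule divide_right_mono) simp
  also have "\<dots> = 2 * G * exp \<Lambda> * exp 1 * (total / peak k)" using n_pos by simp
  finally have 2: "S \<le> 2 * G * exp \<Lambda> * exp 1 * (total / peak k)" .
  have e: "exp 1 \<le> (3 :: real)" by (rule exp_le)
  have C: "0 \<le> 2 * G * exp \<Lambda>" using G_bounds by simp
  have "S * max 1 (peak k / total) \<le> 2 * G * exp \<Lambda> * 3"
  proof (cases "peak k \<le> total")
    case True
    then have "max 1 (peak k / total) = 1" using total_pos by simp
    then show ?thesis using 1 C by simp
  next
    case False
    then have m: "max 1 (peak k / total) = peak k / total" using total_pos by (simp add: max_def)
    have "S * (peak k / total) \<le> 2 * G * exp \<Lambda> * exp 1 * (total / peak k) * (peak k / total)"
      by (rule mult_right_mono[OF 2]) (use peak total_pos in simp)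
    also have "\<dots> = 2 * G * exp \<Lambda> * exp 1" using peak total_pos by simp
    also have "\<dots> \<le> 2 * G * exp \<Lambda> * 3" using e C by (rule mult_left_mono)
    finally show ?thesis unfolding m .
  qed
  then show ?thesis by (simp add: S_def mult.commute mult.left_commute)
qed

section \<open>Probabilities of missed points, inaccurate samples and expensive scans\<close>

definition missed :: "rvec \<Rightarrow> nat \<Rightarrow> rvec stream set" where
  "missed x k = {gs \<in> space (gauss_stream d). \<forall>f<nf k. gs !! f \<notin> hits d \<Lambda> K k y x}"

text \<open>The expected number of catches is at least exp ((100 - 88) sqrt K), which exceeds ln (9
  n), so (1 - p)^N \<le> exp (- p N) for N filters is small enough for a union bound over all n data
  points.\<close>

lemma measure_missed:
  assumes k: "k < 2 * K + 1" and x: "x \<in> set xs" and "w k x \<noteq> 0"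
  shows "missed x k \<in> sets (gauss_stream d)" "measure (gauss_stream d) (missed x k) \<le> 1 / (9 * real n)"
proof -
  interpret G: prob_space "gauss_rvec d" by (rule prob_space_gauss_rvec)
  interpret SG: prob_space "gauss_stream d" by (rule prob_space_gauss_stream)
  show "missed x k \<in> sets (gauss_stream d)" unfolding missed_def by measurable
  let ?p = "measure (gauss_rvec d) (hits d \<Lambda> K k y x)" and ?q = "sqrt (real K)"
  have p: "exp (- \<Lambda> * radius K k - 88 * ?q) \<le> ?p"
    by (rule hits_lower_bound[OF unit(1)[OF x] unit(2) \<Lambda> K(1) k class_weight_side[OF K_pos]])
       (use assms(3) in \<open>simp add: w_def\<close>)
  have "exp (12 * ?q) = exp (- \<Lambda> * radius K k - 88 * ?q) * (G * exp (\<Lambda> * radius K k))"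
    unfolding G by (simp add: mult_exp_exp)
  also have "\<dots> \<le> ?p * real (nf k)"
    using p nf_bounds(1)[OF k] G_bounds by (intro mult_mono) auto
  finally have a: "exp (12 * ?q) \<le> ?p * real (nf k)" .
  have "ln (9 * real n) \<le> exp (12 * ?q)"
  proof -
    have e3: "9 \<le> exp (3 :: real)"
    proof -
      have "(5 / 2) ^ 3 \<le> exp (1 :: real) ^ 3"
        by (rule power_mono) (use exp_lower_Taylor_quadratic[of 1] in auto)
      then show ?thesis by (simp add: power3_eq_cube mult_exp_exp)
    qed
    have "ln (9 * real n) = ln 9 + ln (real n)" using n_pos by (simp add: ln_mult)
    also have "ln 9 \<le> ln (exp (3 :: real))" using e3 by (subst ln_le_cancel_iff) auto
    also have "ln (real n) \<le> ?q * ?q" using K by simp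
    also have "ln (exp 3) + ?q * ?q \<le> exp (12 * ?q)"
    proof -
      have "1 \<le> ?q" using K by simp
      moreover have "0 \<le> ?q * ?q" by simp
      moreover have "1 + 12 * ?q + 72 * (?q * ?q) \<le> exp (12 * ?q)"
        using exp_lower_Taylor_quadratic[of "12 * ?q"] by (simp add: power2_eq_square)
      ultimately show ?thesis unfolding ln_exp by linarith
    qed
    finally show ?thesis by simp
  qed
  then have "ln (9 * real n) \<le> ?p * real (nf k)" using a by linarith
  have "ennreal (measure (gauss_stream d) (missed x k)) = ennreal ((1 - ?p) ^ nf k)"
    unfolding missed_def SG.emeasure_eq_measure[symmetric] by (rule G.emeasure_stream_all_miss) measurable
  then have "measure (gauss_stream d) (missed x k) = (1 - ?p) ^ nf k"
    by (subst (asm) ennreal_inj) (auto simp: G.prob_le_1)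
  also have "\<dots> \<le> exp (- ?p) ^ nf k"
    using exp_ge_add_one_self[of "- ?p"] G.prob_le_1 by (intro power_mono) auto
  also have "\<dots> = exp (- (?p * real (nf k)))"
    by (simp add: exp_of_nat_mult[symmetric] mult.commute)
  also have "\<dots> \<le> exp (- ln (9 * real n))"
    using \<open>ln (9 * real n) \<le> ?p * real (nf k)\<close> by simp
  also have "\<dots> = 1 / (9 * real n)"
  proof -
    have "exp (ln (9 * real n)) = 9 * real n" by (rule exp_ln) (use n_pos in simp)
    then show ?thesis unfolding exp_minus by (simp only: inverse_eq_divide)
  qed
  finally show "measure (gauss_stream d) (missed x k) \<le> 1 / (9 * real n)" .
qed

definition err :: real where "err = \<epsilon> * total / (2 * real K + 1)"

definition inaccurate :: "nat \<Rightarrow> nat \<Rightarrow> real stream set" where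
  "inaccurate k i = {us \<in> space unif_stream.
     err < \<bar>(\<Sum>j<2 ^ i * B. sampled (w k) d xs (us !! j)) / real (2 ^ i * B) - mean k\<bar>}"

text \<open>Chebyshev with error \<epsilon> total / (2 K + 1), the share of one class. The level is
  such that peak \<le> 2^i total, so the total cancels and (2 K + 1)^2 / (B \<epsilon>^2)
  remains.\<close>

lemma measure_inaccurate:
  assumes \<epsilon>1: "\<epsilon> < 1" and k: "k < 2 * K + 1" and i: "peak k / total \<le> 2 ^ i"
  shows "inaccurate k i \<in> sets unif_stream"
    "measure unif_stream (inaccurate k i) \<le> (2 * real K + 1)\<^sup>2 / G"
proof -
  interpret U: prob_space unif by (rule prob_space_unif)
  show "inaccurate k i \<in> sets unif_stream" unfolding inaccurate_def by measurable
  let ?F = "sampled (w k) d xs" and ?L = "2 ^ i * B" and ?c = "2 * real K + 1"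
  have mean: "(\<integral>u. ?F u \<partial>unif) = mean k"
    unfolding mean_def by (rule expectation_sampled) (use n_pos w_nonneg in auto)
  have F: "0 \<le> ?F u" "?F u \<le> peak k" for u
    using pick_in_set[OF n_pos(2)] w_nonneg w_le_peak peak_nonneg by (auto simp: sampled_def)
  have err0: "0 < err" unfolding err_def using \<epsilon> total_pos by simp
  have "measure unif_stream (inaccurate k i) \<le> peak k * mean k / (real ?L * err\<^sup>2)"
    unfolding inaccurate_def mean[symmetric]
    by (rule U.stream_chebyshev[where F = ?F]) (use F err0 B_bounds[OF \<epsilon>1] in auto)
  also have "\<dots> \<le> (2 ^ i * total) * total / (real ?L * err\<^sup>2)"
  proof (intro divide_right_mono mult_mono)
    show "peak k \<le> 2 ^ i * total" using i total_pos by (simp add: divide_le_eq)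
    show "mean k \<le> total" by (rule mean_le_total) fact
  qed (use peak_nonneg mean_nonneg total_pos in auto)
  also have "\<dots> = ?c\<^sup>2 / (real B * (\<epsilon> * \<epsilon>))"
    using total_pos by (simp add: err_def power2_eq_square)
  also have "\<dots> \<le> ?c\<^sup>2 / G"
  proof (rule divide_left_mono)
    show "G \<le> real B * (\<epsilon> * \<epsilon>)"
      using B_bounds(1)[OF \<epsilon>1] \<epsilon> by (simp add: divide_le_eq)
  qed (use G_bounds B_bounds[OF \<epsilon>1] \<epsilon> in auto)
  finally show "measure unif_stream (inaccurate k i) \<le> ?c\<^sup>2 / G" .
qed

definition overfull :: "nat \<Rightarrow> nat \<Rightarrow> (real stream \<times> rvec stream) set" where
  "overfull k i = {\<omega> \<in> space (unif_stream \<Otimes>\<^sub>M gauss_stream d).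
     ennreal bud \<le> all_hits d \<Lambda> K k xs y (nf k) (2 ^ i * B) \<omega>}"

text \<open>Markov's inequality. Of the three factors G in the budget, one stands for the number of
  filters, one for the sample size, and the third makes the failure unlikely.\<close>

lemma measure_overfull:
  assumes \<epsilon>1: "\<epsilon> < 1" and k: "k < 2 * K + 1" and peak: "0 < peak k" and i: "2 ^ i \<le> 2 * max 1 (peak k / total)"
  shows "overfull k i \<in> sets (unif_stream \<Otimes>\<^sub>M gauss_stream d)"
    "measure (unif_stream \<Otimes>\<^sub>M gauss_stream d) (overfull k i) \<le> 24 / G"
proof -
  show "overfull k i \<in> sets (unif_stream \<Otimes>\<^sub>M gauss_stream d)" unfolding overfull_def by measurable
  let ?avg = "(\<Sum>i<n. measure (gauss_rvec d) (hits d \<Lambda> K k y (xs ! i))) / real n"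
  define Z where "Z = real (nf k) * ?avg"
  have Z0: "0 \<le> Z" unfolding Z_def by (intro mult_nonneg_nonneg divide_nonneg_nonneg sum_nonneg) simp_all
  have bud0: "0 < bud" using G_bounds \<epsilon> by (simp add: bud)
  have "measure (unif_stream \<Otimes>\<^sub>M gauss_stream d) (overfull k i)
      \<le> real (nf k) * real (2 ^ i * B) * ?avg / bud"
    unfolding overfull_def by (rule measure_all_hits_ge) (use n_pos bud0 in auto)
  also have "\<dots> = Z * (2 ^ i * real B) / bud" by (simp add: Z_def)
  also have "\<dots> \<le> Z * ((2 * max 1 (peak k / total)) * (2 * (G / (\<epsilon> * \<epsilon>)))) / bud"
    using i B_bounds[OF \<epsilon>1] Z0 bud0 by (intro divide_right_mono mult_left_mono mult_mono) auto
  also have "\<dots> = (Z * max 1 (peak k / total)) * (4 * (G / (\<epsilon> * \<epsilon>))) / bud" by simp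
  also have "\<dots> \<le> (6 * G * exp \<Lambda>) * (4 * (G / (\<epsilon> * \<epsilon>))) / bud"
    using mean_false_positives[OF k peak] bud0 G_bounds \<epsilon> unfolding Z_def
    by (intro divide_right_mono mult_right_mono) auto
  also have "\<dots> = 24 / G"
    using G_bounds \<epsilon> by (simp add: bud)
  finally show "measure (unif_stream \<Otimes>\<^sub>M gauss_stream d) (overfull k i) \<le> 24 / G" .
qed

text \<open>The critical sample size: larger samples are accurate, and this one is scanned within the
  budget.\<close>

definition first_level :: "nat \<Rightarrow> nat" where
  "first_level k = (LEAST i. max 1 (peak k / total) \<le> 2 ^ i)"

text \<open>Minimality bounds the critical power of two by twice the required size; with
  \<open>peak_le\<close> it stays below 2 n, where the loop over the levels ends.\<close>

lemma first_level:
  assumes "k < 2 * K + 1"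
  shows "first_level k \<le> i \<Longrightarrow> peak k / total \<le> 2 ^ i"
    and "2 ^ first_level k \<le> 2 * max 1 (peak k / total)"
    and "2 ^ first_level k < 2 * n"
proof -
  let ?m = "max 1 (peak k / total)"
  obtain i0 where "?m < 2 ^ i0" using real_arch_pow[of 2 ?m] by auto
  then have "?m \<le> 2 ^ i0" by (rule less_imp_le)
  then have ge: "?m \<le> 2 ^ first_level k" unfolding first_level_def by (rule LeastI)
  show "peak k / total \<le> 2 ^ i" if "first_level k \<le> i"
  proof -
    have "(2 :: real) ^ first_level k \<le> 2 ^ i" using that by (intro power_increasing) auto
    then show ?thesis using ge by (meson max.bounded_iff order.trans)
  qed
  have lt: "2 ^ first_level k < 2 * ?m"
  proof (cases "first_level k")
    case (Suc i)
    have "\<not> ?m \<le> 2 ^ i" using not_less_Least[of i "\<lambda>i. ?m \<le> 2 ^ i"] Suc unfolding first_level_def by simp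
    then show ?thesis using Suc by simp
  qed simp
  then show "2 ^ first_level k \<le> 2 * ?m" by simp
  have "peak k / total \<le> real n"
  proof -
    have "peak k \<le> real n * total"
      using peak_le[of k] mean_le_total[OF assms] n_pos by (meson mult_left_mono order.trans less_imp_le)
    then show ?thesis using total_pos by (simp add: divide_le_eq)
  qed
  moreover have "1 \<le> real n" using len by simp
  ultimately have "?m \<le> real n" by simp
  with lt have "real (2 ^ first_level k) < real (2 * n)"
    unfolding of_nat_mult of_nat_numeral of_nat_power by linarith
  then show "2 ^ first_level k < 2 * n" by (simp only: of_nat_less_iff)
qed

definition level_count :: nat where
  "level_count = (LEAST J. 2 * n \<le> 2 ^ J)"

lemma level_count_le: "level_count \<le> 4 * K"
  unfolding level_count_def by (rule least_doubling_le) (use len K in auto)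

lemma first_level_less: "k < 2 * K + 1 \<Longrightarrow> first_level k < level_count"
proof -
  assume "k < 2 * K + 1"
  then have "2 ^ first_level k < 2 * n" by (rule first_level)
  also have "2 * n \<le> 2 ^ level_count"
    unfolding level_count_def by (rule LeastI[of _ "2 * n"]) (simp add: less_imp_le)
  finally show ?thesis by simp
qed

definition cls :: "rvec \<Rightarrow> nat" where
  "cls x = nat \<lfloor>(1 + dotp d x y) * real K\<rfloor>"

lemma cls: assumes "x \<in> set xs" shows "cls x < 2 * K + 1" "w (cls x) x \<noteq> 0" "w k x \<noteq> 0 \<Longrightarrow> k = cls x"
proof -
  note c = sum_class_weight[OF rho[OF assms] K_pos]
  show "cls x < 2 * K + 1" unfolding cls_def by (rule c(3))
  show "w (cls x) x \<noteq> 0" unfolding cls_def w_def c(2) by (rule exp_not_eq_zero)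
  show "k = cls x" if "w k x \<noteq> 0" using that unfolding cls_def w_def by (rule c(4))
qed

text \<open>The union is over the data set, not over the samples drawn. The event thus concerns the
  filters only and covers all levels at once.\<close>

definition bad_recall :: "(real stream \<times> rvec stream) set" where
  "bad_recall = (\<Union>x\<in>set xs. space unif_stream \<times> missed x (cls x))"

text \<open>One level per class: only the critical scan has to complete.\<close>

definition bad_cost :: "(real stream \<times> rvec stream) set" where
  "bad_cost = (\<Union>k\<in>{k. k < 2 * K + 1 \<and> 0 < peak k}. overfull k (first_level k))"

text \<open>Every level from the critical one on is included, since any of them may be the last to
  complete.\<close>

definition bad_sample :: "(real stream \<times> rvec stream) set" where
  "bad_sample = (\<Union>(k, i)\<in>{(k, i). k < 2 * K + 1 \<and> first_level k \<le> i \<and> i < level_count}.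
     inaccurate k i \<times> space (gauss_stream d))"

definition bad_tape :: "nat \<Rightarrow> (real stream \<times> rvec stream) set" where
  "bad_tape M = {us \<in> space unif_stream. \<exists>j<M. \<not> (0 \<le> us !! j \<and> us !! j < 1)} \<times> space (gauss_stream d)"

lemma measure_bad_recall:
  "bad_recall \<in> sets (unif_stream \<Otimes>\<^sub>M gauss_stream d)"
  "measure (unif_stream \<Otimes>\<^sub>M gauss_stream d) bad_recall \<le> 1 / 9"
proof -
  interpret SU: prob_space unif_stream by (rule prob_space_unif_stream)
  interpret SG: prob_space "gauss_stream d" by (rule prob_space_gauss_stream)
  interpret P: pair_prob_space unif_stream "gauss_stream d" ..
  let ?A = "\<lambda>x. space unif_stream \<times> missed x (cls x)"
  have m: "?A x \<in> P.events" if "x \<in> set xs" for x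
    using measure_missed(1)[OF cls(1) that cls(2)] that by auto
  then show "bad_recall \<in> P.events" unfolding bad_recall_def by auto
  have "P.prob bad_recall \<le> (\<Sum>x\<in>set xs. P.prob (?A x))"
    unfolding bad_recall_def by (rule P.finite_measure_subadditive_finite) (use m in auto)
  also have "\<dots> \<le> (\<Sum>x\<in>set xs. 1 / (9 * real n))"
    using measure_missed[OF cls(1) _ cls(2)] by (intro sum_mono) (simp add: measure_snd_event)
  also have "\<dots> = 1 / 9" using n_pos by (simp add: distinct_card[OF dist])
  finally show "P.prob bad_recall \<le> 1 / 9" .
qed

lemma measure_bad_cost:
  assumes "\<epsilon> < 1"
  shows "bad_cost \<in> sets (unif_stream \<Otimes>\<^sub>M gauss_stream d)"
    "measure (unif_stream \<Otimes>\<^sub>M gauss_stream d) bad_cost \<le> 1 / 9"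
proof -
  interpret SU: prob_space unif_stream by (rule prob_space_unif_stream)
  interpret SG: prob_space "gauss_stream d" by (rule prob_space_gauss_stream)
  interpret P: pair_prob_space unif_stream "gauss_stream d" ..
  let ?A = "\<lambda>k. overfull k (first_level k)" and ?I = "{k. k < 2 * K + 1 \<and> 0 < peak k}"
  have m: "?A k \<in> P.events" "P.prob (?A k) \<le> 24 / G" if "k \<in> ?I" for k
  proof -
    have k: "k < 2 * K + 1" "0 < peak k" using that by (simp_all only: mem_Collect_eq)
    show "?A k \<in> P.events" "P.prob (?A k) \<le> 24 / G"
      by (rule measure_overfull[OF assms k first_level(2)[OF k(1)]])+
  qed
  have fin: "finite ?I" by (rule finite_subset[of _ "{..<2 * K + 1}"]) auto
  show "bad_cost \<in> P.events" unfolding bad_cost_def using m(1) fin by (intro sets.finite_UN) auto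
  have "P.prob bad_cost \<le> (\<Sum>k\<in>?I. P.prob (?A k))"
    unfolding bad_cost_def by (rule P.finite_measure_subadditive_finite) (use m fin in auto)
  also have "\<dots> \<le> (\<Sum>k\<in>?I. 24 / G)" by (intro sum_mono m(2))
  also have "\<dots> \<le> (\<Sum>k<2 * K + 1. 24 / G)"
    by (rule sum_mono2) (use G_bounds in auto)
  also have "\<dots> \<le> 1 / 9"
    using G_bounds by (simp add: divide_le_eq)
  finally show "P.prob bad_cost \<le> 1 / 9" .
qed

lemma measure_bad_sample:
  assumes "\<epsilon> < 1"
  shows "bad_sample \<in> sets (unif_stream \<Otimes>\<^sub>M gauss_stream d)"
    "measure (unif_stream \<Otimes>\<^sub>M gauss_stream d) bad_sample \<le> 1 / 9"
proof -
  interpret SU: prob_space unif_stream by (rule prob_space_unif_stream)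
  interpret SG: prob_space "gauss_stream d" by (rule prob_space_gauss_stream)
  interpret P: pair_prob_space unif_stream "gauss_stream d" ..
  let ?I = "{(k, i). k < 2 * K + 1 \<and> first_level k \<le> i \<and> i < level_count}"
  let ?J = "{..<2 * K + 1} \<times> {..<4 * K}" and ?c = "2 * real K + 1"
  define A where "A = (\<lambda>(k, i). inaccurate k i \<times> space (gauss_stream d))"
  have sub: "?I \<subseteq> ?J" using level_count_le by auto
  then have fin: "finite ?I" by (rule finite_subset) simp
  have m: "A p \<in> P.events" "P.prob (A p) \<le> ?c\<^sup>2 / G" if p: "p \<in> ?I" for p
  proof -
    obtain k i where ki: "p = (k, i)" "k < 2 * K + 1" "peak k / total \<le> 2 ^ i"
      using p first_level(1) by fastforce
    then show "A p \<in> P.events" "P.prob (A p) \<le> ?c\<^sup>2 / G"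
      using measure_inaccurate[OF assms ki(2,3)] by (auto simp: A_def measure_fst_event)
  qed
  have eq: "bad_sample = (\<Union>p\<in>?I. A p)" unfolding bad_sample_def A_def by (simp add: case_prod_beta)
  show "bad_sample \<in> P.events" unfolding eq using m(1) fin by (intro sets.finite_UN) auto
  have "P.prob bad_sample \<le> (\<Sum>p\<in>?I. P.prob (A p))"
    unfolding eq by (rule P.finite_measure_subadditive_finite) (use m fin in auto)
  also have "\<dots> \<le> (\<Sum>p\<in>?I. ?c\<^sup>2 / G)" by (intro sum_mono m(2))
  also have "\<dots> \<le> (\<Sum>p\<in>?J. ?c\<^sup>2 / G)"
    by (rule sum_mono2[OF _ sub]) (use G_bounds in auto)
  also have "\<dots> = (4 * real K) * ?c ^ 3 / G"
    by (simp add: card_cartesian_product power2_eq_square power3_eq_cube algebra_simps)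
  also have "\<dots> \<le> 1 / 9"
    using G_big G_bounds by (subst pos_divide_le_eq) auto
  finally show "P.prob bad_sample \<le> 1 / 9" .
qed

lemma measure_bad_tape:
  "bad_tape M \<in> sets (unif_stream \<Otimes>\<^sub>M gauss_stream d)"
  "measure (unif_stream \<Otimes>\<^sub>M gauss_stream d) (bad_tape M) = 0"
proof -
  interpret U: prob_space unif by (rule prob_space_unif)
  interpret SU: prob_space unif_stream by (rule prob_space_unif_stream)
  let ?N = "{us \<in> space unif_stream. \<exists>j<M. \<not> (0 \<le> us !! j \<and> us !! j < 1)}"
  have m: "?N \<in> sets unif_stream" by measurable
  then show "bad_tape M \<in> sets (unif_stream \<Otimes>\<^sub>M gauss_stream d)" unfolding bad_tape_def by (rule pair_measureI[OF _ sets.top])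
  have "AE us in unif_stream. stream_all (\<lambda>u. 0 \<le> u \<and> u < 1) us"
    by (rule U.AE_stream_all[OF _ AE_unif]) measurable
  then have "AE us in unif_stream. us \<notin> ?N"
    by eventually_elim (auto simp: stream_all_def)
  then have "measure unif_stream ?N = 0"
    by (subst SU.prob_eq_0[OF m]) simp
  then show "measure (unif_stream \<Otimes>\<^sub>M gauss_stream d) (bad_tape M) = 0"
    unfolding bad_tape_def by (simp only: measure_fst_event[OF m])
qed

definition good :: "nat \<Rightarrow> (real stream \<times> rvec stream) set" where
  "good M = space (unif_stream \<Otimes>\<^sub>M gauss_stream d) - (bad_recall \<union> bad_cost \<union> bad_sample \<union> bad_tape M)"

lemma measure_good:
  assumes "\<epsilon> < 1"
  shows "good M \<in> sets (tapes d)" "2 / 3 \<le> measure (tapes d) (good M)"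
proof -
  interpret SU: prob_space unif_stream by (rule prob_space_unif_stream)
  interpret SG: prob_space "gauss_stream d" by (rule prob_space_gauss_stream)
  interpret P: pair_prob_space unif_stream "gauss_stream d" ..
  note m = measure_bad_recall measure_bad_cost[OF assms] measure_bad_sample[OF assms] measure_bad_tape[of M]
  define Bd where "Bd = bad_recall \<union> bad_cost \<union> bad_sample \<union> bad_tape M"
  have Bm: "Bd \<in> P.events" unfolding Bd_def by (intro sets.Un m(1) m(3) m(5) m(7))
  have "P.prob Bd \<le> P.prob bad_recall + P.prob bad_cost + P.prob bad_sample + P.prob (bad_tape M)"
    unfolding Bd_def
    using measure_Un_le[OF m(1) m(3)] measure_Un_le[OF sets.Un[OF m(1) m(3)] m(5)]
      measure_Un_le[OF sets.Un[OF sets.Un[OF m(1) m(3)] m(5)] m(7)] by linarith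
  \<comment> \<open>One ninth each for recall, cost and sampling; the tape event is null.\<close>
  also have "\<dots> \<le> 1 / 3" using m by linarith
  finally have "P.prob Bd \<le> 1 / 3" .
  then show "good M \<in> sets (tapes d)" "2 / 3 \<le> measure (tapes d) (good M)"
    unfolding tapes_eq good_def Bd_def[symmetric] using P.prob_compl[OF Bm] Bm by simp_all
qed

lemma good_answer:
  assumes \<epsilon>1: "\<epsilon> < 1" and M: "M = 2 * n * B" and \<omega>: "\<omega> \<in> good M"
  shows "\<bar>search.answer \<phi> d n K B G \<Lambda> bud (\<lambda>f. snd \<omega> !! f) (\<lambda>j. pick d xs (fst \<omega> !! j)) y - total\<bar> \<le> \<epsilon> * total"
proof -
  define us gs where "us = fst \<omega>" and "gs = snd \<omega>"
  interpret S: search \<phi> d n K N B M G \<Lambda> bud "\<lambda>f. gs !! f" "\<lambda>j. pick d xs (us !! j)" y for N .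
  have \<omega>': "\<omega> = (us, gs)" by (simp add: us_def gs_def)
  have sp: "us \<in> space unif_stream" "gs \<in> space (gauss_stream d)"
    and bad: "\<omega> \<notin> bad_recall" "\<omega> \<notin> bad_cost" "\<omega> \<notin> bad_sample" "\<omega> \<notin> bad_tape M"
    using \<omega> by (auto simp: good_def \<omega>' space_pair_measure)
  have nf: "S.nfilters k = nf k" for k by (simp add: S.nfilters_def nf_def)
  have nl: "S.nlevels = level_count" by (simp add: S.nlevels_def level_count_def)
  have u: "0 \<le> us !! j" "us !! j < 1" if "j < M" for j
    using bad(4) sp that by (auto simp: bad_tape_def \<omega>')
  have sm: "pick d xs (us !! j) \<in> set xs" if "j < M" for j
    using pick_in_set[OF n_pos(2) u[OF that]] .
  have wt: "S.weight k j = w k (pick d xs (us !! j))" for k j by (simp add: S.weight_def w_def)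
  have g: "gs !! f \<in> space (gauss_rvec d)" for f
    using sp(2) unfolding space_stream_space by (rule snth_in)
  have hit: "gs !! f \<in> hits d \<Lambda> K k y x \<longleftrightarrow> passes \<Lambda> K k (dotp d (gs !! f) x) \<and> S.ypass k f" for k f x
    using g by (simp add: hits_def S.ypass_def)
  have recall: "\<exists>f<S.nfilters k. S.ypass k f \<and> passes \<Lambda> K k (dotp d (gs !! f) (pick d xs (us !! j)))"
    if "j < M" "S.weight k j \<noteq> 0" for k j
  proof -
    let ?x = "pick d xs (us !! j)"
    have k: "k = cls ?x" using cls(3)[OF sm[OF that(1)]] that(2) by (simp add: wt)
    have "gs \<notin> missed ?x (cls ?x)" using bad(1) sp sm[OF that(1)] by (auto simp: bad_recall_def \<omega>')
    then show ?thesis unfolding nf using sp(2) hit k by (auto simp: missed_def)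
  qed
  have LM: "2 ^ i * B \<le> M" if "i < level_count" for i
    unfolding M by (rule mult_right_mono) (use S.nlevels_less[of i] that nl in auto)
  have est: "S.est k (2 ^ i) = (\<Sum>j<2 ^ i * B. w k (pick d xs (us !! j))) / real (2 ^ i * B)"
    if "i < level_count" for k i
    unfolding wt[symmetric]
  proof (rule S.est_eq_average)
    fix j assume j: "j < 2 ^ i * B" and nz: "S.weight k j \<noteq> 0"
    have "j < M" using j LM[OF that] by (rule less_le_trans)
    then show "\<exists>f<S.nfilters k. S.ypass k f \<and> passes \<Lambda> K k (dotp d (gs !! f) (pick d xs (us !! j)))"
      using nz by (rule recall)
  qed
  have per_class: "\<bar>S.lastval k level_count - mean k\<bar> \<le> err" if k: "k < 2 * K + 1" for k
  proof (cases "peak k = 0")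
    \<comment> \<open>No data point lies in the class, and the cost bound does not apply. Every
      estimate is 0, so the value is right whichever scans complete.\<close>
    case True
    then have z: "w k x = 0" if "x \<in> set xs" for x using w_le_peak[OF that, of k] w_nonneg[of k x] by simp
    have "mean k = 0" by (simp add: mean_def z)
    moreover have "S.lastval k level_count = 0"
    proof (rule S.lastval_zero)
      fix i assume i: "i < level_count"
      have "(\<Sum>j<2 ^ i * B. w k (pick d xs (us !! j))) = 0"
        by (rule sum.neutral) (use LM[OF i] z sm in auto)
      then show "S.est k (2 ^ i) = 0" using est[OF i] by simp
    qed
    moreover have "0 \<le> err" using \<epsilon> total_pos by (simp add: err_def)
    ultimately show ?thesis by simp
  next
    case False
    then have peak: "0 < peak k" using peak_nonneg[of k] by simp
    have "real (S.scan_cost k (S.nfilters k) (2 ^ first_level k * B)) < bud"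
    proof -
      have "\<omega> \<notin> overfull k (first_level k)" using bad(2) k peak by (auto simp: bad_cost_def)
      then have "all_hits d \<Lambda> K k xs y (nf k) (2 ^ first_level k * B) \<omega> < ennreal bud"
        using sp by (simp add: overfull_def \<omega>' space_pair_measure not_le)
      also have "all_hits d \<Lambda> K k xs y (nf k) (2 ^ first_level k * B) \<omega> =
          ennreal (real (S.scan_cost k (nf k) (2 ^ first_level k * B)))"
      proof -
        have ind: "indicator (hits d \<Lambda> K k y (pick d xs (us !! j))) (gs !! f) =
            ennreal (of_bool (passes \<Lambda> K k (dotp d (gs !! f) (pick d xs (us !! j))) \<and> S.ypass k f))" for f j
          using hit by (simp add: indicator_def)
        have "all_hits d \<Lambda> K k xs y (nf k) (2 ^ first_level k * B) \<omega> =
          (\<Sum>f<nf k. \<Sum>j<2 ^ first_level k * B.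
            ennreal (of_bool (passes \<Lambda> K k (dotp d (gs !! f) (pick d xs (us !! j))) \<and> S.ypass k f)))"
          unfolding all_hits_def us_def[symmetric] gs_def[symmetric] ind ..
        also have "\<dots> = (\<Sum>f<nf k. ennreal (\<Sum>j<2 ^ first_level k * B.
            of_bool (passes \<Lambda> K k (dotp d (gs !! f) (pick d xs (us !! j))) \<and> S.ypass k f)))"
          by (intro sum.cong refl sum_ennreal) simp
        also have "\<dots> = ennreal (\<Sum>f<nf k. \<Sum>j<2 ^ first_level k * B.
            of_bool (passes \<Lambda> K k (dotp d (gs !! f) (pick d xs (us !! j))) \<and> S.ypass k f))"
          by (intro sum_ennreal sum_nonneg) simp
        finally show ?thesis unfolding S.real_scan_cost .
      qed
      finally show ?thesis unfolding nf by (simp add: ennreal_less_iff)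
    qed
    moreover have "\<bar>S.est k (2 ^ i) - mean k\<bar> \<le> err" if i: "first_level k \<le> i" "i < level_count" for i
    proof -
      have "us \<notin> inaccurate k i" using bad(3) k i sp by (auto simp: bad_sample_def \<omega>')
      then have "\<bar>(\<Sum>j<2 ^ i * B. sampled (w k) d xs (us !! j)) / real (2 ^ i * B) - mean k\<bar> \<le> err"
        using sp by (simp add: inaccurate_def)
      moreover have "(\<Sum>j<2 ^ i * B. sampled (w k) d xs (us !! j)) = (\<Sum>j<2 ^ i * B. w k (pick d xs (us !! j)))"
        using LM[OF i(2)] u by (intro sum.cong refl) (simp add: sampled_def)
      ultimately show ?thesis unfolding est[OF i(2)] by (simp only:)
    qed
    ultimately show ?thesis by (intro S.lastval_accurate[OF first_level_less[OF k]]) auto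
  qed
  have "\<bar>S.answer - total\<bar> = \<bar>\<Sum>k<2 * K + 1. (S.lastval k level_count - mean k)\<bar>"
    unfolding S.answer_def nl sum_mean[symmetric] sum_subtractf ..
  also have "\<dots> \<le> (\<Sum>k<2 * K + 1. \<bar>S.lastval k level_count - mean k\<bar>)" by (rule sum_abs)
  also have "\<dots> \<le> (\<Sum>k<2 * K + 1. err)" by (intro sum_mono per_class) simp
  also have "\<dots> = (2 * real K + 1) * err" by (simp add: algebra_simps)
  also have "\<dots> = \<epsilon> * total"
  proof -
    have "c * (z / c) = z" if "c \<noteq> 0" for c z :: real using that by simp
    then show ?thesis unfolding err_def by (smt (verit) of_nat_0_le_iff)
  qed
  finally show ?thesis unfolding us_def gs_def .
qed

end

section \<open>Resource bounds\<close>

text \<open>The Lipschitz inequalities are closed conditions on L, so the infimum of all admissible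
  L satisfies them; this makes the \<open>LEAST\<close> over the reals meaningful.\<close>

lemma lipschitz_const_attained:
  assumes "\<exists>L. L-lipschitz_on S f"
  shows "(lipschitz_const S f)-lipschitz_on S f"
proof -
  define A where "A = {L. L-lipschitz_on S f}"
  have ne: "A \<noteq> {}" using assms by (auto simp: A_def)
  have nonneg: "0 \<le> L" if "L \<in> A" for L using that lipschitz_on_nonneg by (auto simp: A_def)
  then have bdd: "bdd_below A" by (rule bdd_belowI)
  have "(Inf A)-lipschitz_on S f"
  proof (rule lipschitz_onI)
    show "0 \<le> Inf A" using ne nonneg by (rule cInf_greatest)
    fix x y assume xy: "x \<in> S" "y \<in> S"
    have L: "dist (f x) (f y) \<le> L * dist x y" if "L \<in> A" for L
      using that xy by (auto simp: A_def intro: lipschitz_onD)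
    show "dist (f x) (f y) \<le> Inf A * dist x y"
    proof (cases "dist x y = 0")
      case True
      then show ?thesis using L ne by auto
    next
      case False
      then have pos: "0 < dist x y" by simp
      have "dist (f x) (f y) / dist x y \<le> Inf A"
        by (rule cInf_greatest[OF ne]) (use L pos in \<open>simp add: pos_divide_le_eq\<close>)
      then show ?thesis using pos by (simp add: pos_divide_le_eq)
    qed
  qed
  then have "Inf A \<in> A" by (simp add: A_def)
  then have "(LEAST L. L-lipschitz_on S f) = Inf A"
    by (intro Least_equality) (auto simp: A_def intro: cInf_lower[OF _ bdd[unfolded A_def]])
  then show ?thesis using \<open>Inf A \<in> A\<close> by (simp add: lipschitz_const_def A_def)
qed

text \<open>Every term is a constant times at most G^3 n E / \<epsilon>^2: one G from the filters,
  one from B, one from the number of classes. The other G^3 absorb the constants. The 6 is the cost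
  of the conditional in \<open>pre_prog\<close>.\<close>

lemma build_cost_bounds:
  fixes n K N B M :: nat and G E \<epsilon> :: real
  assumes n: "1 \<le> n" and G: "3000 \<le> G" "2 * real K + 1 \<le> G" and E: "1 \<le> E" and \<epsilon>: "0 < \<epsilon>" "\<epsilon> < 1"
    and N: "real N \<le> 2 * (G * E)" and B: "real B \<le> 2 * (G / (\<epsilon> * \<epsilon>))" and M: "M = 2 * n * B"
  shows "real (pre_time K N B M) + 6 \<le> G ^ 6 * (real n * E / (\<epsilon> * \<epsilon>))"
    "real (list_base M ((2 * K + 1) * N)) \<le> G ^ 6 * (real n * E / (\<epsilon> * \<epsilon>))"
proof -
  define I where "I = 1 / (\<epsilon> * \<epsilon>)"
  define R where "R = real n * E * I"
  have "\<epsilon> * \<epsilon> \<le> 1 * 1" using \<epsilon> by (intro mult_mono) auto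
  then have I: "1 \<le> I" using \<epsilon> unfolding I_def by (subst pos_le_divide_eq) auto
  have nE: "1 \<le> real n * E" using mult_mono[of 1 "real n" 1 E] n E by simp
  have R: "1 \<le> R" unfolding R_def using mult_mono[of 1 "real n * E" 1 I] nE I by simp
  have IR: "I \<le> R" unfolding R_def using mult_right_mono[OF nE, of I] I by simp
  have ER: "E \<le> R"
  proof -
    have "1 \<le> real n * I" using mult_mono[of 1 "real n" 1 I] n I by simp
    then have "1 * E \<le> (real n * I) * E" using E by (intro mult_right_mono) auto
    then show ?thesis by (simp add: R_def ac_simps)
  qed
  have G1: "1 \<le> G" using G by simp
  have "real K \<le> G" using G by simp
  have NR: "real N \<le> 2 * (G * R)"
    using N mult_left_mono[OF ER, of G] G1 by linarith
  have BI: "real B \<le> 2 * (G * I)" using B by (simp add: I_def)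
  have BR: "real B \<le> 2 * (G * R)" using BI mult_left_mono[OF IR, of G] G1 by linarith
  have Mreal: "real M = 2 * real n * real B" by (simp add: M)
  have "real M \<le> 2 * real n * (2 * (G * I))" unfolding Mreal using BI by (intro mult_left_mono) auto
  then have MI: "real M \<le> 4 * G * (real n * I)" by (simp add: ac_simps)
  have "real n * I \<le> R"
    using mult_left_mono[OF E, of "real n * I"] I by (simp add: R_def ac_simps)
  then have MR: "real M \<le> 4 * (G * R)" using MI mult_left_mono[of "real n * I" R G] G1 by linarith
  have "real N * real M \<le> (2 * (G * E)) * (4 * G * (real n * I))"
    using N MI G1 E I by (intro mult_mono) auto
  also have "\<dots> = 8 * (G * G * R)" by (simp add: R_def ac_simps)
  finally have NM: "real N * real M \<le> 8 * (G * G * R)" .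
  have g1: "G \<le> G * R" using mult_left_mono[OF R, of G] G1 by simp
  have g2: "G * R \<le> G * G * R" using mult_right_mono[OF G1, of "G * R"] G1 R by (simp add: mult.assoc)
  have g3: "G * G * R \<le> G * G * G * R" using mult_right_mono[OF G1, of "G * G * R"] G1 R by (simp add: mult.assoc)
  have g0: "1 \<le> G * R" using g1 G1 by linarith
  define W where "W = real N * (real M * 200 + 40) + 50"
  have W: "W \<le> 1730 * (G * G * R)"
  proof -
    have "W = 200 * (real N * real M) + 40 * real N + 50" by (simp add: W_def algebra_simps)
    then show ?thesis using NM NR g0 g2 by linarith
  qed
  have W0: "0 \<le> W" by (simp add: W_def)
  have "(2 * real K + 1) * W \<le> G * (1730 * (G * G * R))"
    using G W W0 G1 by (intro mult_mono) auto
  then have KW: "(2 * real K + 1) * W \<le> 1730 * (G * G * G * R)" by (simp add: ac_simps)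
  have big: "2500 * (G * G * G * R) \<le> G ^ 6 * R"
  proof -
    have "1 \<le> G * G" using mult_mono[of 1 G 1 G] G1 by simp
    then have "2500 * 1 \<le> G * (G * G)" using G by (intro mult_mono) auto
    then have "2500 * (G * G * G * R) \<le> (G * (G * G)) * (G * G * G * R)"
      using G1 R by (intro mult_right_mono) auto
    also have "\<dots> = G ^ 6 * R" by (simp add: eval_nat_numeral)
    finally show ?thesis .
  qed
  have RI: "real n * E / (\<epsilon> * \<epsilon>) = R" by (simp add: R_def I_def)
  have "real (pre_time K N B M) = real K * 16 + real N * 30 + real B * 20 + real M * 40 + (2 * real K + 1) * W + 400"
    by (simp add: pre_time_def W_def algebra_simps)
  then show "real (pre_time K N B M) + 6 \<le> G ^ 6 * (real n * E / (\<epsilon> * \<epsilon>))"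
    unfolding RI using \<open>real K \<le> G\<close> NR BR MR KW g0 g1 g2 g3 big by linarith
  have "real N * (real M + 1) \<le> 10 * (G * G * R)"
  proof -
    have "real N * (real M + 1) = real N * real M + real N" by (simp add: algebra_simps)
    then show ?thesis using NM NR g2 by linarith
  qed
  then have "(2 * real K + 1) * (real N * (real M + 1)) \<le> G * (10 * (G * G * R))"
    by (rule mult_mono[OF G(2)]) (use G1 in auto)
  then have "(2 * real K + 1) * (real N * (real M + 1)) \<le> 10 * (G * G * G * R)" by (simp add: ac_simps)
  moreover have "real (list_base M ((2 * K + 1) * N)) = 20 + real M + (2 * real K + 1) * (real N * (real M + 1))"
    by (simp add: list_base_def algebra_simps)
  ultimately show "real (list_base M ((2 * K + 1) * N)) \<le> G ^ 6 * (real n * E / (\<epsilon> * \<epsilon>))"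
    unfolding RI using MR g0 g2 g3 big by linarith
qed

text \<open>The budget carries G^3, the levels and the classes one G each; the sixth G absorbs the
  constants.\<close>

lemma query_cost_bound:
  fixes K N J :: nat and G E \<epsilon> :: real
  assumes G: "3000 \<le> G" "2 * real K + 1 \<le> G" "real J \<le> G" and E: "1 \<le> E" and \<epsilon>: "0 < \<epsilon>" "\<epsilon> < 1"
    and N: "real N \<le> 2 * (G * E)" and bud: "bud = G * (G * G) * E / (\<epsilon> * \<epsilon>)"
  shows "real ((2 * K + 1) * (J * (N * 300 + nat \<lceil>bud\<rceil> * 300 + 300) + 300) + 300) + 6 \<le> G ^ 6 * (E / (\<epsilon> * \<epsilon>))"
proof -
  define R where "R = E / (\<epsilon> * \<epsilon>)"
  have "\<epsilon> * \<epsilon> \<le> 1 * 1" using \<epsilon> by (intro mult_mono) auto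
  then have "1 \<le> 1 / (\<epsilon> * \<epsilon>)" using \<epsilon> by (subst pos_le_divide_eq) auto
  then have "E * 1 \<le> E * (1 / (\<epsilon> * \<epsilon>))" using E by (intro mult_left_mono) auto
  then have ER: "E \<le> R" by (simp add: R_def)
  then have R: "1 \<le> R" using E by linarith
  have G1: "1 \<le> G" using G by simp
  have NR: "real N \<le> 2 * (G * R)"
    using N mult_left_mono[OF ER, of G] G1 by linarith
  have g1: "G \<le> G * R" using mult_left_mono[OF R, of G] G1 by simp
  have g2: "G * R \<le> G * (G * R)" using mult_right_mono[OF G1, of "G * R"] G1 R by simp
  have g3: "G * (G * R) \<le> G * (G * (G * R))" using mult_right_mono[OF G1, of "G * (G * R)"] G1 R by simp
  have g4: "G * (G * (G * R)) \<le> G * (G * (G * (G * R)))" using mult_right_mono[OF G1, of "G * (G * (G * R))"] G1 R by simp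
  have g5: "G * (G * (G * (G * R))) \<le> G * (G * (G * (G * (G * R))))"
    using mult_right_mono[OF G1, of "G * (G * (G * (G * R)))"] G1 R by simp
  have "bud = G * (G * (G * R))" by (simp add: bud R_def)
  then have budR: "real (nat \<lceil>bud\<rceil>) \<le> 2 * (G * (G * (G * R)))"
    using g1 g2 g3 G1 by linarith
  define W where "W = real N * 300 + real (nat \<lceil>bud\<rceil>) * 300 + 300"
  have W: "W \<le> 1500 * (G * (G * (G * R)))" unfolding W_def using NR budR g1 g2 g3 G1 by linarith
  have "real J * W \<le> G * (1500 * (G * (G * (G * R))))"
    using G W G1 by (intro mult_mono) (auto simp: W_def)
  then have "real J * W + 300 \<le> 1800 * (G * (G * (G * (G * R))))"
    using g1 g2 g3 g4 G1 by linarith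
  then have "(2 * real K + 1) * (real J * W + 300) \<le> G * (1800 * (G * (G * (G * (G * R)))))"
    using G G1 by (intro mult_mono) (auto simp: W_def)
  then have "(2 * real K + 1) * (real J * W + 300) + 306 \<le> 2200 * (G * (G * (G * (G * (G * R)))))"
    using g1 g2 g3 g4 g5 G1 by linarith
  also have "\<dots> \<le> G * (G * (G * (G * (G * (G * R)))))"
    using G R by (intro mult_right_mono) auto
  also have "\<dots> = G ^ 6 * R" by (simp add: eval_nat_numeral)
  finally show ?thesis by (simp add: R_def W_def algebra_simps)
qed

text \<open>The exponent for which n^\<eta> = exp (600 sqrt (ln n + 2)), an upper bound for G^6
  because K \<le> ln n + 2.\<close>

lemma eta_tendsto: "(\<lambda>n. 600 * sqrt (ln (real n) + 2) / ln (real n)) \<longlonglongrightarrow> 0"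
  by real_asymp

lemma cost_bound_ge:
  assumes n: "2 \<le> n" and \<eta>: "\<eta> = 600 * sqrt (ln (real n) + 2) / ln (real n)"
  shows "cost_bound n \<alpha> \<eta> \<epsilon> \<ge> exp (600 * sqrt (ln (real n) + 2)) * (exp (\<alpha> * ln (real n)) / \<epsilon>\<^sup>2)"
    "cost_bound n \<alpha> \<eta> \<epsilon> \<ge> exp (600 * sqrt (ln (real n) + 2))"
proof -
  have ln: "0 < ln (real n)" using n by simp
  then have "real n powr \<eta> = exp (600 * sqrt (ln (real n) + 2))"
    unfolding powr_def \<eta> using n by simp
  moreover have "real n powr \<alpha> = exp (\<alpha> * ln (real n))" unfolding powr_def using n by simp
  ultimately show "cost_bound n \<alpha> \<eta> \<epsilon> \<ge> exp (600 * sqrt (ln (real n) + 2)) * (exp (\<alpha> * ln (real n)) / \<epsilon>\<^sup>2)"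
    "cost_bound n \<alpha> \<eta> \<epsilon> \<ge> exp (600 * sqrt (ln (real n) + 2))"
    by (simp_all add: cost_bound_def powr_add max_def mult.commute)
qed

lemma preprocess_wp:
  "wp \<phi> d m pre_prog Q (init_state (length xs) d \<delta> \<epsilon> xs \<omega>) \<longleftrightarrow> (\<exists>t s. preprocess pre_prog \<phi> d m \<delta> \<epsilon> xs \<omega> t s \<and> Q t s)"
  by (simp add: wp_def preprocess_def)

lemma trivial_structure:
  assumes "1 \<le> \<epsilon>" "10 \<le> Tpre" "20 \<le> Tqry"
  shows "kernel_mean_structure pre_prog qry_prog \<phi> d \<delta> \<epsilon> X 1 Tpre Tqry"
proof -
  let ?s = "\<lambda>xs \<omega>. init_state (length xs) d \<delta> \<epsilon> xs \<omega>"
  have r: "rmem (?s xs \<omega>) 1 = \<epsilon>" for xs \<omega> by (simp add: init_state_def)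
  have pre: "preprocess pre_prog \<phi> d 1 \<delta> \<epsilon> xs \<omega> 7 (?s xs \<omega>)" for xs \<omega>
  proof -
    have "exec \<phi> d 1 pre_prog (?s xs \<omega>) (1 + bcost (RLess (rv 1) (rc 1)) + 1) (?s xs \<omega>)"
      unfolding pre_prog_def by (rule exec.CondFalse) (use r[of xs \<omega>] assms in \<open>simp, intro exec.Skip\<close>)
    then show ?thesis by (simp add: preprocess_def eval_nat_numeral)
  qed
  have qry: "\<exists>t. query qry_prog \<phi> d 1 (?s xs \<omega>) y t 0 \<and> t \<le> 20" for xs \<omega> y
  proof -
    have "wp \<phi> d 1 qry_prog (\<lambda>t s. t \<le> 20 \<and> rmem s 0 = 0) ((?s xs \<omega>)\<lparr>inputs := [y]\<rparr>)"
      unfolding qry_prog_def using r[of xs \<omega>] assms by (simp add: wp_simps)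
    then show ?thesis unfolding wp_def query_def by blast
  qed
  have mean0: "0 \<le> kernel_mean \<phi> d X y" for y
    unfolding kernel_mean_def by (intro mult_nonneg_nonneg sum_nonneg) auto
  interpret T: prob_space "tapes d" by (rule prob_space_tapes)
  show ?thesis
    unfolding kernel_mean_structure_def
  proof (intro allI impI conjI ballI)
    fix xs assume "distinct xs \<and> set xs = X"
    show "AE \<omega> in tapes d. \<exists>t s. preprocess pre_prog \<phi> d 1 \<delta> \<epsilon> xs \<omega> t s \<and> real t \<le> Tpre"
      by (rule AE_I2, intro exI conjI, rule pre) (use assms in simp)
    fix y
    have tq: "\<exists>t'. query qry_prog \<phi> d 1 (?s xs \<omega>) y t' 0 \<and> real t' \<le> Tqry" for \<omega>
    proof -
      obtain t' where "query qry_prog \<phi> d 1 (?s xs \<omega>) y t' 0" "t' \<le> 20" using qry by blast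
      moreover have "real t' \<le> Tqry" using \<open>t' \<le> 20\<close> assms by linarith
      ultimately show ?thesis by blast
    qed
    show "AE \<omega> in tapes d. \<exists>t s t' r. preprocess pre_prog \<phi> d 1 \<delta> \<epsilon> xs \<omega> t s \<and>
        query qry_prog \<phi> d 1 s y t' r \<and> real t' \<le> Tqry"
      by (rule AE_I2) (use pre tq in blast)
    have "rel_approx \<epsilon> (kernel_mean \<phi> d X y) 0"
      using mean0[of y] assms by (auto simp: rel_approx_def mult_le_0_iff)
    then show "\<exists>A\<in>T.events. 2 / 3 \<le> T.prob A \<and> (\<forall>\<omega>\<in>A. \<exists>t s t' r. preprocess pre_prog \<phi> d 1 \<delta> \<epsilon> xs \<omega> t s \<and>
        query qry_prog \<phi> d 1 s y t' r \<and> rel_approx \<epsilon> (kernel_mean \<phi> d X y) r)"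
      using pre tq by (intro bexI[of _ "space (tapes d)"]) (auto simp: T.prob_space, blast)
  qed
qed

theorem theorem1:
  fixes \<delta> :: real
  assumes "\<delta> > 0"
  shows "\<exists>pre qry :: com. \<exists>\<eta> :: nat \<Rightarrow> real. \<eta> \<longlonglongrightarrow> 0 \<and>
    (\<forall>(n::nat) (d::nat) (\<phi> :: real \<Rightarrow> real).
       convex_on {-1..1} \<phi> \<and> (\<exists>L. L-lipschitz_on {-1..1} \<phi>) \<and>
       lipschitz_const {-1..1} \<phi> < (1 - \<delta>) * ln (real n) \<longrightarrow>
       (\<forall>\<epsilon>>0. \<forall>X. X \<subseteq> unit_sphere d \<and> finite X \<and> card X = n \<longrightarrow>
          (\<exists>m::nat. real m \<le> cost_bound n (2 - \<delta>) (\<eta> n) \<epsilon> \<and>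
             kernel_mean_structure pre qry \<phi> d \<delta> \<epsilon> X m
               (cost_bound n (2 - \<delta>) (\<eta> n) \<epsilon>) (cost_bound n (1 - \<delta>) (\<eta> n) \<epsilon>))))"
proof -
  define \<eta> where "\<eta> = (\<lambda>n. 600 * sqrt (ln (real n) + 2) / ln (real n))"
  have "\<exists>m::nat. real m \<le> cost_bound n (2 - \<delta>) (\<eta> n) \<epsilon> \<and>
      kernel_mean_structure pre_prog qry_prog \<phi> d \<delta> \<epsilon> X m
        (cost_bound n (2 - \<delta>) (\<eta> n) \<epsilon>) (cost_bound n (1 - \<delta>) (\<eta> n) \<epsilon>)"
    if lip: "\<exists>L. L-lipschitz_on {-1..1} \<phi>" and lc: "lipschitz_const {-1..1} \<phi> < (1 - \<delta>) * ln (real n)"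
      and \<epsilon>: "0 < \<epsilon>" and X: "X \<subseteq> unit_sphere d" "finite X" "card X = n"
    for n d :: nat and \<phi> :: "real \<Rightarrow> real" and \<epsilon> X
  proof -
    let ?L = "lipschitz_const {-1..1} \<phi>" and ?Tp = "cost_bound n (2 - \<delta>) (\<eta> n) \<epsilon>"
      and ?Tq = "cost_bound n (1 - \<delta>) (\<eta> n) \<epsilon>"
    define \<Lambda> where "\<Lambda> = (1 - \<delta>) * ln (real n)"
    have L: "?L-lipschitz_on {-1..1} \<phi>" using lip by (rule lipschitz_const_attained)
    have L0: "0 \<le> ?L" using L by (rule lipschitz_on_nonneg)
    then have \<Lambda>0: "0 < \<Lambda>" using lc by (simp add: \<Lambda>_def)
    \<comment> \<open>Lipschitz constants are nonnegative, so the hypothesis forces (1 - \<delta>)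
      ln n > 0; for n \<le> 1 the logarithm is 0, at n = 0 by its default value.\<close>
    have n2: "2 \<le> n"
    proof (rule ccontr)
      assume "\<not> 2 \<le> n"
      then have "n = 0 \<or> n = 1" by linarith
      then show False using \<Lambda>0 by (auto simp: \<Lambda>_def)
    qed
    then have ln0: "0 < ln (real n)" by simp
    have \<Lambda>1: "\<Lambda> \<le> ln (real n)" using ln0 assms by (simp add: \<Lambda>_def algebra_simps)
    define p where "p = sqrt (ln (real n) + 2)"
    have p: "1 \<le> p" using ln0 by (simp add: p_def)
    have cost: "exp (600 * p) * (exp (\<alpha> * ln (real n)) / (\<epsilon> * \<epsilon>)) \<le> cost_bound n \<alpha> (\<eta> n) \<epsilon>"
      "exp (600 * p) \<le> cost_bound n \<alpha> (\<eta> n) \<epsilon>" for \<alpha>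
      using cost_bound_ge[OF n2 refl, of \<alpha> \<epsilon>] by (simp_all add: \<eta>_def p_def power2_eq_square)
    have "600 \<le> exp (600 * p)" using exp_ge_add_one_self[of "600 * p"] p by linarith
    \<comment> \<open>The floor n^\<eta> pays for the constant running time when \<epsilon> \<ge>
      1.\<close>
    then have floor: "600 \<le> cost_bound n \<alpha> (\<eta> n) \<epsilon>" for \<alpha> using cost(2)[of \<alpha>] by linarith
    show ?thesis
    proof (cases "\<epsilon> < 1")
      case False
      then show ?thesis
        using floor[of "2 - \<delta>"] floor[of "1 - \<delta>"] by (intro exI[of _ 1] conjI trivial_structure) auto
    next
      case True
      define K where "K = max 2 (nat \<lceil>ln (real n)\<rceil>)"
      define G where "G = exp (100 * exp (ln (real K) / 2))"
      define N where "N = nat \<lceil>G * exp \<Lambda>\<rceil>"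
      define B where "B = nat \<lceil>G / (\<epsilon> * \<epsilon>)\<rceil>"
      define M where "M = 2 * n * B"
      define bud where "bud = G * (G * G) * exp \<Lambda> / (\<epsilon> * \<epsilon>)"
      \<comment> \<open>The first address behind the table.\<close>
      define m where "m = list_base M ((2 * K + 1) * N)"
      have K: "2 \<le> K" "ln (real n) \<le> real K" "real K \<le> ln (real n) + 2"
        using ln0 unfolding K_def by linarith+
      have sqrtK: "exp (ln (real K) / 2) = sqrt (real K)"
        using K by (simp add: ln_sqrt[symmetric])
      then have G: "G = exp (100 * sqrt (real K))" by (simp add: G_def)
      have instance_for: "kernel_instance \<phi> d xs y \<epsilon> \<Lambda> G bud K B"
        if xs: "distinct xs" "set xs = X" and y: "y \<in> unit_sphere d" for xs y
      proof
        show "\<bar>\<phi> a - \<phi> b\<bar> \<le> \<Lambda> * \<bar>a - b\<bar>" if "a \<in> {-1..1}" "b \<in> {-1..1}" for a b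
        proof -
          have "\<bar>\<phi> a - \<phi> b\<bar> \<le> ?L * \<bar>a - b\<bar>" using lipschitz_onD[OF L that] by (simp add: dist_real_def)
          also have "\<dots> \<le> \<Lambda> * \<bar>a - b\<bar>" using lc by (intro mult_right_mono) (auto simp: \<Lambda>_def)
          finally show ?thesis .
        qed
      qed (use xs X y n2 K \<Lambda>0 \<Lambda>1 \<epsilon> G B_def bud_def distinct_card[OF xs(1)] in auto)
      have "sqrt (real K) \<le> p" unfolding p_def using K by simp
      then have G6: "G ^ 6 \<le> exp (600 * p)" by (simp add: G flip: exp_of_nat_mult)
      have G3: "3000 \<le> G" "2 * real K + 1 \<le> G" "4 * real K \<le> G"
      proof -
        have c: "36 * real K * (2 * real K + 1) ^ 3 \<le> G"
        proof -
          have "(7 / 5)\<^sup>2 \<le> real K" using K by (simp add: power2_eq_square)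
          then have "7 / 5 \<le> sqrt (real K)" by (rule real_le_rsqrt)
          then show ?thesis unfolding G by (intro constants_le_exp) auto
        qed
        have "5 ^ 3 \<le> (2 * real K + 1) ^ 3" using K by (intro power_mono) auto
        then have "(36 * real K) * 5 ^ 3 \<le> 36 * real K * (2 * real K + 1) ^ 3"
          by (intro mult_left_mono) auto
        then have "4500 * real K \<le> G" using c by simp
        moreover have "2 \<le> real K" using K by simp
        ultimately show "3000 \<le> G" "2 * real K + 1 \<le> G" "4 * real K \<le> G" by auto
      qed
      have E1: "1 \<le> exp \<Lambda>" using \<Lambda>0 by simp
      have N2: "real N \<le> 2 * (G * exp \<Lambda>)"
      proof -
        have "1 * 1 \<le> G * exp \<Lambda>" using G3 E1 by (intro mult_mono) auto
        then show ?thesis unfolding N_def by linarith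
      qed
      have B2: "real B \<le> 2 * (G / (\<epsilon> * \<epsilon>))"
      proof -
        have "\<epsilon> * \<epsilon> \<le> 1 * 1" using \<epsilon> True by (intro mult_mono) auto
        then have "1 * (\<epsilon> * \<epsilon>) \<le> G" using G3 by linarith
        then have "1 \<le> G / (\<epsilon> * \<epsilon>)" using \<epsilon> by (subst pos_le_divide_eq) auto
        then show ?thesis unfolding B_def by linarith
      qed
      have n1: "1 \<le> n" using n2 by simp
      have pows: "exp ((2 - \<delta>) * ln (real n)) = real n * exp \<Lambda>" "exp ((1 - \<delta>) * ln (real n)) = exp \<Lambda>"
      proof -
        have "(2 - \<delta>) * ln (real n) = ln (real n) + \<Lambda>" by (simp add: \<Lambda>_def algebra_simps)
        then show "exp ((2 - \<delta>) * ln (real n)) = real n * exp \<Lambda>" using n2 by (simp add: exp_add)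
      qed (simp add: \<Lambda>_def)
      have scale: "G ^ 6 * (z / (\<epsilon> * \<epsilon>)) \<le> exp (600 * p) * (z / (\<epsilon> * \<epsilon>))" if "0 \<le> z" for z
        using G6 that \<epsilon> by (intro mult_right_mono) auto
      note build = build_cost_bounds[OF n1 G3(1,2) E1 \<epsilon> True N2 B2 M_def]
      have mT: "real m \<le> ?Tp" and preT: "real (pre_time K N B M + 6) \<le> ?Tp"
        using build scale[of "real n * exp \<Lambda>"] cost(1)[of "2 - \<delta>"] unfolding pows m_def by simp_all
      have m20: "20 + M \<le> m" "20 < m"
      proof -
        show "20 + M \<le> m" by (simp add: m_def list_base_def)
        have "0 < G * exp \<Lambda>" using G3 by simp
        then have "1 \<le> N" unfolding N_def by linarith
        then show "20 < m" by (simp add: m_def list_base_def)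
      qed
      have pre: "\<exists>t s. preprocess pre_prog \<phi> d m \<delta> \<epsilon> xs \<omega> t s \<and> real t \<le> ?Tp \<and>
          prepared d n K N B M \<epsilon> G \<Lambda> bud (\<lambda>f. snd \<omega> !! f) (\<lambda>j. pick d xs (fst \<omega> !! j)) s"
        if "distinct xs" "set xs = X" for xs \<omega>
      proof -
        have n: "n = length xs" using that X distinct_card by metis
        have "rmem (init_state n d \<delta> \<epsilon> xs \<omega>) 1 < 1" using True by (simp add: init_state_def)
        then have "wp \<phi> d m pre_prog (\<lambda>t s. t \<le> pre_time K N B M + 6 \<and>
            prepared d n K N B M \<epsilon> G \<Lambda> bud (\<lambda>f. snd \<omega> !! f) (\<lambda>j. pick d xs (fst \<omega> !! j)) s)
          (init_state n d \<delta> \<epsilon> xs \<omega>)"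
          unfolding pre_prog_def wp_Cond
          using wp_pre_main[OF n \<Lambda>_def K_def G_def N_def B_def M_def bud_def, of m \<phi> d \<omega>] m_def
          by (auto elim!: wp_mono)
        then show ?thesis
          unfolding n preprocess_wp using preT unfolding n by (smt (verit) of_nat_mono)
      qed
      have qry: "\<exists>t'. query qry_prog \<phi> d m s y t'
            (search.answer \<phi> d n K B G \<Lambda> bud gs sm y) \<and> real t' \<le> ?Tq"
        if prep: "prepared d n K N B M \<epsilon> G \<Lambda> bud gs sm s" for s y gs sm
      proof -
        interpret S: prepared_search \<phi> d n K N B M G \<Lambda> bud gs sm y m \<epsilon> s
        proof
          fix k assume k: "k < 2 * K + 1"
          have "exp (\<Lambda> * radius K k) \<le> exp \<Lambda>"
            using radius_bounds[OF k] K \<Lambda>0 by (simp add: mult_left_le)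
          then have "G * exp (\<Lambda> * radius K k) \<le> G * exp \<Lambda>" using G3 by (intro mult_left_mono) auto
          then show "search.nfilters K G \<Lambda> k \<le> N"
            unfolding search.nfilters_def N_def by (intro nat_mono ceiling_mono)
        qed (use prep m20 M_def in auto)
        have "S.nlevels \<le> 4 * K"
          unfolding S.nlevels_def using n1 K by (intro least_doubling_le) auto
        then have J: "real S.nlevels \<le> G" using G3 by linarith
        have "real (S.qry_time + 6) \<le> G ^ 6 * (exp \<Lambda> / (\<epsilon> * \<epsilon>))"
          using query_cost_bound[OF G3(1,2) J E1 \<epsilon> True N2 bud_def] unfolding S.qry_time_def by simp
        then have T: "real (S.qry_time + 6) \<le> ?Tq"
          using scale[of "exp \<Lambda>"] cost(1)[of "1 - \<delta>"] unfolding pows by simp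
        have "rmem s 1 < 1" using prep True by (simp add: prepared_def)
        then have "wp \<phi> d m qry_prog (\<lambda>t s'. t \<le> S.qry_time + 6 \<and> rmem s' 0 = S.answer) (s\<lparr>inputs := [y]\<rparr>)"
          unfolding qry_prog_def wp_Cond using S.wp_qry_main[OF refl] by (auto elim!: wp_mono)
        then obtain t' s' where "exec \<phi> d m qry_prog (s\<lparr>inputs := [y]\<rparr>) t' s'" "t' \<le> S.qry_time + 6" "rmem s' 0 = S.answer"
          unfolding wp_def by blast
        moreover have "real t' \<le> ?Tq" using \<open>t' \<le> S.qry_time + 6\<close> T by linarith
        ultimately show ?thesis unfolding query_def by blast
      qed
      have "kernel_mean_structure pre_prog qry_prog \<phi> d \<delta> \<epsilon> X m ?Tp ?Tq"
        unfolding kernel_mean_structure_def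
      proof (intro allI impI conjI ballI)
        fix xs assume xs: "distinct xs \<and> set xs = X"
        then have n: "n = length xs" using X distinct_card by metis
        show "AE \<omega> in tapes d. \<exists>t s. preprocess pre_prog \<phi> d m \<delta> \<epsilon> xs \<omega> t s \<and> real t \<le> ?Tp"
          by (rule AE_I2) (use pre[of xs] xs in blast)
        fix y assume y: "y \<in> unit_sphere d"
        show "AE \<omega> in tapes d. \<exists>t s t' r. preprocess pre_prog \<phi> d m \<delta> \<epsilon> xs \<omega> t s \<and>
            query qry_prog \<phi> d m s y t' r \<and> real t' \<le> ?Tq"
          by (rule AE_I2) (use pre[of xs] qry xs in blast)
        interpret I: kernel_instance \<phi> d xs y \<epsilon> \<Lambda> G bud K B
          by (rule instance_for) (use xs y in auto)
        have approx: "rel_approx \<epsilon> (kernel_mean \<phi> d X y)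
            (search.answer \<phi> d n K B G \<Lambda> bud (\<lambda>f. snd \<omega> !! f) (\<lambda>j. pick d xs (fst \<omega> !! j)) y)"
          if "\<omega> \<in> I.good M" for \<omega>
          using I.good_answer[OF True _ that] xs unfolding n[symmetric]
          by (auto simp: M_def rel_approx_def I.total_def abs_le_iff algebra_simps)
        show "\<exists>A\<in>sets (tapes d). 2 / 3 \<le> measure (tapes d) A \<and>
            (\<forall>\<omega>\<in>A. \<exists>t s t' r. preprocess pre_prog \<phi> d m \<delta> \<epsilon> xs \<omega> t s \<and>
              query qry_prog \<phi> d m s y t' r \<and> rel_approx \<epsilon> (kernel_mean \<phi> d X y) r)"
        proof (intro bexI[of _ "I.good M"] conjI ballI)
          fix \<omega> assume "\<omega> \<in> I.good M"
          then show "\<exists>t s t' r. preprocess pre_prog \<phi> d m \<delta> \<epsilon> xs \<omega> t s \<and>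
              query qry_prog \<phi> d m s y t' r \<and> rel_approx \<epsilon> (kernel_mean \<phi> d X y) r"
            using approx pre[of xs \<omega>] qry xs by blast
        qed (rule I.measure_good[OF True])+
      qed
      then show ?thesis using mT by blast
    qed
  qed
  moreover have "\<eta> \<longlonglongrightarrow> 0" unfolding \<eta>_def by (rule eta_tendsto)
  ultimately show ?thesis by (intro exI[of _ pre_prog] exI[of _ qry_prog] exI[of _ \<eta>]) auto
qed

end
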